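(* (i) For every linear map $\Delta\in\mathbb{R}^{q\times p}$, $SGW_\Delta$ and $RISGW$ (defined for $\mu\in\mathcal{P}(\mathbb{R}^p)$, $\nu\in\mathcal{P}(\mathbb{R}^q)$) are translation invariant, i.e. unchanged when $\mu$ or $\nu$ is replaced by a translate. $RISGW$ is also rotation invariant when $p=q$: for every orthogonal matrix $\mathbf{Q}\in\mathcal{O}(p)$, $RISGW(\mathbf{Q}\#\mu,\nu)=RISGW(\mu,\nu)$, and likewise for any $\mathbf{Q}'\in\mathcal{O}(q)$ applied to $\nu$. (ii) $SGW$ and $RISGW$ are pseudo-distances on $\mathcal{P}(\mathbb{R}^p)$, i.e. they are symmetric, satisfy the triangle inequality, and $SGW(\mu,\mu)=RISGW(\mu,\mu)=0$. (iii) Let $\mu,\nu\in\mathcal{P}(\mathbb{R}^p)$ have compact supports. If $SGW(\mu,\nu)=0$, then $\mu$ and $\nu$ are isomorphic for the distance $d(\mathbf{x},\mathbf{x}')=\sum_{i=1}^p|x_i-x_i'|$ induced by the $\ell_1$ norm on $\mathbb{R}^p$. In particular $SGW(\mu,\nu)=0\implies GW_2(d,d,\mu,\nu)=0$.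
   Context: $\mathcal{P}(\cdot)$ denotes probability measures, $\#$ push-forward; a matrix is identified with its linear map. For measures $\mu,\nu$ on $\mathcal{X},\mathcal{Y}$ and functions $c_{\mathcal{X}}:\mathcal{X}\times\mathcal{X}\to\mathbb{R}$, $c_{\mathcal{Y}}:\mathcal{Y}\times\mathcal{Y}\to\mathbb{R}$, $$GW_2(c_{\mathcal{X}},c_{\mathcal{Y}},\mu,\nu)=\Big(\inf_{\pi\in\Pi(\mu,\nu)}\iint|c_{\mathcal{X}}(x,x')-c_{\mathcal{Y}}(y,y')|^2d\pi(x,y)d\pi(x',y')\Big)^{1/2},$$ with $\Pi(\mu,\nu)$ the set of couplings. For $\theta$ in the unit sphere $\mathbb{S}^{q-1}$ of $\mathbb{R}^q$ let $P_\theta(\mathbf{x})=\langle\mathbf{x},\theta\rangle$ and let $\lambda_{q-1}$ be the uniform probability measure on $\mathbb{S}^{q-1}$. For $\Delta\in\mathbb{R}^{q\times p}$, the Sliced Gromov-Wasserstein discrepancy is $$SGW_\Delta(\mu,\nu)=\int_{\mathbb{S}^{q-1}}GW_2^2\big(c,c,P_\theta\#(\Delta\#\mu),P_\theta\#\nu\big)\,d\lambda_{q-1}(\theta),\qquad c(s,t)=|s-t|^2\ \text{on }\mathbb{R}.$$ When $p=q$, $SGW=SGW_{\mathbf{I}_p}$. For $p\le q$, with the Stiefel manifold $\mathbb{V}_p(\mathbb{R}^q)=\{\Delta\in\mathbb{R}^{q\times p}:\Delta^T\Delta=\mathbf{I}_p\}$, the rotation invariant variant is $RISGW(\mu,\nu)=\min_{\Delta\in\mathbb{V}_p(\mathbb{R}^q)}SGW_\Delta(\mu,\nu)$.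 $\mu$ and $\nu$ are isomorphic for $d$ if there is a bijection $f:\mathrm{supp}(\mu)\to\mathrm{supp}(\nu)$ with $f\#\mu=\nu$ and $d(f(\mathbf{x}),f(\mathbf{x}'))=d(\mathbf{x},\mathbf{x}')$ for all $\mathbf{x},\mathbf{x}'\in\mathrm{supp}(\mu)$.
   Formalization: The triangle inequality in (ii) is proved for the square roots of SGW and RISGW, since for SGW and RISGW themselves it fails: for δ₀, (δ₀+δ_{e₁})/2, (δ₀+δ_{2e₁})/2 it would require 8K ≤ 5K with K = ∫θ₁⁴ dλ > 0. *)

theory Defs
  imports "HOL-Probability.Probability"
begin

text \<open>No moments are assumed, so all discrepancies take values in \<open>[0, \<infinity>]\<close>.\<close>

definition ennreal_sqrt :: "ennreal \<Rightarrow> ennreal" where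
  "ennreal_sqrt x = (if x = \<infinity> then \<infinity> else ennreal (sqrt (enn2real x)))"

abbreviation borel_probs :: "'a::topological_space measure set" where
  "borel_probs \<equiv> space (prob_algebra borel)"

definition couplings :: "'a measure \<Rightarrow> 'b measure \<Rightarrow> ('a \<times> 'b) measure set" where
  "couplings \<mu> \<nu> =
     {\<pi>. sets \<pi> = sets (\<mu> \<Otimes>\<^sub>M \<nu>) \<and> distr \<pi> \<mu> fst = \<mu> \<and> distr \<pi> \<nu> snd = \<nu>}"

definition GW2 ::
  "('a \<Rightarrow> 'a \<Rightarrow> real) \<Rightarrow> ('b \<Rightarrow> 'b \<Rightarrow> real) \<Rightarrow> 'a measure \<Rightarrow> 'b measure \<Rightarrow> ennreal" where
  "GW2 cX cY \<mu> \<nu> = ennreal_sqrt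
     (INF \<pi>\<in>couplings \<mu> \<nu>.
        \<integral>\<^sup>+ (x', y'). (\<integral>\<^sup>+ (x, y). ennreal (\<bar>cX x x' - cY y y'\<bar>\<^sup>2) \<partial>\<pi>) \<partial>\<pi>)"

text \<open>The uniform probability measure on the unit sphere, as a Borel measure on the whole
  space concentrated on the sphere: the radial projection of the uniform distribution on the
  unit ball. (In dimension one it is the uniform distribution on \<open>{-1, 1}\<close>.)\<close>

definition sphere_unif :: "'a::euclidean_space measure" where
  "sphere_unif = distr (uniform_measure lborel (ball 0 1)) borel (\<lambda>x. x /\<^sub>R norm x)"

definition proj :: "'a::euclidean_space \<Rightarrow> 'a \<Rightarrow> real" where
  "proj \<theta> x = x \<bullet> \<theta>"

definition sqdist :: "real \<Rightarrow> real \<Rightarrow> real" where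
  "sqdist s t = \<bar>s - t\<bar>\<^sup>2"

definition lin_push :: "real^'p^'q \<Rightarrow> (real^'p) measure \<Rightarrow> (real^'q) measure" where
  "lin_push \<Delta> \<mu> = distr \<mu> borel (\<lambda>x. \<Delta> *v x)"

definition translate :: "'a::euclidean_space \<Rightarrow> 'a measure \<Rightarrow> 'a measure" where
  "translate a \<mu> = distr \<mu> borel (\<lambda>x. x + a)"

definition SGW_lin :: "real^'p^'q \<Rightarrow> (real^'p) measure \<Rightarrow> (real^'q) measure \<Rightarrow> ennreal" where
  "SGW_lin \<Delta> \<mu> \<nu> =
     (\<integral>\<^sup>+ \<theta>. (GW2 sqdist sqdist (distr (lin_push \<Delta> \<mu>) borel (proj \<theta>))
                              (distr \<nu> borel (proj \<theta>)))\<^sup>2 \<partial>sphere_unif)"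

definition SGW :: "(real^'p) measure \<Rightarrow> (real^'p) measure \<Rightarrow> ennreal" where
  "SGW \<mu> \<nu> = SGW_lin (mat 1) \<mu> \<nu>"

definition stiefel :: "(real^'p^'q) set" where
  "stiefel = {\<Delta>. transpose \<Delta> ** \<Delta> = mat 1}"

text \<open>Meaningful for \<open>CARD('p) \<le> CARD('q)\<close>; otherwise \<open>stiefel\<close> is empty. The minimum over
  the compact Stiefel manifold is written as an infimum in \<open>[0, \<infinity>]\<close>.\<close>

definition RISGW :: "(real^'p) measure \<Rightarrow> (real^'q) measure \<Rightarrow> ennreal" where
  "RISGW \<mu> \<nu> = (INF \<Delta>\<in>stiefel. SGW_lin \<Delta> \<mu> \<nu>)"

definition supp :: "'a::topological_space measure \<Rightarrow> 'a set" where
  "supp \<mu> = {x. \<forall>U. open U \<longrightarrow> x \<in> U \<longrightarrow> emeasure \<mu> U > 0}"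

text \<open>The map \<open>f\<close> is only relevant on \<open>supp \<mu>\<close>, so the push-forward is taken from the
  restriction of \<open>\<mu>\<close> to its support.\<close>

definition isomorphic_for ::
  "('a::topological_space \<Rightarrow> 'a \<Rightarrow> real) \<Rightarrow> 'a measure \<Rightarrow> 'a measure \<Rightarrow> bool" where
  "isomorphic_for d \<mu> \<nu> \<longleftrightarrow>
     (\<exists>f. bij_betw f (supp \<mu>) (supp \<nu>) \<and>
          f \<in> restrict_space \<mu> (supp \<mu>) \<rightarrow>\<^sub>M borel \<and>
          distr (restrict_space \<mu> (supp \<mu>)) borel f = \<nu> \<and>
          (\<forall>x\<in>supp \<mu>. \<forall>x'\<in>supp \<mu>. d (f x) (f x') = d x x'))"

definition l1_dist :: "real^'p \<Rightarrow> real^'p \<Rightarrow> real" where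
  "l1_dist x x' = (\<Sum>i\<in>UNIV. \<bar>x $ i - x' $ i\<bar>)"

end

theory Submission imports Defs
begin

text \<open>The one-dimensional couplings form a compact set: a Borel injection of the plane into the line
  with uniformly continuous inverse reduces Prokhorov's and Skorohod's theorems to the real case.
  Hence \<open>\<theta> \<mapsto> GW\<^sub>2(P\<^sub>\<theta>#\<mu>, P\<^sub>\<theta>#\<nu>)\<close> is lower semicontinuous, so
  measurable, optimal couplings exist, and couplings with a common marginal can be glued as limits
  of discretised gluings; this gives the triangle inequality, which Minkowski's inequality carries
  over to the sphere. Invariance and symmetry follow from the rotation invariance of the sphere.

  If \<open>SGW(\<mu>, \<nu>) = 0\<close>, then in almost every direction an optimal coupling lies on the graph of an
  isometry \<open>t = \<plusminus>s + c\<close> of the line. After centring, the \<open>k\<close>-th directional moments of \<open>\<nu>\<close> are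
  \<open>(\<plusminus>1)\<^sup>k\<close> times those of \<open>\<mu>\<close>. These moments are polynomials in the direction, so one sign works for
  all directions, and moments determine a compactly supported measure: \<open>\<nu>\<close> is the image of \<open>\<mu>\<close>
  under \<open>x \<mapsto> \<plusminus>(x - a) + b\<close>, an isometry for every norm.\<close>

section \<open>A coding of the plane by real numbers\<close>

text \<open>The slicing integral is a nonnegative Lebesgue integral, so Minkowski's inequality over
  the sphere and the passage from \<open>SGW \<mu> \<nu> = 0\<close> to almost every direction both
  require an integrand measurable in the direction. An infimum over couplings that change with the
  direction gives no measurability by itself; closed sublevel sets do, and these come from
  compactness. The same compactness argument, applied to a constant sequence of directions, yields
  optimal couplings, and applied to gluings over ever finer cells it takes the place of
  disintegration. Since \<open>SGW\<close> integrates the square of \<open>GW2\<close>, it is the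
  square root that satisfies the triangle inequality.\<close>

text \<open>Boundedness on bounded sets keeps push-forwards of tight families tight. The
  \<epsilon>-\<delta> clause is uniform continuity of the inverse on the range and entails
  injectivity. Of the code itself only Borel measurability is asked, since a continuous injection of
  the plane into the line does not exist.\<close>

definition coding :: "('a::metric_space \<Rightarrow> real) \<Rightarrow> bool" where
  "coding e \<longleftrightarrow> e \<in> borel_measurable borel \<and> (\<forall>S. bounded S \<longrightarrow> bounded (e ` S)) \<and>
     (\<forall>\<epsilon>>0. \<exists>\<delta>>0. \<forall>p q. \<bar>e p - e q\<bar> < \<delta> \<longrightarrow> dist p q < \<epsilon>)"

text \<open>Base 5 is used with the digits 0 to 3: leaving out the digit 4 makes the range a Cantor
  set, so that expansions with different leading digits stay apart. In base 4 the double expansions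
  of one number would spoil the inverse.\<close>

definition quinary :: "(nat \<Rightarrow> int) \<Rightarrow> real" where
  "quinary d = (\<Sum>k. real_of_int (d k) / 5 ^ Suc k)"

lemma quinary_summable:
  assumes "\<And>k. 0 \<le> d k \<and> d k \<le> 3"
  shows "summable (\<lambda>k. real_of_int (d k) / 5 ^ Suc k)"
proof (rule summable_comparison_test')
  show "summable (\<lambda>k. (3/5) * (1/5::real) ^ k)"
    by (intro summable_mult summable_geometric) auto
  show "norm (real_of_int (d k) / 5 ^ Suc k) \<le> (3/5) * (1/5) ^ k" if "k \<ge> 0" for k
    using assms[of k] by (simp add: field_simps)
qed

lemma quinary_bounds:
  assumes "\<And>k. 0 \<le> d k \<and> d k \<le> 3"
  shows "0 \<le> quinary d" "quinary d \<le> 3/4"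
proof -
  show "0 \<le> quinary d"
    unfolding quinary_def using assms by (intro suminf_nonneg quinary_summable) auto
  have s: "(\<lambda>k. (3/5) * (1/5::real) ^ k) sums ((3/5) * (1 / (1 - 1/5)))"
    by (intro sums_mult geometric_sums) auto
  have "quinary d \<le> (\<Sum>k. (3/5) * (1/5) ^ k)"
    unfolding quinary_def
    using assms by (intro suminf_le quinary_summable sums_summable[OF s]) (auto simp: field_simps)
  also have "\<dots> = 3/4" using sums_unique[OF s] by simp
  finally show "quinary d \<le> 3/4" .
qed

lemma quinary_Suc:
  assumes "\<And>k. 0 \<le> d k \<and> d k \<le> 3"
  shows "quinary d = (real_of_int (d 0) + quinary (\<lambda>k. d (Suc k))) / 5"
proof -
  have "quinary d = (\<Sum>k. real_of_int (d (Suc k)) / 5 ^ Suc (Suc k)) + real_of_int (d 0) / 5"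
    unfolding quinary_def using suminf_split_head[OF quinary_summable[of d, OF assms]] by simp
  also have "(\<Sum>k. real_of_int (d (Suc k)) / 5 ^ Suc (Suc k)) = quinary (\<lambda>k. d (Suc k)) / 5"
    unfolding quinary_def
    using suminf_divide[OF quinary_summable[of "\<lambda>k. d (Suc k)"], of 5] assms
    by (simp add: field_simps)
  finally show ?thesis by (simp add: add_divide_distrib)
qed

text \<open>The fractional parts fill at most [0, 3/4], which leaves a gap of length 1/4 below each
  integer; this is the origin of the constant.\<close>

lemma quinary_gap:
  fixes m n :: int
  assumes "\<And>k. 0 \<le> d k \<and> d k \<le> 3" "\<And>k. 0 \<le> d' k \<and> d' k \<le> 3"
    and "\<bar>(m + quinary d) - (n + quinary d')\<bar> < 1 / 4"
  shows "m = n"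
proof -
  have "\<bar>real_of_int (m - n)\<bar> < 1"
    using assms(3) quinary_bounds[of d, OF assms(1)] quinary_bounds[of d', OF assms(2)]
    unfolding of_int_diff by linarith
  then show ?thesis by linarith
qed

text \<open>Removing the leading digit multiplies distances by 5, whence the bound 1/(4 * 5^n) for n
  digits. After this scaling the leading digit plays the part of the integer in
  \<open>quinary_gap\<close>.\<close>

lemma quinary_digits_eq:
  assumes "\<And>k. 0 \<le> d k \<and> d k \<le> 3" "\<And>k. 0 \<le> d' k \<and> d' k \<le> 3"
    and "\<bar>quinary d - quinary d'\<bar> < 1 / (4 * 5 ^ n)"
  shows "\<forall>k<n. d k = d' k"
  using assms
proof (induction n arbitrary: d d')
  case (Suc n)
  let ?s = "\<lambda>d k. d (Suc k) :: int"
  have eq: "quinary d - quinary d' =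
      ((d 0 + quinary (?s d)) - (d' 0 + quinary (?s d'))) / 5"
    by (simp add: quinary_Suc[of d, OF Suc.prems(1)] quinary_Suc[of d', OF Suc.prems(2)]
        diff_divide_distrib)
  then have *: "\<bar>(d 0 + quinary (?s d)) - (d' 0 + quinary (?s d'))\<bar> < 1 / (4 * 5 ^ n)"
    using Suc.prems(3) by (simp only: eq abs_divide) (simp add: field_simps)
  also have "1 / (4 * 5 ^ n) \<le> (1/4::real)" by (simp add: field_simps)
  finally have 0: "d 0 = d' 0"
    using Suc.prems by (intro quinary_gap[of "?s d" "?s d'"]) auto
  have "\<forall>k<n. ?s d k = ?s d' k"
    using * 0 Suc.prems by (intro Suc.IH) auto
  with 0 show ?case by (auto simp: less_Suc_eq_0_disj)
qed simp

lemma two_digits_unique: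
  fixes a b c d :: int
  assumes "a + 2 * b = c + 2 * d" "0 \<le> a \<and> a \<le> 1" "0 \<le> c \<and> c \<le> 1"
  shows "a = c \<and> b = d"
  using assms by presburger

text \<open>Position 0 is the first binary digit after the point. As the floor rounds downwards, the
  digits are 0 or 1 for negative numbers too.\<close>

definition bin_digit :: "nat \<Rightarrow> real \<Rightarrow> int" where
  "bin_digit k x = \<lfloor>2 ^ Suc k * x\<rfloor> - 2 * \<lfloor>2 ^ k * x\<rfloor>"

lemma bin_digit_bounds: "0 \<le> bin_digit k x \<and> bin_digit k x \<le> 1"
  unfolding bin_digit_def power_Suc mult.assoc by linarith

text \<open>The integer part and the first n digits determine the floor of 2^n * x, and numbers with
  the same floor differ by less than 1.\<close>

lemma bin_digits_dist:
  assumes "\<lfloor>x\<rfloor> = \<lfloor>y\<rfloor>" "\<forall>k<n. bin_digit k x = bin_digit k y"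
  shows "\<bar>x - y\<bar> < 1 / 2 ^ n"
proof -
  have "\<lfloor>2 ^ n * x\<rfloor> = \<lfloor>2 ^ n * y\<rfloor>" using assms(2)
  proof (induction n)
    case (Suc n)
    then have "\<lfloor>2 ^ n * x\<rfloor> = \<lfloor>2 ^ n * y\<rfloor>" "bin_digit n x = bin_digit n y" by auto
    then show ?case unfolding bin_digit_def by linarith
  qed (use assms in simp)
  then have "\<bar>2 ^ n * x - 2 ^ n * y\<bar> < 1" by linarith
  then have "2 ^ n * \<bar>x - y\<bar> < 1" by (simp add: abs_mult flip: right_diff_distrib)
  then show ?thesis by (simp add: field_simps)
qed

text \<open>The integer part of the code numbers the unit square that contains the point, and each
  quinary digit packs one binary digit of either coordinate as a + 2b. Points in different squares
  get codes at distance at least 1/4, however close the points are; only the inverse has to be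
  continuous.\<close>

lemma coding_real_pair: "\<exists>e :: real \<times> real \<Rightarrow> real. coding e"
proof -
  define c :: "int \<times> int \<Rightarrow> int" where "c = (\<lambda>p. int (to_nat p))"
  define d where "d = (\<lambda>(x, y) k. bin_digit k x + 2 * bin_digit k y)"
  define e where "e = (\<lambda>p. real_of_int (c (\<lfloor>fst p\<rfloor>, \<lfloor>snd p\<rfloor>)) + quinary (d p))"
  have d: "0 \<le> d p k \<and> d p k \<le> 3" for p k
    using bin_digit_bounds[of k "fst p"] bin_digit_bounds[of k "snd p"]
    by (cases p) (auto simp: d_def)
  have meas: "e \<in> borel_measurable borel"
    unfolding e_def quinary_def d_def bin_digit_def case_prod_beta borel_prod[symmetric]
    by measurable
  have bdd: "bounded (e ` S)" if S: "bounded S" for S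
  proof -
    obtain B where B: "\<And>p. p \<in> S \<Longrightarrow> norm p \<le> B" using S by (auto simp: bounded_iff)
    \<comment> \<open>A bounded set meets finitely many unit squares, so their numbers are bounded
      although the numbering ignores geometry.\<close>
    define F where "F = c ` ({\<lfloor>-B\<rfloor>..\<lfloor>B\<rfloor>} \<times> {\<lfloor>-B\<rfloor>..\<lfloor>B\<rfloor>})"
    have "finite F" by (simp add: F_def)
    then have "bounded (real_of_int ` F)" by (intro finite_imp_bounded) auto
    then obtain C where C: "\<And>i. i \<in> F \<Longrightarrow> \<bar>real_of_int i\<bar> \<le> C" by (auto simp: bounded_iff)
    have "norm (e p) \<le> C + 1" if "p \<in> S" for p
    proof -
      have "\<bar>fst p\<bar> \<le> B" "\<bar>snd p\<bar> \<le> B"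
        using B[OF that] norm_fst_le[of "fst p" "snd p"] norm_snd_le[of "snd p" "fst p"] by auto
      then have "(\<lfloor>fst p\<rfloor>, \<lfloor>snd p\<rfloor>) \<in> {\<lfloor>-B\<rfloor>..\<lfloor>B\<rfloor>} \<times> {\<lfloor>-B\<rfloor>..\<lfloor>B\<rfloor>}"
        by (auto intro!: floor_mono)
      then have "\<bar>real_of_int (c (\<lfloor>fst p\<rfloor>, \<lfloor>snd p\<rfloor>))\<bar> \<le> C" unfolding F_def
        by (intro C) (auto simp: F_def)
      then show ?thesis
        using quinary_bounds[of "d p", OF d] by (auto simp: e_def)
    qed
    then show ?thesis by (intro boundedI[of _ "C + 1"]) blast
  qed
  have inv: "\<exists>\<delta>>0. \<forall>p q. \<bar>e p - e q\<bar> < \<delta> \<longrightarrow> dist p q < \<epsilon>" if "\<epsilon> > 0" for \<epsilon>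
  proof -
    \<comment> \<open>Each coordinate will be known up to 2^-n, and the distance in the plane is at
      most the sum of the two errors.\<close>
    obtain n where n: "(1/2::real) ^ n < \<epsilon> / 2"
      using real_arch_pow_inv[of "\<epsilon> / 2" "1/2"] \<open>\<epsilon> > 0\<close> by auto
    have "dist p q < \<epsilon>" if close: "\<bar>e p - e q\<bar> < 1 / (4 * 5 ^ n)" for p q
    proof -
      have "1 / (4 * 5 ^ n) \<le> (1/4::real)" by (simp add: field_simps)
      then have "\<bar>e p - e q\<bar> < 1 / 4" using close by linarith
      then have eq: "c (\<lfloor>fst p\<rfloor>, \<lfloor>snd p\<rfloor>) = c (\<lfloor>fst q\<rfloor>, \<lfloor>snd q\<rfloor>)"
        unfolding e_def by (intro quinary_gap[of "d p" "d q", OF d d])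
      then have fl: "\<lfloor>fst p\<rfloor> = \<lfloor>fst q\<rfloor>" "\<lfloor>snd p\<rfloor> = \<lfloor>snd q\<rfloor>"
        unfolding c_def by auto
      have "\<bar>quinary (d p) - quinary (d q)\<bar> < 1 / (4 * 5 ^ n)"
        using close eq unfolding e_def by simp
      then have dig: "\<forall>k<n. d p k = d q k"
        by (intro quinary_digits_eq d)
      have "bin_digit k (fst p) = bin_digit k (fst q) \<and> bin_digit k (snd p) = bin_digit k (snd q)"
        if "k < n" for k
      proof -
        have "bin_digit k (fst p) + 2 * bin_digit k (snd p) =
            bin_digit k (fst q) + 2 * bin_digit k (snd q)"
          using dig that by (auto simp: d_def case_prod_beta)
        then show ?thesis by (rule two_digits_unique[OF _ bin_digit_bounds bin_digit_bounds])
      qed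
      then have "\<bar>fst p - fst q\<bar> < 1 / 2 ^ n" "\<bar>snd p - snd q\<bar> < 1 / 2 ^ n"
        using fl by (auto intro!: bin_digits_dist)
      moreover have "dist p q \<le> \<bar>fst p - fst q\<bar> + \<bar>snd p - snd q\<bar>"
        unfolding dist_prod_def using sqrt_sum_squares_le_sum_abs by (simp add: dist_real_def)
      ultimately show ?thesis using n by (simp add: power_divide)
    qed
    then show ?thesis by (intro exI[of _ "1 / (4 * 5 ^ n)"]) auto
  qed
  show ?thesis using meas bdd inv unfolding coding_def by blast
qed

text \<open>Provides a code for pairs of points of the plane, the space on which two glued couplings
  live: each half is coded first, then the two codes together.\<close>

lemma coding_Pair:
  fixes e1 :: "'a::{metric_space, second_countable_topology} \<Rightarrow> real"
    and e2 :: "'b::{metric_space, second_countable_topology} \<Rightarrow> real"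
  assumes 1: "coding e1" and 2: "coding e2"
  shows "\<exists>e :: 'a \<times> 'b \<Rightarrow> real. coding e"
proof -
  obtain \<phi> :: "real \<times> real \<Rightarrow> real" where \<phi>: "coding \<phi>" using coding_real_pair by blast
  define e where "e = (\<lambda>p. \<phi> (e1 (fst p), e2 (snd p)))"
  have [measurable]: "e1 \<in> borel_measurable borel" "e2 \<in> borel_measurable borel"
    "\<phi> \<in> borel_measurable (borel \<Otimes>\<^sub>M borel)"
    using 1 2 \<phi> by (auto simp: coding_def borel_prod)
  have "e \<in> borel_measurable borel"
    unfolding e_def borel_prod[symmetric] by measurable
  moreover have "bounded (e ` S)" if S: "bounded S" for S
  proof -
    have "bounded (e1 ` fst ` S \<times> e2 ` snd ` S)"
      using 1 2 bounded_fst[OF S] bounded_snd[OF S] by (intro bounded_Times) (auto simp: coding_def)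
    then have "bounded (\<phi> ` (e1 ` fst ` S \<times> e2 ` snd ` S))" using \<phi> by (auto simp: coding_def)
    then show ?thesis by (rule bounded_subset) (auto simp: e_def)
  qed
  moreover have "\<exists>\<delta>>0. \<forall>p q. \<bar>e p - e q\<bar> < \<delta> \<longrightarrow> dist p q < \<epsilon>" if "\<epsilon> > 0" for \<epsilon>
  proof -
    have half: "\<epsilon> / 2 > 0" using that by simp
    obtain \<delta>1 where \<delta>1: "\<delta>1 > 0" "\<And>x y. \<bar>e1 x - e1 y\<bar> < \<delta>1 \<Longrightarrow> dist x y < \<epsilon> / 2"
      using 1 half unfolding coding_def by blast
    obtain \<delta>2 where \<delta>2: "\<delta>2 > 0" "\<And>x y. \<bar>e2 x - e2 y\<bar> < \<delta>2 \<Longrightarrow> dist x y < \<epsilon> / 2"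
      using 2 half unfolding coding_def by blast
    have "min \<delta>1 \<delta>2 > 0" using \<delta>1 \<delta>2 by simp
    then obtain \<delta> where d: "\<delta> > 0" "\<And>u v. \<bar>\<phi> u - \<phi> v\<bar> < \<delta> \<Longrightarrow> dist u v < min \<delta>1 \<delta>2"
      using \<phi> unfolding coding_def by blast
    have "dist p q < \<epsilon>" if "\<bar>e p - e q\<bar> < \<delta>" for p q
    proof -
      have *: "dist (e1 (fst p), e2 (snd p)) (e1 (fst q), e2 (snd q)) < min \<delta>1 \<delta>2"
        using d that unfolding e_def by blast
      have "dist (fst p) (fst q) < \<epsilon> / 2"
        using * dist_fst_le[of "(e1 (fst p), e2 (snd p))" "(e1 (fst q), e2 (snd q))"]
        by (intro \<delta>1) (auto simp: dist_real_def)
      moreover have "dist (snd p) (snd q) < \<epsilon> / 2"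
        using * dist_snd_le[of "(e1 (fst p), e2 (snd p))" "(e1 (fst q), e2 (snd q))"]
        by (intro \<delta>2) (auto simp: dist_real_def)
      moreover have "dist p q \<le> dist (fst p) (fst q) + dist (snd p) (snd q)"
        unfolding dist_prod_def using sqrt_sum_squares_le_sum by simp
      ultimately show ?thesis by simp
    qed
    then show ?thesis using d(1) by blast
  qed
  ultimately show ?thesis unfolding coding_def by blast
qed

section \<open>Weak compactness\<close>

text \<open>The indicator of a closed set C is the pointwise limit of the functions max(0, 1 - k *
  dist(x, C)), and the closed sets form an intersection-stable generator of the Borel sets.\<close>

lemma measure_eqI_integral_continuous:
  fixes M N :: "'a::metric_space measure"
  assumes "prob_space M" "prob_space N" and sets: "sets M = sets borel" "sets N = sets borel"
    and eq: "\<And>f :: 'a \<Rightarrow> real. continuous_on UNIV f \<Longrightarrow> (\<And>x. 0 \<le> f x \<and> f x \<le> 1) \<Longrightarrow>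
      integral\<^sup>L M f = integral\<^sup>L N f"
  shows "M = N"
proof -
  interpret M: prob_space M by fact
  interpret N: prob_space N by fact
  \<comment> \<open>The empty set is treated apart because \<open>infdist\<close> to it is 0 by
    convention.\<close>
  have closed_eq: "emeasure M C = emeasure N C" if C: "closed C" "C \<noteq> {}" for C
  proof -
    define f where "f = (\<lambda>(k::nat) x. max 0 (1 - real k * infdist x C))"
    have cont: "continuous_on UNIV (f k)" for k
      unfolding f_def by (intro continuous_intros)
    have bnd: "0 \<le> f k x \<and> f k x \<le> 1" for k x
      by (auto simp: f_def infdist_nonneg)
    have lim: "(\<lambda>k. f k x) \<longlonglongrightarrow> indicator C x" for x
    proof (cases "x \<in> C")
      case False
      then have pos: "infdist x C > 0" using C by (simp add: infdist_pos_not_in_closed)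
      obtain K :: nat where K: "1 / infdist x C < K" using reals_Archimedean2 by blast
      have "\<forall>\<^sub>F k in sequentially. f k x = 0"
        using eventually_ge_at_top[of K]
      proof eventually_elim
        case (elim k)
        have "1 < real K * infdist x C" using K pos by (simp add: field_simps)
        also have "\<dots> \<le> real k * infdist x C" using elim pos by (intro mult_right_mono) auto
        finally show ?case by (simp add: f_def)
      qed
      with False show ?thesis by (simp add: tendsto_eventually)
    qed (simp add: f_def)
    have *: "(\<lambda>k. integral\<^sup>L P (f k)) \<longlonglongrightarrow> measure P C"
      if "prob_space P" "sets P = sets borel" for P
    proof -
      interpret P: prob_space P by fact
      note [measurable_cong] = \<open>sets P = sets borel\<close>
      have [measurable]: "f k \<in> borel_measurable borel" "C \<in> sets borel" for k
        using cont C by (auto intro: borel_measurable_continuous_onI)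
      have "(\<lambda>k. integral\<^sup>L P (f k)) \<longlonglongrightarrow> integral\<^sup>L P (indicator C)"
      proof (rule integral_dominated_convergence[where w = "\<lambda>_. 1"])
        show "AE x in P. norm (f k x) \<le> 1" for k using bnd[of k] by (intro AE_I2) simp
      qed (use lim in auto)
      then show ?thesis using \<open>sets P = sets borel\<close> by (simp add: sets_eq_imp_space_eq)
    qed
    have "measure M C = measure N C"
      using *[OF assms(1) sets(1)] *[OF assms(2) sets(2)] eq[OF cont bnd]
      by (auto intro: LIMSEQ_unique)
    then show ?thesis by (simp add: M.emeasure_eq_measure N.emeasure_eq_measure)
  qed
  show ?thesis
  proof (rule measure_eqI_generator_eq[where E = "Collect closed" and \<Omega> = UNIV and A = "\<lambda>_. UNIV"])
    show "emeasure M X = emeasure N X" if "X \<in> Collect closed" for X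
      using that closed_eq by (cases "X = {}") auto
  qed (auto simp: Int_stable_def sets borel_eq_closed)
qed

text \<open>Almost sure convergence implies weak convergence, and weak limits are unique. This
  identifies the marginals of limiting couplings: one sequence lives on the representation space,
  the other on the space of a fixed measure.\<close>

lemma distr_limit_unique:
  fixes Z W :: "nat \<Rightarrow> _ \<Rightarrow> 'a::{metric_space, second_countable_topology}"
  assumes "prob_space M" "prob_space N"
    and [measurable]: "\<And>n. Z n \<in> borel_measurable M" "Z' \<in> borel_measurable M"
      "\<And>n. W n \<in> borel_measurable N" "W' \<in> borel_measurable N"
    and limZ: "AE x in M. (\<lambda>n. Z n x) \<longlonglongrightarrow> Z' x" and limW: "AE x in N. (\<lambda>n. W n x) \<longlonglongrightarrow> W' x"
    and eq: "\<And>n. distr M borel (Z n) = distr N borel (W n)"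
  shows "distr M borel Z' = distr N borel W'"
proof (rule measure_eqI_integral_continuous)
  interpret M: prob_space M by fact
  interpret N: prob_space N by fact
  show "prob_space (distr M borel Z')" "prob_space (distr N borel W')"
    by (auto intro: M.prob_space_distr N.prob_space_distr)
  fix f :: "'a \<Rightarrow> real"
  assume f: "continuous_on UNIV f" "\<And>x. 0 \<le> f x \<and> f x \<le> 1"
  have [measurable]: "f \<in> borel_measurable borel" using f by (auto intro: borel_measurable_continuous_onI)
  have cont: "(\<lambda>n. f (z n)) \<longlonglongrightarrow> f z'" if "z \<longlonglongrightarrow> z'" for z z'
    using f(1) that by (auto intro: continuous_on_tendsto_compose)
  have 1: "(\<lambda>n. \<integral>x. f (Z n x) \<partial>M) \<longlonglongrightarrow> (\<integral>x. f (Z' x) \<partial>M)"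
    by (rule integral_dominated_convergence[where w = "\<lambda>_. 1"]) (use limZ cont f(2) in auto)
  have 2: "(\<lambda>n. \<integral>x. f (W n x) \<partial>N) \<longlonglongrightarrow> (\<integral>x. f (W' x) \<partial>N)"
    by (rule integral_dominated_convergence[where w = "\<lambda>_. 1"]) (use limW cont f(2) in auto)
  have "(\<integral>x. f (Z n x) \<partial>M) = (\<integral>x. f (W n x) \<partial>N)" for n
    using arg_cong[OF eq[of n], of "\<lambda>P. integral\<^sup>L P f"] by (simp add: integral_distr)
  then show "integral\<^sup>L (distr M borel Z') f = integral\<^sup>L (distr N borel W') f"
    using LIMSEQ_unique[OF 1] 2 by (simp add: integral_distr)
qed auto

text \<open>Prokhorov's theorem and Skorohod's representation theorem combined. The push-forwards
  under a coding are measures on the line, where Helly's selection theorem applies; the uniformly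
  continuous inverse of the coding extends to the closure of its range and transports the almost
  sure limit back.\<close>

lemma tight_subsequence_representation:
  fixes p :: "nat \<Rightarrow> 'a::euclidean_space measure"
  assumes e: "coding (e :: 'a \<Rightarrow> real)"
    and p: "\<And>n. prob_space (p n)" "\<And>n. sets (p n) = sets borel"
    and tight: "\<And>\<epsilon>. \<epsilon> > 0 \<Longrightarrow> \<exists>B. \<forall>n. measure (p n) {x. norm x > B} < \<epsilon>"
  obtains r and \<Omega> :: "real measure" and Z Z'
  where "strict_mono r" "prob_space \<Omega>" "\<And>n. Z n \<in> borel_measurable \<Omega>"
    "Z' \<in> borel_measurable \<Omega>" "\<And>n. distr \<Omega> borel (Z n) = p (r n)"
    "AE \<omega> in \<Omega>. (\<lambda>n. Z n \<omega>) \<longlonglongrightarrow> Z' \<omega>"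
proof -
  interpret p: prob_space "p n" for n by fact
  note [measurable_cong] = p(2)
  have sp: "space (p n) = UNIV" for n using sets_eq_imp_space_eq[OF p(2)[of n]] by simp
  have e_meas[measurable]: "e \<in> borel_measurable borel" using e by (simp add: coding_def)
  define m where "m n = distr (p n) borel e" for n
  have rd: "real_distribution (m n)" for n
    unfolding m_def by (intro p.real_distribution_distr) measurable
  have "tight m" unfolding tight_def
  proof (intro conjI allI impI rd)
    fix \<epsilon> :: real assume "\<epsilon> > 0"
    then obtain B where B: "\<And>n. measure (p n) {x. norm x > B} < \<epsilon>" using tight by blast
    have "bounded (e ` cball 0 B)" using e by (simp add: coding_def)
    then obtain C where C: "\<And>x. norm x \<le> B \<Longrightarrow> \<bar>e x\<bar> \<le> C"
      unfolding bounded_iff by (metis image_eqI mem_cball_0 real_norm_def)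
    \<comment> \<open>The absolute value covers a negative B, where the ball is empty and C
      arbitrary; the added 1 keeps -C inside an interval that is open on the left.\<close>
    have "measure (m n) {-\<bar>C\<bar> - 1<..\<bar>C\<bar> + 1} > 1 - \<epsilon>" for n
    proof -
      have "1 - \<epsilon> < 1 - measure (p n) {x. norm x > B}" using B[of n] by simp
      also have "\<dots> = measure (p n) (space (p n) - {x. norm x > B})"
        by (intro p.prob_compl[symmetric]) (simp add: p)
      also have "\<dots> \<le> measure (p n) (e -` {-\<bar>C\<bar> - 1<..\<bar>C\<bar> + 1} \<inter> space (p n))"
      proof (rule p.finite_measure_mono)
        have "e x \<in> {-\<bar>C\<bar> - 1<..\<bar>C\<bar> + 1}" if "norm x \<le> B" for x
          using C[OF that] by (simp add: abs_le_iff)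
        then show "space (p n) - {x. norm x > B} \<subseteq> e -` {-\<bar>C\<bar> - 1<..\<bar>C\<bar> + 1} \<inter> space (p n)"
          by (auto simp: sp)
      qed (rule measurable_sets[of _ _ borel]; measurable)
      also have "\<dots> = measure (m n) {-\<bar>C\<bar> - 1<..\<bar>C\<bar> + 1}"
        unfolding m_def by (subst measure_distr) auto
      finally show ?thesis .
    qed
    then show "\<exists>a b. a < b \<and> (\<forall>n. measure (m n) {a<..b} > 1 - \<epsilon>)"
      by (intro exI[of _ "-\<bar>C\<bar> - 1"] exI[of _ "\<bar>C\<bar> + 1"]) auto
  qed
  from tight_imp_convergent_subsubsequence[OF this strict_mono_id]
  obtain r M where r: "strict_mono r" and M: "real_distribution M" "weak_conv_m (m \<circ> r) M"
    by auto
  obtain \<Omega> :: "real measure" and Y Y' where ps: "prob_space \<Omega>"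
    and Y[measurable]: "\<And>n. Y n \<in> borel_measurable \<Omega>" and dY: "\<And>n. distr \<Omega> borel (Y n) = (m \<circ> r) n"
    and Y'[measurable]: "Y' \<in> borel_measurable \<Omega>" and lim: "\<And>x. x \<in> space \<Omega> \<Longrightarrow> (\<lambda>n. Y n x) \<longlonglongrightarrow> Y' x"
  proof -
    have "real_distribution ((m \<circ> r) n)" for n using rd by simp
    from Skorohod[OF this M] show ?thesis
    proof (elim exE)
      fix \<Omega> :: "real measure" and Y :: "nat \<Rightarrow> real \<Rightarrow> real" and Y' :: "real \<Rightarrow> real"
      assume *: "prob_space \<Omega> \<and> (\<forall>n. Y n \<in> borel_measurable \<Omega>) \<and>
        (\<forall>n. distr \<Omega> borel (Y n) = (m \<circ> r) n) \<and> Y' \<in> measurable \<Omega> lborel \<and>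
        distr \<Omega> borel Y' = M \<and> (\<forall>x\<in>space \<Omega>. (\<lambda>n. Y n x) \<longlonglongrightarrow> Y' x)"
      show ?thesis by (rule that[of \<Omega> Y Y']) (use * in auto)
    qed
  qed
  interpret \<Omega>: prob_space \<Omega> by fact
  let ?C = "closure (range e)"
  have inj: "inj e"
  proof (rule injI)
    fix x y assume "e x = e y"
    then have "\<And>\<epsilon>. \<epsilon> > 0 \<Longrightarrow> dist x y < \<epsilon>" using e unfolding coding_def by fastforce
    then show "x = y" by (metis less_irrefl zero_less_dist_iff)
  qed
  have "uniformly_continuous_on (range e) (inv e)"
    unfolding uniformly_continuous_on_def
  proof (intro allI impI)
    fix \<epsilon> :: real assume "\<epsilon> > 0"
    then obtain \<delta> where "\<delta> > 0" "\<And>x y. \<bar>e x - e y\<bar> < \<delta> \<Longrightarrow> dist x y < \<epsilon>"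
      using e unfolding coding_def by blast
    then show "\<exists>d>0. \<forall>x\<in>range e. \<forall>x'\<in>range e. dist x' x < d \<longrightarrow> dist (inv e x') (inv e x) < \<epsilon>"
      using inj by (intro exI[of _ \<delta>]) (auto simp: dist_real_def)
  qed
  then obtain g where g: "uniformly_continuous_on ?C g" "\<And>u. u \<in> range e \<Longrightarrow> inv e u = g u"
    using uniformly_continuous_on_extension_on_closure by metis
  \<comment> \<open>Extension by 0 makes the decoder Borel on the whole line. Almost surely neither
    \<open>Y n\<close> nor the limit leaves the closed set \<open>?C\<close>, on which it is
    continuous.\<close>
  define G where "G u = (if u \<in> ?C then g u else 0)" for u
  have [measurable]: "G \<in> borel_measurable borel"
    unfolding G_def using uniformly_continuous_imp_continuous[OF g(1)]
    by (intro borel_measurable_continuous_on_if) auto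
  have Ge: "G (e x) = x" for x
    using g(2)[of "e x"] closure_subset[of "range e"] inj by (auto simp: G_def)
  have AE_C: "AE \<omega> in \<Omega>. Y n \<omega> \<in> ?C" for n
  proof -
    have "AE u in m (r n). u \<in> ?C"
      unfolding m_def using closure_subset[of "range e"] by (subst AE_distr_iff) auto
    then have "AE u in distr \<Omega> borel (Y n). u \<in> ?C" unfolding dY comp_def .
    then show ?thesis by (subst (asm) AE_distr_iff) auto
  qed
  show ?thesis
  proof
    show "strict_mono r" "prob_space \<Omega>" by fact+
    show "(\<lambda>\<omega>. G (Y n \<omega>)) \<in> borel_measurable \<Omega>" "(\<lambda>\<omega>. G (Y' \<omega>)) \<in> borel_measurable \<Omega>" for n
      by measurable
    show "distr \<Omega> borel (\<lambda>\<omega>. G (Y n \<omega>)) = p (r n)" for n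
    proof -
      have "distr \<Omega> borel (\<lambda>\<omega>. G (Y n \<omega>)) = distr (distr \<Omega> borel (Y n)) borel G"
        by (subst distr_distr) (auto simp: comp_def)
      also have "\<dots> = distr (p (r n)) borel (\<lambda>x. x)"
        unfolding dY comp_def m_def by (subst distr_distr) (auto simp: comp_def Ge)
      also have "\<dots> = p (r n)" by (rule distr_id2) (simp add: p)
      finally show ?thesis .
    qed
    have "AE \<omega> in \<Omega>. \<forall>n. Y n \<omega> \<in> ?C" using AE_C by (simp add: AE_all_countable)
    moreover have "AE \<omega> in \<Omega>. (\<lambda>n. Y n \<omega>) \<longlonglongrightarrow> Y' \<omega>" using lim by (intro AE_I2)
    ultimately show "AE \<omega> in \<Omega>. (\<lambda>n. G (Y n \<omega>)) \<longlonglongrightarrow> G (Y' \<omega>)"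
    proof eventually_elim
      case (elim \<omega>)
      then have "Y' \<omega> \<in> ?C" using closed_sequentially[OF closed_closure, of "\<lambda>n. Y n \<omega>"] by blast
      then have "(\<lambda>n. g (Y n \<omega>)) \<longlonglongrightarrow> g (Y' \<omega>)"
        using elim
        by (intro continuous_on_tendsto_compose[OF uniformly_continuous_imp_continuous[OF g(1)]]) auto
      then show ?case using elim \<open>Y' \<omega> \<in> ?C\<close> by (simp add: G_def)
    qed
  qed
qed

section \<open>Couplings and the Gromov-Wasserstein cost\<close>

lemma ennreal_sqrt_power2 [simp]: "(ennreal_sqrt x)\<^sup>2 = x"
proof (cases x)
  case (real r)
  then show ?thesis by (auto simp: ennreal_sqrt_def ennreal_power)
qed (auto simp: ennreal_sqrt_def power2_eq_square)

lemma ennreal_power2_sqrt [simp]: "ennreal_sqrt (x\<^sup>2) = x"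
  by (cases x) (auto simp: ennreal_sqrt_def ennreal_power power2_eq_square ennreal_mult_eq_top_iff
      simp flip: ennreal_mult)

lemma ennreal_sqrt_mono: "x \<le> y \<Longrightarrow> ennreal_sqrt x \<le> ennreal_sqrt y"
  by (cases x; cases y) (auto simp: ennreal_sqrt_def ennreal_le_iff top_unique)

lemma ennreal_sqrt_le_iff: "ennreal_sqrt x \<le> y \<longleftrightarrow> x \<le> y\<^sup>2"
  by (metis ennreal_sqrt_mono ennreal_sqrt_power2 ennreal_power2_sqrt power_mono zero_le)

lemma ennreal_sqrt_INF: "ennreal_sqrt (INF i\<in>I. f i) = (INF i\<in>I. ennreal_sqrt (f i))"
proof (rule antisym)
  show "ennreal_sqrt (INF i\<in>I. f i) \<le> (INF i\<in>I. ennreal_sqrt (f i))"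
    by (intro INF_greatest ennreal_sqrt_mono INF_lower)
  have "(INF i\<in>I. ennreal_sqrt (f i))\<^sup>2 \<le> f j" if "j \<in> I" for j
    using power_mono[OF INF_lower[OF that, of "\<lambda>i. ennreal_sqrt (f i)"], of 2] by simp
  then have "ennreal_sqrt ((INF i\<in>I. ennreal_sqrt (f i))\<^sup>2) \<le> ennreal_sqrt (INF i\<in>I. f i)"
    by (intro ennreal_sqrt_mono INF_greatest)
  then show "(INF i\<in>I. ennreal_sqrt (f i)) \<le> ennreal_sqrt (INF i\<in>I. f i)" by simp
qed

text \<open>An infinite right-hand side leaves nothing to show; otherwise the infimum is finite,
  hence strictly below itself plus \<epsilon>, and some index gets under that bound.\<close>

lemma le_INF_add_const:
  fixes F :: "'i \<Rightarrow> ennreal"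
  assumes "\<And>i. i \<in> I \<Longrightarrow> x \<le> F i + c"
  shows "x \<le> (INF i\<in>I. F i) + c"
proof (rule ennreal_le_epsilon)
  fix e :: real assume e: "e > 0" and fin: "(INF i\<in>I. F i) + c < top"
  have "m < m + ennreal e" if "m + c < top" for m
    using e that ennreal_add_left_cancel_less[of m 0 "ennreal e"] by auto
  from this[OF fin] have "(INF i\<in>I. F i) < (INF i\<in>I. F i) + ennreal e" .
  then obtain i where i: "i \<in> I" "F i < (INF i\<in>I. F i) + ennreal e"
    by (auto simp: INF_less_iff)
  have "x \<le> F i + c" using i(1) by (rule assms)
  also have "\<dots> \<le> (INF i\<in>I. F i) + ennreal e + c" using i(2) by (intro add_right_mono less_imp_le)
  finally show "x \<le> (INF i\<in>I. F i) + c + ennreal e" by (simp add: ac_simps)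
qed

text \<open>Reduces a triangle inequality between infima to one for each pair of competitors:
  couplings in \<open>GW2_triangle\<close>, rotations in \<open>RISGW_triangle\<close>.\<close>

lemma le_ennreal_sqrt_INF_add:
  assumes "\<And>i j. i \<in> I \<Longrightarrow> j \<in> J \<Longrightarrow> x \<le> ennreal_sqrt (f i) + ennreal_sqrt (g j)"
  shows "x \<le> ennreal_sqrt (INF i\<in>I. f i) + ennreal_sqrt (INF j\<in>J. g j)"
  unfolding ennreal_sqrt_INF
proof (rule le_INF_add_const)
  fix i assume "i \<in> I"
  then have "x \<le> (INF j\<in>J. ennreal_sqrt (g j)) + ennreal_sqrt (f i)"
    using assms by (intro le_INF_add_const) (simp add: add.commute)
  then show "x \<le> ennreal_sqrt (f i) + (INF j\<in>J. ennreal_sqrt (g j))" by (simp add: add.commute)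
qed

text \<open>After expanding the square, Cauchy-Schwarz bounds the mixed term. The calculation stays
  in [0, \<infinity>] and so covers infinite norms.\<close>

lemma Minkowski_nn_integral:
  assumes [measurable]: "f \<in> borel_measurable M" "g \<in> borel_measurable M"
  shows "ennreal_sqrt (\<integral>\<^sup>+x. (f x + g x)\<^sup>2 \<partial>M) \<le>
    ennreal_sqrt (\<integral>\<^sup>+x. (f x)\<^sup>2 \<partial>M) + ennreal_sqrt (\<integral>\<^sup>+x. (g x)\<^sup>2 \<partial>M)"
proof -
  define F where "F = (\<integral>\<^sup>+x. (f x)\<^sup>2 \<partial>M)"
  define G where "G = (\<integral>\<^sup>+x. (g x)\<^sup>2 \<partial>M)"
  have "(\<integral>\<^sup>+x. f x * g x \<partial>M) = ennreal_sqrt ((\<integral>\<^sup>+x. f x * g x \<partial>M)\<^sup>2)" by simp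
  also have "\<dots> \<le> ennreal_sqrt (F * G)"
    unfolding F_def G_def by (intro ennreal_sqrt_mono Cauchy_Schwarz_nn_integral) auto
  also have "\<dots> = ennreal_sqrt ((ennreal_sqrt F * ennreal_sqrt G)\<^sup>2)"
    by (subst power_mult_distrib) simp
  also have "\<dots> = ennreal_sqrt F * ennreal_sqrt G" by simp
  finally have fg: "(\<integral>\<^sup>+x. f x * g x \<partial>M) \<le> ennreal_sqrt F * ennreal_sqrt G" .
  have "(\<integral>\<^sup>+x. (f x + g x)\<^sup>2 \<partial>M) = (\<integral>\<^sup>+x. (f x)\<^sup>2 + (g x)\<^sup>2 + 2 * (f x * g x) \<partial>M)"
    by (simp add: power2_sum mult.assoc)
  also have "\<dots> = F + G + 2 * (\<integral>\<^sup>+x. f x * g x \<partial>M)"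
    unfolding F_def G_def by (subst nn_integral_add, simp, simp)+ (simp add: nn_integral_cmult)
  also have "\<dots> \<le> F + G + 2 * (ennreal_sqrt F * ennreal_sqrt G)"
    using fg by (intro add_left_mono mult_left_mono) auto
  also have "\<dots> = (ennreal_sqrt F)\<^sup>2 + (ennreal_sqrt G)\<^sup>2 + 2 * (ennreal_sqrt F * ennreal_sqrt G)"
    by simp
  also have "\<dots> = (ennreal_sqrt F + ennreal_sqrt G)\<^sup>2"
    by (simp only: power2_sum mult.assoc)
  finally show ?thesis unfolding ennreal_sqrt_le_iff F_def G_def .
qed

section \<open>The cost of a coupling and its behaviour under maps\<close>

definition gw_cost ::
  "('a \<Rightarrow> 'a \<Rightarrow> real) \<Rightarrow> ('b \<Rightarrow> 'b \<Rightarrow> real) \<Rightarrow> ('a \<times> 'b) measure \<Rightarrow> ennreal" where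
  "gw_cost cX cY \<pi> = (\<integral>\<^sup>+p'. (\<integral>\<^sup>+p.
     ennreal (\<bar>cX (fst p) (fst p') - cY (snd p) (snd p')\<bar>\<^sup>2) \<partial>\<pi>) \<partial>\<pi>)"

lemma GW2_eq: "GW2 cX cY \<mu> \<nu> = ennreal_sqrt (INF \<pi>\<in>couplings \<mu> \<nu>. gw_cost cX cY \<pi>)"
  by (simp add: GW2_def gw_cost_def case_prod_unfold)

lemma GW2_power2: "(GW2 cX cY \<mu> \<nu>)\<^sup>2 = (INF \<pi>\<in>couplings \<mu> \<nu>. gw_cost cX cY \<pi>)"
  by (simp add: GW2_eq)

lemma GW2_le_coupling: "\<pi> \<in> couplings \<mu> \<nu> \<Longrightarrow> GW2 cX cY \<mu> \<nu> \<le> ennreal_sqrt (gw_cost cX cY \<pi>)"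
  unfolding GW2_eq by (intro ennreal_sqrt_mono INF_lower)

lemma borel_probsD:
  assumes "\<mu> \<in> borel_probs"
  shows "sets \<mu> = sets borel" "prob_space \<mu>" "space \<mu> = UNIV"
  using assms sets_eq_imp_space_eq[of \<mu> borel] by (auto simp: space_prob_algebra)

lemma borel_probs_distr:
  assumes "prob_space M" "f \<in> borel_measurable M"
  shows "distr M borel f \<in> borel_probs"
  using assms prob_space.prob_space_distr by (auto simp: space_prob_algebra)

lemma measurable_borel_probs:
  "\<mu> \<in> borel_probs \<Longrightarrow> f \<in> borel \<rightarrow>\<^sub>M N \<Longrightarrow> f \<in> \<mu> \<rightarrow>\<^sub>M N"
  using measurable_cong_sets[of \<mu> borel N N] by (simp add: borel_probsD)

lemma distr_id_borel_probs: "\<mu> \<in> borel_probs \<Longrightarrow> distr \<mu> borel (\<lambda>x. x) = \<mu>"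
  by (intro distr_id2) (simp add: borel_probsD)

text \<open>Second countability enters here: the product of the two Borel algebras is then the Borel
  algebra of the product space.\<close>

lemma couplings_iff:
  fixes \<mu> :: "'a::second_countable_topology measure" and \<nu> :: "'b::second_countable_topology measure"
  assumes "sets \<mu> = sets borel" "sets \<nu> = sets borel"
  shows "\<pi> \<in> couplings \<mu> \<nu> \<longleftrightarrow>
    sets \<pi> = sets borel \<and> distr \<pi> borel fst = \<mu> \<and> distr \<pi> borel snd = \<nu>"
proof -
  have "sets (\<mu> \<Otimes>\<^sub>M \<nu>) = sets borel"
    using assms by (simp add: borel_prod[symmetric] cong: sets_pair_measure_cong)
  moreover have "distr \<pi> \<mu> fst = distr \<pi> borel fst" "distr \<pi> \<nu> snd = distr \<pi> borel snd"
    using assms by (auto intro: distr_cong)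
  ultimately show ?thesis by (simp add: couplings_def)
qed

lemma couplings_borel_probs:
  fixes \<mu> :: "'a::second_countable_topology measure" and \<nu> :: "'b::second_countable_topology measure"
  assumes "\<mu> \<in> borel_probs" "\<nu> \<in> borel_probs" "\<pi> \<in> couplings \<mu> \<nu>"
  shows "\<pi> \<in> borel_probs" "distr \<pi> borel fst = \<mu>" "distr \<pi> borel snd = \<nu>"
proof -
  note c = assms(3)[unfolded couplings_iff[OF borel_probsD(1)[OF assms(1)] borel_probsD(1)[OF assms(2)]]]
  show "distr \<pi> borel fst = \<mu>" "distr \<pi> borel snd = \<nu>" using c by auto
  have "fst \<in> borel_measurable \<pi>"
    using c by (simp add: measurable_cong_sets[of \<pi> borel] borel_prod[symmetric])
  then have "prob_space \<pi>"
    using c borel_probsD(2)[OF assms(1)] by (intro prob_space_distrD[of fst \<pi> borel]) auto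
  then show "\<pi> \<in> borel_probs" using c by (auto simp: space_prob_algebra)
qed

lemma distr_Pair_couplings:
  fixes X :: "'w \<Rightarrow> 'a::second_countable_topology" and Y :: "'w \<Rightarrow> 'b::second_countable_topology"
  assumes [measurable]: "X \<in> borel_measurable M" "Y \<in> borel_measurable M"
  shows "distr M borel (\<lambda>\<omega>. (X \<omega>, Y \<omega>)) \<in> couplings (distr M borel X) (distr M borel Y)"
  unfolding couplings_iff[of "distr M borel X" "distr M borel Y", simplified]
  by (simp add: borel_prod[symmetric] distr_distr comp_def)

lemma gw_kernel_measurable:
  fixes cX :: "'a::second_countable_topology \<Rightarrow> 'a \<Rightarrow> real"
    and cY :: "'b::second_countable_topology \<Rightarrow> 'b \<Rightarrow> real"
  assumes "case_prod cX \<in> borel_measurable borel" "case_prod cY \<in> borel_measurable borel"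
  shows "(\<lambda>(p, p'). ennreal (\<bar>cX (fst p) (fst p') - cY (snd p) (snd p')\<bar>\<^sup>2))
    \<in> borel_measurable (borel \<Otimes>\<^sub>M borel)"
proof -
  have [measurable]: "case_prod cX \<in> borel_measurable (borel \<Otimes>\<^sub>M borel)"
    "case_prod cY \<in> borel_measurable (borel \<Otimes>\<^sub>M borel)"
    using assms by (auto simp: borel_prod)
  have "(\<lambda>p. ennreal (\<bar>case_prod cX (fst (fst p), fst (snd p)) - case_prod cY (snd (fst p), snd (snd p))\<bar>\<^sup>2))
    \<in> borel_measurable ((borel \<Otimes>\<^sub>M borel) \<Otimes>\<^sub>M (borel \<Otimes>\<^sub>M borel))"
    by measurable
  then show ?thesis by (simp add: borel_prod case_prod_beta)
qed

lemma gw_cost_distr: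
  fixes f :: "'w \<Rightarrow> 'a::second_countable_topology \<times> 'b::second_countable_topology"
  assumes f[measurable]: "f \<in> borel_measurable M"
    and c: "case_prod cX \<in> borel_measurable borel" "case_prod cY \<in> borel_measurable borel"
    and M: "prob_space M"
  shows "gw_cost cX cY (distr M borel f) = (\<integral>\<^sup>+\<omega>'. (\<integral>\<^sup>+\<omega>.
     ennreal (\<bar>cX (fst (f \<omega>)) (fst (f \<omega>')) - cY (snd (f \<omega>)) (snd (f \<omega>'))\<bar>\<^sup>2) \<partial>M) \<partial>M)"
proof -
  interpret M: prob_space M by fact
  interpret D: prob_space "distr M borel f" by (rule M.prob_space_distr) fact
  define k :: "('a \<times> 'b) \<times> 'a \<times> 'b \<Rightarrow> ennreal"
    where "k = (\<lambda>(p, p'). ennreal (\<bar>cX (fst p) (fst p') - cY (snd p) (snd p')\<bar>\<^sup>2))"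
  have [measurable]: "k \<in> borel_measurable (borel \<Otimes>\<^sub>M borel)"
    unfolding k_def by (rule gw_kernel_measurable[OF c])
  have "gw_cost cX cY (distr M borel f) = (\<integral>\<^sup>+p'. (\<integral>\<^sup>+p. k (p, p') \<partial>distr M borel f) \<partial>distr M borel f)"
    by (simp add: gw_cost_def k_def)
  also have "\<dots> = (\<integral>\<^sup>+\<omega>'. (\<integral>\<^sup>+p. k (p, f \<omega>') \<partial>distr M borel f) \<partial>M)"
    by (subst nn_integral_distr) measurable
  also have "\<dots> = (\<integral>\<^sup>+\<omega>'. (\<integral>\<^sup>+\<omega>. k (f \<omega>, f \<omega>') \<partial>M) \<partial>M)"
    by (intro nn_integral_cong nn_integral_distr) measurable
  finally show ?thesis by (simp add: k_def)
qed

text \<open>Pushing a coupling forward by (f, g) gives a coupling of the images at the same cost.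
  For invertible maps the reverse inequality follows by a second application to the inverses, as in
  \<open>GW2_translate\<close>.\<close>

lemma GW2_distr_le:
  fixes f :: "'a::second_countable_topology \<Rightarrow> 'c::second_countable_topology"
    and g :: "'b::second_countable_topology \<Rightarrow> 'd::second_countable_topology"
  assumes \<mu>: "\<mu> \<in> borel_probs" and \<nu>: "\<nu> \<in> borel_probs"
    and [measurable]: "f \<in> borel_measurable borel" "g \<in> borel_measurable borel"
    and c: "case_prod cX \<in> borel_measurable borel" "case_prod cY \<in> borel_measurable borel"
    and f: "\<And>s t. cX (f s) (f t) = cX' s t" and g: "\<And>s t. cY (g s) (g t) = cY' s t"
  shows "GW2 cX cY (distr \<mu> borel f) (distr \<nu> borel g) \<le> GW2 cX' cY' \<mu> \<nu>"
  unfolding GW2_eq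
proof (intro ennreal_sqrt_mono INF_mono)
  fix \<pi> assume \<pi>: "\<pi> \<in> couplings \<mu> \<nu>"
  note P = couplings_borel_probs[OF \<mu> \<nu> \<pi>]
  have [measurable]: "fst \<in> borel_measurable (borel :: ('a \<times> 'b) measure)"
    "snd \<in> borel_measurable (borel :: ('a \<times> 'b) measure)"
    by (auto simp: borel_prod[symmetric])
  have m: "(\<lambda>p. f (fst p)) \<in> borel_measurable \<pi>" "(\<lambda>p. g (snd p)) \<in> borel_measurable \<pi>"
    by (intro measurable_borel_probs[OF P(1)]; measurable)+
  have "distr \<pi> borel (\<lambda>p. f (fst p)) = distr \<mu> borel f" "distr \<pi> borel (\<lambda>p. g (snd p)) = distr \<nu> borel g"
    unfolding P(2,3)[symmetric] by (subst distr_distr; simp add: comp_def measurable_borel_probs[OF P(1)])+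
  then have 1: "distr \<pi> borel (\<lambda>p. (f (fst p), g (snd p))) \<in> couplings (distr \<mu> borel f) (distr \<nu> borel g)"
    using distr_Pair_couplings[OF m] by simp
  have "gw_cost cX cY (distr \<pi> borel (\<lambda>p. (f (fst p), g (snd p)))) = gw_cost cX' cY' \<pi>"
    using m by (subst gw_cost_distr[OF _ c borel_probsD(2)[OF P(1)]])
      (auto simp: f g gw_cost_def intro!: borel_measurable_Pair)
  with 1 show "\<exists>\<pi>'\<in>couplings (distr \<mu> borel f) (distr \<nu> borel g). gw_cost cX cY \<pi>' \<le> gw_cost cX' cY' \<pi>"
    by (intro bexI[OF _ 1]) simp
qed

lemma GW2_commute_le:
  fixes \<mu> :: "'a::second_countable_topology measure" and \<nu> :: "'b::second_countable_topology measure"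
  assumes \<mu>: "\<mu> \<in> borel_probs" and \<nu>: "\<nu> \<in> borel_probs"
    and c: "case_prod cX \<in> borel_measurable borel" "case_prod cY \<in> borel_measurable borel"
  shows "GW2 cY cX \<nu> \<mu> \<le> GW2 cX cY \<mu> \<nu>"
  unfolding GW2_eq
proof (intro ennreal_sqrt_mono INF_mono)
  fix \<pi> assume \<pi>: "\<pi> \<in> couplings \<mu> \<nu>"
  note P = couplings_borel_probs[OF \<mu> \<nu> \<pi>]
  have m: "fst \<in> borel_measurable \<pi>" "snd \<in> borel_measurable \<pi>"
    by (intro measurable_borel_probs[OF P(1)]; simp add: borel_prod[symmetric])+
  have 1: "distr \<pi> borel (\<lambda>p. (snd p, fst p)) \<in> couplings \<nu> \<mu>"
    using distr_Pair_couplings[OF m(2,1)] P by simp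
  have "gw_cost cY cX (distr \<pi> borel (\<lambda>p. (snd p, fst p))) = gw_cost cX cY \<pi>"
    using m by (subst gw_cost_distr[OF _ c(2,1) borel_probsD(2)[OF P(1)]])
      (auto simp: gw_cost_def abs_minus_commute intro!: borel_measurable_Pair)
  with 1 show "\<exists>\<pi>'\<in>couplings \<nu> \<mu>. gw_cost cY cX \<pi>' \<le> gw_cost cX cY \<pi>"
    by (intro bexI[OF _ 1]) simp
qed

lemma GW2_commute:
  fixes \<mu> :: "'a::second_countable_topology measure" and \<nu> :: "'b::second_countable_topology measure"
  assumes "\<mu> \<in> borel_probs" "\<nu> \<in> borel_probs"
    and "case_prod cX \<in> borel_measurable borel" "case_prod cY \<in> borel_measurable borel"
  shows "GW2 cX cY \<mu> \<nu> = GW2 cY cX \<nu> \<mu>"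
  using assms by (intro antisym GW2_commute_le)

text \<open>The coupling carried by the graph of f has integrand 0.\<close>

lemma GW2_eq_0_map:
  fixes \<mu> :: "'a::second_countable_topology measure" and f :: "'a \<Rightarrow> 'b::second_countable_topology"
  assumes \<mu>: "\<mu> \<in> borel_probs" and f: "f \<in> borel_measurable borel"
    and c: "case_prod cX \<in> borel_measurable borel" "case_prod cY \<in> borel_measurable borel"
    and iso: "\<And>s t. cY (f s) (f t) = cX s t"
  shows "GW2 cX cY \<mu> (distr \<mu> borel f) = 0"
proof -
  have [measurable]: "(\<lambda>x. x) \<in> borel_measurable \<mu>" "f \<in> borel_measurable \<mu>"
    using f by (auto intro: measurable_borel_probs[OF \<mu>])
  have "distr \<mu> borel (\<lambda>x. (x, f x)) \<in> couplings \<mu> (distr \<mu> borel f)"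
    using distr_Pair_couplings[of "\<lambda>x. x" \<mu> f] \<mu> by (simp add: distr_id_borel_probs)
  from GW2_le_coupling[OF this, of cX cY] show ?thesis
    by (subst (asm) gw_cost_distr[OF _ c borel_probsD(2)[OF \<mu>]])
      (auto simp: iso ennreal_sqrt_def)
qed

section \<open>Lower semicontinuity in the direction\<close>

lemma proj_measurable [measurable]: "proj \<theta> \<in> borel_measurable borel"
  unfolding proj_def by measurable

lemma sqdist_measurable: "case_prod sqdist \<in> borel_measurable borel"
  unfolding sqdist_def by (intro borel_measurable_continuous_onI) (auto simp: case_prod_beta intro!: continuous_intros)

lemma fst_snd_borel_measurable [measurable]:
  "fst \<in> borel_measurable (borel :: ('a::second_countable_topology \<times> 'b::second_countable_topology) measure)"
  "snd \<in> borel_measurable (borel :: ('a::second_countable_topology \<times> 'b::second_countable_topology) measure)"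
  by (auto simp: borel_prod[symmetric])

lemma tail_measure_small:
  fixes \<mu> :: "'a::real_normed_vector measure"
  assumes \<mu>: "\<mu> \<in> borel_probs" and "\<epsilon> > 0"
  shows "\<exists>B>0. measure \<mu> {x. norm x > B} < \<epsilon>"
proof -
  interpret prob_space \<mu> using borel_probsD[OF \<mu>] by simp
  have "{x. norm x > real n} \<in> sets \<mu>" for n
    unfolding borel_probsD(1)[OF \<mu>] by measurable
  moreover have "decseq (\<lambda>n. {x :: 'a. norm x > real n})"
    by (auto simp: decseq_def)
  ultimately have "(\<lambda>n. measure \<mu> {x. norm x > real n}) \<longlonglongrightarrow> measure \<mu> (\<Inter>n. {x. norm x > real n})"
    by (intro finite_Lim_measure_decseq) auto
  also have "(\<Inter>n. {x :: 'a. norm x > real n}) = {}"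
    by (auto simp: not_less) (meson reals_Archimedean2 less_imp_le not_less)
  finally have "\<forall>\<^sub>F n in sequentially. measure \<mu> {x. norm x > real n} < \<epsilon>"
    using \<open>\<epsilon> > 0\<close> by (auto intro: order_tendstoD)
  then have "\<forall>\<^sub>F n in sequentially. measure \<mu> {x. norm x > real n} < \<epsilon> \<and> n > 0"
    using eventually_gt_at_top[of 0] by eventually_elim auto
  then obtain n where "measure \<mu> {x. norm x > real n} < \<epsilon>" "n > 0"
    by (auto dest: eventually_happens)
  then show ?thesis by (intro exI[of _ "real n"]) auto
qed

text \<open>A pair of norm above 2B has a component of norm above B. Tight marginals therefore make
  their couplings uniformly tight.\<close>

lemma Pair_tail_le:
  fixes P :: "('a::euclidean_space \<times> 'b::euclidean_space) measure"
  assumes P: "P \<in> borel_probs"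
  shows "measure P {p. norm p > 2 * B} \<le>
    measure (distr P borel fst) {x. norm x > B} + measure (distr P borel snd) {x. norm x > B}"
proof -
  interpret prob_space P using borel_probsD[OF P] by simp
  note [measurable_cong] = borel_probsD(1)[OF P]
  have sp: "space P = UNIV" using P by (rule borel_probsD)
  have sub: "{p :: 'a \<times> 'b. norm p > 2 * B} \<subseteq> {p. norm (fst p) > B} \<union> {p. norm (snd p) > B}"
  proof
    fix p :: "'a \<times> 'b" assume "p \<in> {p. norm p > 2 * B}"
    then show "p \<in> {p. norm (fst p) > B} \<union> {p. norm (snd p) > B}"
      using norm_Pair_le[of "fst p" "snd p"] by auto
  qed
  have [measurable]: "{p. norm (fst p) > B} \<in> sets P" "{p. norm (snd p) > B} \<in> sets P"
    by measurable
  have "measure P {p. norm p > 2 * B} \<le> measure P ({p. norm (fst p) > B} \<union> {p. norm (snd p) > B})"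
    using sub by (intro finite_measure_mono) auto
  also have "\<dots> \<le> measure P {p. norm (fst p) > B} + measure P {p. norm (snd p) > B}"
    by (intro measure_Un_le) measurable
  also have "\<dots> = measure (distr P borel fst) {x. norm x > B} + measure (distr P borel snd) {x. norm x > B}"
    by (subst (1 2) measure_distr) (auto simp: sp vimage_def)
  finally show ?thesis .
qed

text \<open>Fatou's lemma for the inner and then for the outer integral; the kernel is continuous,
  so it converges along almost surely convergent points.\<close>

lemma gw_cost_liminf:
  fixes Z :: "nat \<Rightarrow> 'w \<Rightarrow> real \<times> real"
  assumes M: "prob_space M" and Z[measurable]: "\<And>n. Z n \<in> borel_measurable M" "Z' \<in> borel_measurable M"
    and lim: "AE x in M. (\<lambda>n. Z n x) \<longlonglongrightarrow> Z' x"
  shows "gw_cost sqdist sqdist (distr M borel Z') \<le>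
    liminf (\<lambda>n. gw_cost sqdist sqdist (distr M borel (Z n)))"
proof -
  interpret prob_space M by fact
  define k where "k = (\<lambda>p p' :: real \<times> real.
    ennreal (\<bar>sqdist (fst p) (fst p') - sqdist (snd p) (snd p')\<bar>\<^sup>2))"
  have k: "case_prod k \<in> borel_measurable (borel \<Otimes>\<^sub>M borel)"
    unfolding k_def by (rule gw_kernel_measurable[OF sqdist_measurable sqdist_measurable])
  have [measurable]: "(\<lambda>x. k (u x) (v x)) \<in> borel_measurable N"
    if "u \<in> borel_measurable N" "v \<in> borel_measurable N" for u v and N :: "'c measure"
    using measurable_compose[OF measurable_Pair[OF that] k] by simp
  have cost: "gw_cost sqdist sqdist (distr M borel f) = (\<integral>\<^sup>+\<omega>'. (\<integral>\<^sup>+\<omega>. k (f \<omega>) (f \<omega>') \<partial>M) \<partial>M)"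
    if "f \<in> borel_measurable M" for f
    using that by (simp add: gw_cost_distr sqdist_measurable M k_def)
  have conv: "(\<lambda>n. k (u n) (v n)) \<longlonglongrightarrow> k u' v'" if "u \<longlonglongrightarrow> u'" "v \<longlonglongrightarrow> v'" for u v u' v'
    unfolding k_def sqdist_def using that by (intro tendsto_intros)
  have "(\<integral>\<^sup>+\<omega>'. (\<integral>\<^sup>+\<omega>. k (Z' \<omega>) (Z' \<omega>') \<partial>M) \<partial>M) \<le>
      (\<integral>\<^sup>+\<omega>'. liminf (\<lambda>n. \<integral>\<^sup>+\<omega>. k (Z n \<omega>) (Z n \<omega>') \<partial>M) \<partial>M)"
  proof (rule nn_integral_mono_AE)
    show "AE \<omega>' in M. (\<integral>\<^sup>+\<omega>. k (Z' \<omega>) (Z' \<omega>') \<partial>M) \<le> liminf (\<lambda>n. \<integral>\<^sup>+\<omega>. k (Z n \<omega>) (Z n \<omega>') \<partial>M)"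
      using lim
    proof eventually_elim
      case (elim \<omega>')
      have "(\<integral>\<^sup>+\<omega>. k (Z' \<omega>) (Z' \<omega>') \<partial>M) = (\<integral>\<^sup>+\<omega>. liminf (\<lambda>n. k (Z n \<omega>) (Z n \<omega>')) \<partial>M)"
      proof (rule nn_integral_cong_AE)
        show "AE \<omega> in M. k (Z' \<omega>) (Z' \<omega>') = liminf (\<lambda>n. k (Z n \<omega>) (Z n \<omega>'))"
          using lim
        proof eventually_elim
          case (elim \<omega>)
          from conv[OF this \<open>(\<lambda>n. Z n \<omega>') \<longlonglongrightarrow> Z' \<omega>'\<close>] show ?case
            by (simp add: lim_imp_Liminf)
        qed
      qed
      also have "\<dots> \<le> liminf (\<lambda>n. \<integral>\<^sup>+\<omega>. k (Z n \<omega>) (Z n \<omega>') \<partial>M)"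
        by (intro nn_integral_liminf) measurable
      finally show ?case .
    qed
  qed
  also have "\<dots> \<le> liminf (\<lambda>n. \<integral>\<^sup>+\<omega>'. (\<integral>\<^sup>+\<omega>. k (Z n \<omega>) (Z n \<omega>') \<partial>M) \<partial>M)"
    by (intro nn_integral_liminf) measurable
  finally show ?thesis by (simp add: cost)
qed

text \<open>Near-optimal couplings for the directions \<open>\<theta> n\<close> are tight because
  convergent directions are bounded. A subsequential limit has the marginals belonging to \<theta>'
  and, by Fatou, cost at most a. Varying directions give lower semicontinuity; a constant sequence
  gives an optimal coupling.\<close>

lemma projected_coupling_limit:
  fixes \<mu> \<nu> :: "'a::euclidean_space measure" and a :: ennreal
  assumes \<mu>: "\<mu> \<in> borel_probs" and \<nu>: "\<nu> \<in> borel_probs" and lim: "\<theta> \<longlonglongrightarrow> \<theta>'" and "a \<noteq> \<infinity>"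
    and le: "\<And>n. (GW2 sqdist sqdist (distr \<mu> borel (proj (\<theta> n))) (distr \<nu> borel (proj (\<theta> n))))\<^sup>2 \<le> a"
  shows "\<exists>\<pi>\<in>couplings (distr \<mu> borel (proj \<theta>')) (distr \<nu> borel (proj \<theta>')).
    gw_cost sqdist sqdist \<pi> \<le> a"
proof -
  let ?D = "\<lambda>\<mu> \<theta>. distr \<mu> borel (proj \<theta>)"
  interpret \<mu>: prob_space \<mu> using borel_probsD[OF \<mu>] by simp
  interpret \<nu>: prob_space \<nu> using borel_probsD[OF \<nu>] by simp
  note [measurable_cong] = borel_probsD(1)[OF \<mu>] borel_probsD(1)[OF \<nu>]
  have D: "?D \<mu> \<theta> \<in> borel_probs" "?D \<nu> \<theta> \<in> borel_probs" for \<theta>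
    by (auto intro!: borel_probs_distr \<mu>.prob_space_axioms \<nu>.prob_space_axioms)
  have "\<exists>\<pi>\<in>couplings (?D \<mu> (\<theta> n)) (?D \<nu> (\<theta> n)). gw_cost sqdist sqdist \<pi> < a + ennreal (1 / Suc n)" for n
  proof -
    \<comment> \<open>Finiteness of a makes the inequality strict, so the infimum supplies a
      coupling below the bound; the excess 1/(n+1) tends to 0 along the subsequence.\<close>
    have "a < a + ennreal (1 / Suc n)"
      using \<open>a \<noteq> \<infinity>\<close> by (simp add: ennreal_add_left_cancel_less less_top)
    with le[of n] have "(INF \<pi>\<in>couplings (?D \<mu> (\<theta> n)) (?D \<nu> (\<theta> n)). gw_cost sqdist sqdist \<pi>) < a + ennreal (1 / Suc n)"
      unfolding GW2_power2 by (rule le_less_trans)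
    then show ?thesis by (simp add: INF_less_iff)
  qed
  then obtain \<pi> where \<pi>: "\<And>n. \<pi> n \<in> couplings (?D \<mu> (\<theta> n)) (?D \<nu> (\<theta> n))"
    "\<And>n. gw_cost sqdist sqdist (\<pi> n) < a + ennreal (1 / Suc n)" by metis
  note P = couplings_borel_probs[OF D \<pi>(1)]
  have "bounded (range \<theta>)" using lim by (intro convergent_imp_bounded)
  then obtain K where K: "\<And>n. norm (\<theta> n) \<le> K" "K > 0"
    by (auto simp: bounded_pos)
  \<comment> \<open>The projections stretch norms by at most K, so the tails of all projected
    measures are controlled by those of one fixed measure.\<close>
  have proj_tail: "measure (?D \<rho> (\<theta> n)) {x. norm x > K * B} \<le> measure \<rho> {x. norm x > B}"
    if \<rho>: "\<rho> \<in> borel_probs" for \<rho> n B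
  proof -
    interpret prob_space \<rho> using borel_probsD[OF \<rho>] by simp
    note [measurable_cong] = borel_probsD(1)[OF \<rho>]
    have "measure (?D \<rho> (\<theta> n)) {x. norm x > K * B} = measure \<rho> {x. \<bar>x \<bullet> \<theta> n\<bar> > K * B}"
      by (subst measure_distr) (auto simp: borel_probsD(3)[OF \<rho>] proj_def vimage_def)
    also have "\<dots> \<le> measure \<rho> {x. norm x > B}"
    proof (rule finite_measure_mono)
      have "K * B < \<bar>x \<bullet> \<theta> n\<bar> \<Longrightarrow> B < norm x" for x
      proof -
        assume *: "K * B < \<bar>x \<bullet> \<theta> n\<bar>"
        also have "\<dots> \<le> norm x * norm (\<theta> n)" by (rule Cauchy_Schwarz_ineq2)
        also have "\<dots> \<le> norm x * K" using K by (intro mult_left_mono) auto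
        finally show ?thesis using K(2) by (simp add: mult.commute)
      qed
      then show "{x. K * B < \<bar>x \<bullet> \<theta> n\<bar>} \<subseteq> {x. B < norm x}" by auto
    qed measurable
    finally show ?thesis .
  qed
  obtain e :: "real \<times> real \<Rightarrow> real" where e: "coding e" using coding_real_pair by blast
  have tight: "\<exists>B. \<forall>n. measure (\<pi> n) {x. norm x > B} < \<epsilon>" if "\<epsilon> > 0" for \<epsilon>
  proof -
    obtain B1 where B1: "measure \<mu> {x. norm x > B1} < \<epsilon> / 2"
      using tail_measure_small[OF \<mu>, of "\<epsilon> / 2"] \<open>\<epsilon> > 0\<close> by auto
    obtain B2 where B2: "measure \<nu> {x. norm x > B2} < \<epsilon> / 2"
      using tail_measure_small[OF \<nu>, of "\<epsilon> / 2"] \<open>\<epsilon> > 0\<close> by auto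
    let ?B = "max B1 B2"
    have "measure \<mu> {x. norm x > ?B} \<le> measure \<mu> {x. norm x > B1}"
      "measure \<nu> {x. norm x > ?B} \<le> measure \<nu> {x. norm x > B2}"
      by (auto intro!: \<mu>.finite_measure_mono \<nu>.finite_measure_mono)
    then have "measure (\<pi> n) {x. norm x > 2 * (K * ?B)} < \<epsilon>" for n
      using Pair_tail_le[OF P(1)[of n], of "K * ?B"] proj_tail[OF \<mu>, of n ?B] proj_tail[OF \<nu>, of n ?B] B1 B2
      unfolding P(2,3) by linarith
    then show ?thesis by blast
  qed
  obtain r and \<Omega> :: "real measure" and Z Z' where r: "strict_mono r" and \<Omega>: "prob_space \<Omega>"
    and Z[measurable]: "\<And>n. Z n \<in> borel_measurable \<Omega>" "Z' \<in> borel_measurable \<Omega>"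
    and law: "\<And>n. distr \<Omega> borel (Z n) = \<pi> (r n)" and Zlim: "AE \<omega> in \<Omega>. (\<lambda>n. Z n \<omega>) \<longlonglongrightarrow> Z' \<omega>"
    by (rule tight_subsequence_representation[OF e borel_probsD(2)[OF P(1)] borel_probsD(1)[OF P(1)] tight])
      (assumption, rule that)
  have \<theta>r: "(\<lambda>n. \<theta> (r n)) \<longlonglongrightarrow> \<theta>'"
    using LIMSEQ_subseq_LIMSEQ[OF lim r] by (simp add: comp_def)
  \<comment> \<open>The comparison sequence consists of the projections of \<mu> itself, which
    converge pointwise with the directions.\<close>
  have marg1: "distr \<Omega> borel (\<lambda>\<omega>. fst (Z' \<omega>)) = ?D \<mu> \<theta>'"
  proof (rule distr_limit_unique[OF \<Omega> \<mu>.prob_space_axioms])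
    show "AE \<omega> in \<Omega>. (\<lambda>n. fst (Z n \<omega>)) \<longlonglongrightarrow> fst (Z' \<omega>)"
      using Zlim by eventually_elim (rule tendsto_fst)
    show "AE x in \<mu>. (\<lambda>n. proj (\<theta> (r n)) x) \<longlonglongrightarrow> proj \<theta>' x"
      unfolding proj_def using \<theta>r by (intro AE_I2 tendsto_intros)
    show "distr \<Omega> borel (\<lambda>\<omega>. fst (Z n \<omega>)) = ?D \<mu> (\<theta> (r n))" for n
      unfolding P(2)[symmetric, of "r n"] law[symmetric] by (subst distr_distr) (auto simp: comp_def)
  qed measurable
  have marg2: "distr \<Omega> borel (\<lambda>\<omega>. snd (Z' \<omega>)) = ?D \<nu> \<theta>'"
  proof (rule distr_limit_unique[OF \<Omega> \<nu>.prob_space_axioms])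
    show "AE \<omega> in \<Omega>. (\<lambda>n. snd (Z n \<omega>)) \<longlonglongrightarrow> snd (Z' \<omega>)"
      using Zlim by eventually_elim (rule tendsto_snd)
    show "AE x in \<nu>. (\<lambda>n. proj (\<theta> (r n)) x) \<longlonglongrightarrow> proj \<theta>' x"
      unfolding proj_def using \<theta>r by (intro AE_I2 tendsto_intros)
    show "distr \<Omega> borel (\<lambda>\<omega>. snd (Z n \<omega>)) = ?D \<nu> (\<theta> (r n))" for n
      unfolding P(3)[symmetric, of "r n"] law[symmetric] by (subst distr_distr) (auto simp: comp_def)
  qed measurable
  have "gw_cost sqdist sqdist (distr \<Omega> borel Z') \<le> liminf (\<lambda>n. gw_cost sqdist sqdist (\<pi> (r n)))"
    using gw_cost_liminf[OF \<Omega> Z Zlim] by (simp add: law)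
  also have "\<dots> \<le> liminf (\<lambda>n. a + ennreal (1 / Suc (r n)))"
    using \<pi>(2) by (intro Liminf_mono always_eventually allI less_imp_le)
  also have "\<dots> = a"
  proof -
    have "(\<lambda>n. a + ennreal (1 / Suc (r n))) \<longlonglongrightarrow> a + ennreal 0"
      using LIMSEQ_subseq_LIMSEQ[OF LIMSEQ_inverse_real_of_nat r]
      by (intro tendsto_add tendsto_const tendsto_ennrealI) (simp add: comp_def inverse_eq_divide)
    then show ?thesis by (simp add: lim_imp_Liminf)
  qed
  finally have "gw_cost sqdist sqdist (distr \<Omega> borel Z') \<le> a" .
  moreover have "distr \<Omega> borel Z' \<in> couplings (?D \<mu> \<theta>') (?D \<nu> \<theta>')"
    using distr_Pair_couplings[of "\<lambda>\<omega>. fst (Z' \<omega>)" \<Omega> "\<lambda>\<omega>. snd (Z' \<omega>)"] unfolding marg1 marg2 by simp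
  ultimately show ?thesis by blast
qed

text \<open>Sublevel sets are sequentially closed. They are taken at level a for \<open>GW2\<close>
  and at level a^2 for its square, the quantity that \<open>projected_coupling_limit\<close>
  bounds.\<close>

lemma GW2_proj_measurable:
  fixes \<mu> \<nu> :: "'a::euclidean_space measure"
  assumes \<mu>: "\<mu> \<in> borel_probs" and \<nu>: "\<nu> \<in> borel_probs"
  shows "(\<lambda>\<theta>. GW2 sqdist sqdist (distr \<mu> borel (proj \<theta>)) (distr \<nu> borel (proj \<theta>)))
    \<in> borel_measurable borel"
proof (rule borel_measurableI_le)
  fix a :: ennreal
  let ?S = "{\<theta>. GW2 sqdist sqdist (distr \<mu> borel (proj \<theta>)) (distr \<nu> borel (proj \<theta>)) \<le> a}"
  have "closed ?S"
  proof (cases "a = \<infinity>")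
    case False
    show ?thesis unfolding closed_sequential_limits
    proof safe
      fix \<theta> \<theta>' assume \<theta>: "\<forall>n. \<theta> n \<in> ?S" "\<theta> \<longlonglongrightarrow> \<theta>'"
      have "a\<^sup>2 \<noteq> \<infinity>" using False by (simp add: power2_eq_square ennreal_mult_eq_top_iff)
      moreover have "(GW2 sqdist sqdist (distr \<mu> borel (proj (\<theta> n))) (distr \<nu> borel (proj (\<theta> n))))\<^sup>2 \<le> a\<^sup>2" for n
        using \<theta>(1) by (intro power_mono) auto
      ultimately obtain \<pi> where \<pi>: "\<pi> \<in> couplings (distr \<mu> borel (proj \<theta>')) (distr \<nu> borel (proj \<theta>'))"
        "gw_cost sqdist sqdist \<pi> \<le> a\<^sup>2"
        using projected_coupling_limit[OF \<mu> \<nu> \<theta>(2)] by blast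
      have "GW2 sqdist sqdist (distr \<mu> borel (proj \<theta>')) (distr \<nu> borel (proj \<theta>')) \<le> ennreal_sqrt (gw_cost sqdist sqdist \<pi>)"
        by (rule GW2_le_coupling) fact
      also have "\<dots> \<le> a" using \<pi>(2) by (simp add: ennreal_sqrt_le_iff)
      finally show "GW2 sqdist sqdist (distr \<mu> borel (proj \<theta>')) (distr \<nu> borel (proj \<theta>')) \<le> a" .
    qed
  qed simp
  then show "{\<theta> \<in> space borel. GW2 sqdist sqdist (distr \<mu> borel (proj \<theta>)) (distr \<nu> borel (proj \<theta>)) \<le> a} \<in> sets borel"
    by simp
qed

section \<open>Gluing over a countable partition\<close>

text \<open>Rather than conditioning on the exact middle coordinate, the two couplings are made
  conditionally independent given its cell. On the product measure this is the density 1/w(i) where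
  both middle coordinates lie in cell i; the common marginal gives both couplings the same cell
  probabilities w(i). The middle coordinates then agree up to the size of a cell.\<close>

lemma discrete_gluing:
  fixes \<pi>1 :: "('a::second_countable_topology \<times> 'b::second_countable_topology) measure"
    and \<pi>2 :: "('b \<times> 'c::second_countable_topology) measure" and h :: "'b \<Rightarrow> int"
  assumes p1: "\<pi>1 \<in> borel_probs" and p2: "\<pi>2 \<in> borel_probs"
    and marg: "distr \<pi>1 borel snd = distr \<pi>2 borel fst"
    and h[measurable]: "h \<in> borel \<rightarrow>\<^sub>M count_space UNIV"
  obtains \<gamma> where "\<gamma> \<in> borel_probs" "distr \<gamma> borel fst = \<pi>1" "distr \<gamma> borel snd = \<pi>2"
    "AE x in \<gamma>. h (snd (fst x)) = h (fst (snd x))"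
proof -
  interpret \<pi>1: prob_space \<pi>1 using borel_probsD[OF p1] by simp
  interpret \<pi>2: prob_space \<pi>2 using borel_probsD[OF p2] by simp
  interpret pair_prob_space \<pi>1 \<pi>2 ..
  note [measurable_cong] = borel_probsD(1)[OF p1] borel_probsD(1)[OF p2]
  have sp[simp]: "space \<pi>1 = UNIV" "space \<pi>2 = UNIV"
    using p1 p2 borel_probsD(3) by blast+
  define w where "w i = emeasure (distr \<pi>1 borel snd) {y. h y = i}" for i
  have cell[measurable]: "{y. h y = i} \<in> sets borel" for i by measurable
  have w1: "w i = emeasure \<pi>1 {p. h (snd p) = i}" for i
    unfolding w_def by (subst emeasure_distr) (auto simp: vimage_def)
  have w2: "w i = emeasure \<pi>2 {q. h (fst q) = i}" for i
    unfolding w_def marg by (subst emeasure_distr) (auto simp: vimage_def)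
  have wfin: "w i \<noteq> \<infinity>" for i by (simp add: w1)
  \<comment> \<open>There are countably many cells, so all those of probability 0 can be discarded
    at once.\<close>
  have pos1: "AE p in \<pi>1. w (h (snd p)) \<noteq> 0"
  proof -
    have "AE p in \<pi>1. \<forall>i. w i = 0 \<longrightarrow> h (snd p) \<noteq> i"
      unfolding AE_all_countable
    proof
      fix i show "AE p in \<pi>1. w i = 0 \<longrightarrow> h (snd p) \<noteq> i"
        by (cases "w i = 0") (auto simp: w1 intro!: AE_I[of _ _ "{p. h (snd p) = i}"])
    qed
    then show ?thesis by eventually_elim auto
  qed
  have pos2: "AE q in \<pi>2. w (h (fst q)) \<noteq> 0"
  proof -
    have "AE q in \<pi>2. \<forall>i. w i = 0 \<longrightarrow> h (fst q) \<noteq> i"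
      unfolding AE_all_countable
    proof
      fix i show "AE q in \<pi>2. w i = 0 \<longrightarrow> h (fst q) \<noteq> i"
        by (cases "w i = 0") (auto simp: w2 intro!: AE_I[of _ _ "{q. h (fst q) = i}"])
    qed
    then show ?thesis by eventually_elim auto
  qed
  define d where "d = (\<lambda>x :: ('a \<times> 'b) \<times> 'b \<times> 'c.
    if h (snd (fst x)) = h (fst (snd x)) then inverse (w (h (snd (fst x)))) else 0)"
  have d[measurable]: "d \<in> borel_measurable (\<pi>1 \<Otimes>\<^sub>M \<pi>2)" unfolding d_def by measurable
  define \<gamma> where "\<gamma> = density (\<pi>1 \<Otimes>\<^sub>M \<pi>2) d"
  \<comment> \<open>Outside null cells the weights cancel. On a null cell the density is
    \<open>inverse 0 = \<infinity>\<close>, but the cell has measure 0 and \<infinity> * 0 =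
    0.\<close>
  have int1: "(\<integral>\<^sup>+q. d (p, q) \<partial>\<pi>2) = (if w (h (snd p)) = 0 then 0 else 1)" for p
  proof -
    have "(\<integral>\<^sup>+q. d (p, q) \<partial>\<pi>2) = (\<integral>\<^sup>+q. inverse (w (h (snd p))) * indicator {q. h (fst q) = h (snd p)} q \<partial>\<pi>2)"
      by (intro nn_integral_cong) (auto simp: d_def indicator_def)
    also have "\<dots> = inverse (w (h (snd p))) * w (h (snd p))"
      by (subst nn_integral_cmult_indicator) (auto simp: w2)
    also have "\<dots> = (if w (h (snd p)) = 0 then 0 else 1)"
      using wfin by (auto simp: ennreal_inverse_mult less_top mult.commute[of "inverse _"] ennreal_divide_self[unfolded divide_ennreal_def])
    finally show ?thesis .
  qed
  have int2: "(\<integral>\<^sup>+p. d (p, q) \<partial>\<pi>1) = (if w (h (fst q)) = 0 then 0 else 1)" for q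
  proof -
    have "(\<integral>\<^sup>+p. d (p, q) \<partial>\<pi>1) = (\<integral>\<^sup>+p. inverse (w (h (fst q))) * indicator {p. h (snd p) = h (fst q)} p \<partial>\<pi>1)"
      by (intro nn_integral_cong) (auto simp: d_def indicator_def)
    also have "\<dots> = inverse (w (h (fst q))) * w (h (fst q))"
      by (subst nn_integral_cmult_indicator) (auto simp: w1)
    also have "\<dots> = (if w (h (fst q)) = 0 then 0 else 1)"
      using wfin by (auto simp: ennreal_inverse_mult less_top mult.commute[of "inverse _"] ennreal_divide_self[unfolded divide_ennreal_def])
    finally show ?thesis .
  qed
  have sets: "sets \<gamma> = sets borel"
    unfolding \<gamma>_def by (simp add: borel_prod[symmetric] borel_probsD(1)[OF p1] borel_probsD(1)[OF p2] cong: sets_pair_measure_cong)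
  have d1: "distr \<gamma> borel fst = \<pi>1"
  proof (rule measure_eqI)
    fix A assume "A \<in> sets (distr \<gamma> borel fst)"
    then have [measurable]: "A \<in> sets borel" by simp
    have "emeasure (distr \<gamma> borel fst) A = emeasure \<gamma> (fst -` A \<inter> space (\<pi>1 \<Otimes>\<^sub>M \<pi>2))"
      unfolding \<gamma>_def by (subst emeasure_distr) (auto simp: space_pair_measure)
    also have "\<dots> = (\<integral>\<^sup>+x. d x * indicator (fst -` A \<inter> space (\<pi>1 \<Otimes>\<^sub>M \<pi>2)) x \<partial>(\<pi>1 \<Otimes>\<^sub>M \<pi>2))"
      unfolding \<gamma>_def by (intro emeasure_density) measurable
    also have "\<dots> = (\<integral>\<^sup>+x. d x * indicator A (fst x) \<partial>(\<pi>1 \<Otimes>\<^sub>M \<pi>2))"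
      by (intro nn_integral_cong) (auto simp: indicator_def)
    also have "\<dots> = (\<integral>\<^sup>+p. (\<integral>\<^sup>+q. d (p, q) * indicator A p \<partial>\<pi>2) \<partial>\<pi>1)"
      by (subst \<pi>2.nn_integral_fst[symmetric]) auto
    also have "\<dots> = (\<integral>\<^sup>+p. (\<integral>\<^sup>+q. d (p, q) \<partial>\<pi>2) * indicator A p \<partial>\<pi>1)"
      by (intro nn_integral_cong nn_integral_multc) measurable
    also have "\<dots> = (\<integral>\<^sup>+p. indicator A p \<partial>\<pi>1)"
      using pos1 by (intro nn_integral_cong_AE) (auto simp: int1)
    finally show "emeasure (distr \<gamma> borel fst) A = emeasure \<pi>1 A" by simp
  qed (simp add: borel_probsD(1)[OF p1])
  have d2: "distr \<gamma> borel snd = \<pi>2"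
  proof (rule measure_eqI)
    fix A assume "A \<in> sets (distr \<gamma> borel snd)"
    then have [measurable]: "A \<in> sets borel" by simp
    have "emeasure (distr \<gamma> borel snd) A = emeasure \<gamma> (snd -` A \<inter> space (\<pi>1 \<Otimes>\<^sub>M \<pi>2))"
      unfolding \<gamma>_def by (subst emeasure_distr) (auto simp: space_pair_measure)
    also have "\<dots> = (\<integral>\<^sup>+x. d x * indicator (snd -` A \<inter> space (\<pi>1 \<Otimes>\<^sub>M \<pi>2)) x \<partial>(\<pi>1 \<Otimes>\<^sub>M \<pi>2))"
      unfolding \<gamma>_def by (intro emeasure_density) measurable
    also have "\<dots> = (\<integral>\<^sup>+x. d x * indicator A (snd x) \<partial>(\<pi>1 \<Otimes>\<^sub>M \<pi>2))"
      by (intro nn_integral_cong) (auto simp: indicator_def)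
    also have "\<dots> = (\<integral>\<^sup>+q. (\<integral>\<^sup>+p. d (p, q) * indicator A q \<partial>\<pi>1) \<partial>\<pi>2)"
      by (subst nn_integral_snd[symmetric]) auto
    also have "\<dots> = (\<integral>\<^sup>+q. (\<integral>\<^sup>+p. d (p, q) \<partial>\<pi>1) * indicator A q \<partial>\<pi>2)"
      by (intro nn_integral_cong nn_integral_multc) measurable
    also have "\<dots> = (\<integral>\<^sup>+q. indicator A q \<partial>\<pi>2)"
      using pos2 by (intro nn_integral_cong_AE) (auto simp: int2)
    finally show "emeasure (distr \<gamma> borel snd) A = emeasure \<pi>2 A" by simp
  qed (simp add: borel_probsD(1)[OF p2])
  show ?thesis
  proof
    have "fst \<in> borel_measurable \<gamma>" using sets by (simp add: measurable_cong_sets[OF sets refl])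
    then have "prob_space \<gamma>"
      using d1 p1 borel_probsD(2) by (intro prob_space_distrD[of fst \<gamma> borel]) auto
    then show "\<gamma> \<in> borel_probs" using sets by (simp add: space_prob_algebra)
    show "AE x in \<gamma>. h (snd (fst x)) = h (fst (snd x))"
      unfolding \<gamma>_def AE_density[OF d] by (auto simp: d_def)
  qed (fact d1 d2)+
qed

section \<open>Gluing and the triangle inequality\<close>

lemma floor_mult_eq_imp_close:
  fixes x y c :: real
  assumes "\<lfloor>c * x\<rfloor> = \<lfloor>c * y\<rfloor>" "c > 0"
  shows "\<bar>x - y\<bar> < 1 / c"
proof -
  have "\<bar>c * x - c * y\<bar> < 1" using assms(1) by linarith
  then have "c * \<bar>x - y\<bar> < 1" using assms(2) by (simp add: abs_mult flip: right_diff_distrib)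
  then show ?thesis using assms(2) by (simp add: pos_less_divide_eq mult.commute)
qed

text \<open>The laws of the two pairs are \<pi>1 and \<pi>2 at every stage and hence in the limit,
  while cells of length 1/(n+1) force the two middle coordinates together.\<close>

lemma gluing:
  fixes \<alpha> \<beta> \<rho> :: "real measure"
  assumes probs: "\<alpha> \<in> borel_probs" "\<beta> \<in> borel_probs" "\<rho> \<in> borel_probs"
    and \<pi>1: "\<pi>1 \<in> couplings \<alpha> \<beta>" and \<pi>2: "\<pi>2 \<in> couplings \<beta> \<rho>"
  obtains \<Omega> :: "real measure" and X Y Z :: "real \<Rightarrow> real"
  where "prob_space \<Omega>" "X \<in> borel_measurable \<Omega>" "Y \<in> borel_measurable \<Omega>" "Z \<in> borel_measurable \<Omega>"
    "distr \<Omega> borel (\<lambda>\<omega>. (X \<omega>, Y \<omega>)) = \<pi>1" "distr \<Omega> borel (\<lambda>\<omega>. (Y \<omega>, Z \<omega>)) = \<pi>2"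
proof -
  note P1 = couplings_borel_probs[OF probs(1,2) \<pi>1] and P2 = couplings_borel_probs[OF probs(2,3) \<pi>2]
  define h where "h n y = \<lfloor>real (Suc n) * y\<rfloor>" for n and y :: real
  have h: "h n \<in> borel \<rightarrow>\<^sub>M count_space UNIV" for n unfolding h_def by measurable
  have "\<exists>\<gamma>. \<gamma> \<in> borel_probs \<and> distr \<gamma> borel fst = \<pi>1 \<and> distr \<gamma> borel snd = \<pi>2 \<and>
    (AE x in \<gamma>. h n (snd (fst x)) = h n (fst (snd x)))" for n
  proof -
    have "distr \<pi>1 borel snd = distr \<pi>2 borel fst" using P1(3) P2(2) by simp
    from discrete_gluing[OF P1(1) P2(1) this h[of n]] show ?thesis by blast
  qed
  then have "\<exists>\<gamma>. \<forall>n. \<gamma> n \<in> borel_probs \<and> distr (\<gamma> n) borel fst = \<pi>1 \<and> distr (\<gamma> n) borel snd = \<pi>2 \<and>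
    (AE x in \<gamma> n. h n (snd (fst x)) = h n (fst (snd x)))"
    by (intro choice allI)
  then obtain \<gamma> where \<gamma>: "\<And>n. \<gamma> n \<in> borel_probs" "\<And>n. distr (\<gamma> n) borel fst = \<pi>1"
    "\<And>n. distr (\<gamma> n) borel snd = \<pi>2"
    "\<And>n. AE x in \<gamma> n. h n (snd (fst x)) = h n (fst (snd x))" by blast
  obtain e2 :: "real \<times> real \<Rightarrow> real" where e2: "coding e2" using coding_real_pair by blast
  obtain e :: "(real \<times> real) \<times> real \<times> real \<Rightarrow> real" where e: "coding e"
    using coding_Pair[OF e2 e2] by blast
  have tight: "\<exists>B. \<forall>n. measure (\<gamma> n) {x. norm x > B} < \<epsilon>" if "\<epsilon> > 0" for \<epsilon>
  proof -
    interpret \<pi>1: prob_space \<pi>1 using borel_probsD[OF P1(1)] by simp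
    interpret \<pi>2: prob_space \<pi>2 using borel_probsD[OF P2(1)] by simp
    note [measurable_cong] = borel_probsD(1)[OF P1(1)] borel_probsD(1)[OF P2(1)]
    obtain B1 where B1: "measure \<pi>1 {x. norm x > B1} < \<epsilon> / 2"
      using tail_measure_small[OF P1(1), of "\<epsilon> / 2"] \<open>\<epsilon> > 0\<close> by auto
    obtain B2 where B2: "measure \<pi>2 {x. norm x > B2} < \<epsilon> / 2"
      using tail_measure_small[OF P2(1), of "\<epsilon> / 2"] \<open>\<epsilon> > 0\<close> by auto
    let ?B = "max B1 B2"
    have "measure \<pi>1 {x. norm x > ?B} \<le> measure \<pi>1 {x. norm x > B1}"
      "measure \<pi>2 {x. norm x > ?B} \<le> measure \<pi>2 {x. norm x > B2}"
      by (auto intro!: \<pi>1.finite_measure_mono \<pi>2.finite_measure_mono)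
    then have "measure (\<gamma> n) {x. norm x > 2 * ?B} < \<epsilon>" for n
      using Pair_tail_le[OF \<gamma>(1)[of n], of ?B] B1 B2 unfolding \<gamma>(2,3) by linarith
    then show ?thesis by blast
  qed
  obtain r and \<Omega> :: "real measure" and W W' where r: "strict_mono r" and \<Omega>: "prob_space \<Omega>"
    and W[measurable]: "\<And>n. W n \<in> borel_measurable \<Omega>" "W' \<in> borel_measurable \<Omega>"
    and law: "\<And>n. distr \<Omega> borel (W n) = \<gamma> (r n)" and Wlim: "AE \<omega> in \<Omega>. (\<lambda>n. W n \<omega>) \<longlonglongrightarrow> W' \<omega>"
    by (rule tight_subsequence_representation[OF e borel_probsD(2)[OF \<gamma>(1)] borel_probsD(1)[OF \<gamma>(1)] tight])
      (assumption, rule that)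
  have id: "distr \<pi> borel (\<lambda>x. x) = \<pi>" "(\<lambda>x. x) \<in> borel_measurable \<pi>"
    if "\<pi> \<in> borel_probs" for \<pi> :: "(real \<times> real) measure"
    using that borel_probsD(1)[OF that] by (auto intro!: distr_id2)
  have 1: "distr \<Omega> borel (\<lambda>\<omega>. fst (W' \<omega>)) = \<pi>1"
  proof -
    have "distr \<Omega> borel (\<lambda>\<omega>. fst (W' \<omega>)) = distr \<pi>1 borel (\<lambda>x. x)"
    proof (rule distr_limit_unique[OF \<Omega> borel_probsD(2)[OF P1(1)]])
      show "AE \<omega> in \<Omega>. (\<lambda>n. fst (W n \<omega>)) \<longlonglongrightarrow> fst (W' \<omega>)"
        using Wlim by eventually_elim (rule tendsto_fst)
      show "distr \<Omega> borel (\<lambda>\<omega>. fst (W n \<omega>)) = distr \<pi>1 borel (\<lambda>x. x)" for n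
      proof -
        have "distr \<Omega> borel (\<lambda>\<omega>. fst (W n \<omega>)) = distr (distr \<Omega> borel (W n)) borel fst"
          by (subst distr_distr) (auto simp: comp_def)
        then show ?thesis by (simp add: law \<gamma>(2) id(1)[OF P1(1)])
      qed
    qed (use id(2)[OF P1(1)] in measurable)
    then show ?thesis by (simp add: id(1)[OF P1(1)])
  qed
  have 2: "distr \<Omega> borel (\<lambda>\<omega>. snd (W' \<omega>)) = \<pi>2"
  proof -
    have "distr \<Omega> borel (\<lambda>\<omega>. snd (W' \<omega>)) = distr \<pi>2 borel (\<lambda>x. x)"
    proof (rule distr_limit_unique[OF \<Omega> borel_probsD(2)[OF P2(1)]])
      show "AE \<omega> in \<Omega>. (\<lambda>n. snd (W n \<omega>)) \<longlonglongrightarrow> snd (W' \<omega>)"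
        using Wlim by eventually_elim (rule tendsto_snd)
      show "distr \<Omega> borel (\<lambda>\<omega>. snd (W n \<omega>)) = distr \<pi>2 borel (\<lambda>x. x)" for n
      proof -
        have "distr \<Omega> borel (\<lambda>\<omega>. snd (W n \<omega>)) = distr (distr \<Omega> borel (W n)) borel snd"
          by (subst distr_distr) (auto simp: comp_def)
        then show ?thesis by (simp add: law \<gamma>(3) id(1)[OF P2(1)])
      qed
    qed (use id(2)[OF P2(1)] in measurable)
    then show ?thesis by (simp add: id(1)[OF P2(1)])
  qed
  have "AE \<omega> in \<Omega>. h (r n) (snd (fst (W n \<omega>))) = h (r n) (fst (snd (W n \<omega>)))" for n
  proof -
    have "AE x in distr \<Omega> borel (W n). h (r n) (snd (fst x)) = h (r n) (fst (snd x))"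
      unfolding law by (rule \<gamma>(4))
    moreover have "{x. h (r n) (snd (fst x)) = h (r n) (fst (snd x))} \<in> sets (borel :: ((real \<times> real) \<times> real \<times> real) measure)"
      unfolding h_def by measurable
    ultimately show ?thesis by (subst (asm) AE_distr_iff) auto
  qed
  then have "AE \<omega> in \<Omega>. \<forall>n. h (r n) (snd (fst (W n \<omega>))) = h (r n) (fst (snd (W n \<omega>)))"
    by (simp add: AE_all_countable)
  then have mid: "AE \<omega> in \<Omega>. snd (fst (W' \<omega>)) = fst (snd (W' \<omega>))"
    using Wlim
  proof eventually_elim
    case (elim \<omega>)
    have "norm (snd (fst (W n \<omega>)) - fst (snd (W n \<omega>))) \<le> 1 / Suc (r n)" for n
      using elim(1)[rule_format, of n] unfolding h_def real_norm_def
      by (intro less_imp_le floor_mult_eq_imp_close) auto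
    moreover have "(\<lambda>n. 1 / real (Suc (r n))) \<longlonglongrightarrow> 0"
      using LIMSEQ_subseq_LIMSEQ[OF LIMSEQ_inverse_real_of_nat r] by (simp add: comp_def inverse_eq_divide)
    ultimately have "(\<lambda>n. snd (fst (W n \<omega>)) - fst (snd (W n \<omega>))) \<longlonglongrightarrow> 0"
      by (rule Lim_null_comparison[OF always_eventually, OF allI])
    moreover have "(\<lambda>n. snd (fst (W n \<omega>)) - fst (snd (W n \<omega>))) \<longlonglongrightarrow> snd (fst (W' \<omega>)) - fst (snd (W' \<omega>))"
      using elim(2) by (intro tendsto_intros)
    ultimately have "0 = snd (fst (W' \<omega>)) - fst (snd (W' \<omega>))" by (rule LIMSEQ_unique)
    then show ?case by simp
  qed
  show ?thesis
  proof
    show "prob_space \<Omega>" by fact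
    show "(\<lambda>\<omega>. fst (fst (W' \<omega>))) \<in> borel_measurable \<Omega>" "(\<lambda>\<omega>. snd (fst (W' \<omega>))) \<in> borel_measurable \<Omega>"
      "(\<lambda>\<omega>. snd (snd (W' \<omega>))) \<in> borel_measurable \<Omega>" by measurable
    show "distr \<Omega> borel (\<lambda>\<omega>. (fst (fst (W' \<omega>)), snd (fst (W' \<omega>)))) = \<pi>1" using 1 by simp
    \<comment> \<open>The second pair brings its own middle coordinate; exchanging it for that of
      the first pair alters a null set.\<close>
    have "distr \<Omega> borel (\<lambda>\<omega>. (snd (fst (W' \<omega>)), snd (snd (W' \<omega>)))) = distr \<Omega> borel (\<lambda>\<omega>. snd (W' \<omega>))"
      using mid by (intro distr_cong_AE) (auto simp: prod_eq_iff)
    then show "distr \<Omega> borel (\<lambda>\<omega>. (snd (fst (W' \<omega>)), snd (snd (W' \<omega>)))) = \<pi>2" using 2 by simp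
  qed
qed

text \<open>Once X, Y, Z live on one space, the root of a cost is an L2 distance on
  \<open>\<Omega> \<Otimes>\<^sub>M \<Omega>\<close> between squared distance functions, and
  Minkowski's inequality applies. The bound is shown for arbitrary couplings and then passed to the
  infima.\<close>

lemma GW2_triangle:
  fixes \<alpha> \<beta> \<rho> :: "real measure"
  assumes probs: "\<alpha> \<in> borel_probs" "\<beta> \<in> borel_probs" "\<rho> \<in> borel_probs"
  shows "GW2 sqdist sqdist \<alpha> \<rho> \<le> GW2 sqdist sqdist \<alpha> \<beta> + GW2 sqdist sqdist \<beta> \<rho>"
proof -
  let ?c = "gw_cost sqdist sqdist"
  have step: "GW2 sqdist sqdist \<alpha> \<rho> \<le> ennreal_sqrt (?c \<pi>1) + ennreal_sqrt (?c \<pi>2)"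
    if \<pi>1: "\<pi>1 \<in> couplings \<alpha> \<beta>" and \<pi>2: "\<pi>2 \<in> couplings \<beta> \<rho>" for \<pi>1 \<pi>2
  proof -
    obtain \<Omega> :: "real measure" and X Y Z :: "real \<Rightarrow> real" where \<Omega>: "prob_space \<Omega>"
      and [measurable]: "X \<in> borel_measurable \<Omega>" "Y \<in> borel_measurable \<Omega>" "Z \<in> borel_measurable \<Omega>"
      and law: "distr \<Omega> borel (\<lambda>\<omega>. (X \<omega>, Y \<omega>)) = \<pi>1" "distr \<Omega> borel (\<lambda>\<omega>. (Y \<omega>, Z \<omega>)) = \<pi>2"
      by (rule gluing[OF probs \<pi>1 \<pi>2])
    interpret \<Omega>: prob_space \<Omega> by fact
    interpret \<Omega>\<Omega>: pair_prob_space \<Omega> \<Omega> ..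
    \<comment> \<open>The components are swapped because the outer integral of
      \<open>gw_cost\<close> runs over the primed point, and the outer integral of the product over
      the first component.\<close>
    define d where "d U V x = ennreal \<bar>sqdist (U (snd x)) (U (fst x)) - sqdist (V (snd x)) (V (fst x))\<bar>"
      for U V :: "real \<Rightarrow> real" and x
    have [measurable]: "d U V \<in> borel_measurable (\<Omega> \<Otimes>\<^sub>M \<Omega>)"
      if [measurable]: "U \<in> borel_measurable \<Omega>" "V \<in> borel_measurable \<Omega>" for U V
      unfolding d_def sqdist_def by measurable
    have cost: "?c (distr \<Omega> borel (\<lambda>\<omega>. (U \<omega>, V \<omega>))) = (\<integral>\<^sup>+x. (d U V x)\<^sup>2 \<partial>(\<Omega> \<Otimes>\<^sub>M \<Omega>))"
      if [measurable]: "U \<in> borel_measurable \<Omega>" "V \<in> borel_measurable \<Omega>" for U V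
    proof -
      have "(\<lambda>x. (d U V x)\<^sup>2) \<in> borel_measurable (\<Omega> \<Otimes>\<^sub>M \<Omega>)" by measurable
      from \<Omega>.nn_integral_fst[OF this] show ?thesis
        by (subst gw_cost_distr) (auto simp: sqdist_measurable \<Omega> d_def ennreal_power)
    qed
    have margX: "distr \<Omega> borel X = \<alpha>"
      using couplings_borel_probs(2)[OF probs(1,2) \<pi>1]
      unfolding law(1)[symmetric] by (subst (asm) distr_distr) (auto simp: comp_def)
    have margZ: "distr \<Omega> borel Z = \<rho>"
      using couplings_borel_probs(3)[OF probs(2,3) \<pi>2]
      unfolding law(2)[symmetric] by (subst (asm) distr_distr) (auto simp: comp_def)
    have "GW2 sqdist sqdist \<alpha> \<rho> \<le> ennreal_sqrt (?c (distr \<Omega> borel (\<lambda>\<omega>. (X \<omega>, Z \<omega>))))"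
      unfolding margX[symmetric] margZ[symmetric] by (intro GW2_le_coupling distr_Pair_couplings) measurable
    also have "\<dots> = ennreal_sqrt (\<integral>\<^sup>+x. (d X Z x)\<^sup>2 \<partial>(\<Omega> \<Otimes>\<^sub>M \<Omega>))"
      by (subst cost) measurable
    also have "\<dots> \<le> ennreal_sqrt (\<integral>\<^sup>+x. (d X Y x + d Y Z x)\<^sup>2 \<partial>(\<Omega> \<Otimes>\<^sub>M \<Omega>))"
    proof (intro ennreal_sqrt_mono nn_integral_mono power_mono zero_le)
      show "d X Z x \<le> d X Y x + d Y Z x" for x
        unfolding d_def ennreal_plus[OF abs_ge_zero abs_ge_zero, symmetric]
        by (intro ennreal_leI) linarith
    qed
    also have "\<dots> \<le> ennreal_sqrt (\<integral>\<^sup>+x. (d X Y x)\<^sup>2 \<partial>(\<Omega> \<Otimes>\<^sub>M \<Omega>)) + ennreal_sqrt (\<integral>\<^sup>+x. (d Y Z x)\<^sup>2 \<partial>(\<Omega> \<Otimes>\<^sub>M \<Omega>))"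
      by (intro Minkowski_nn_integral) measurable
    also have "\<dots> = ennreal_sqrt (?c \<pi>1) + ennreal_sqrt (?c \<pi>2)"
      unfolding law[symmetric] by (subst (1 2) cost) measurable
    finally show ?thesis .
  qed
  then show ?thesis unfolding GW2_eq[of _ _ \<alpha> \<beta>] GW2_eq[of _ _ \<beta> \<rho>] by (rule le_ennreal_sqrt_INF_add)
qed

section \<open>Rotation invariance of the sphere\<close>

lemma lborel_translate_invariant:
  fixes c :: "'a::euclidean_space"
  assumes [measurable]: "f \<in> borel_measurable borel"
  shows "(\<integral>\<^sup>+x. f (x + c) \<partial>lborel) = (\<integral>\<^sup>+x. f x \<partial>lborel)"
proof -
  have "(\<integral>\<^sup>+x. f x \<partial>lborel) = (\<integral>\<^sup>+x. f x \<partial>distr lborel borel ((+) c))" by (simp add: lborel_distr_plus)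
  also have "\<dots> = (\<integral>\<^sup>+x. f (c + x) \<partial>lborel)" by (subst nn_integral_distr) auto
  finally show ?thesis by (simp add: add.commute)
qed

lemma emeasure_lborel_unit_ball_neq_0: "emeasure lborel (ball (0::'a::euclidean_space) 1) \<noteq> 0"
  using content_ball_pos[of 1 "0::'a"] by (auto simp: measure_def)

text \<open>Uniqueness of Haar measure in miniature: two translation invariant measures that agree on
  the unit ball are compared through \<open>\<integral>\<integral> 1\<^sub>A(x) 1\<^sub>B(y) d\<mu>(x) dy\<close>, with \<open>x\<close> shifted by \<open>y\<close>
  and then \<open>y\<close> shifted by \<open>-x\<close>. The library has the invariance of Lebesgue measure under
  orthogonal maps only for well-ordered index types.\<close>

lemma lborel_distr_orthogonal:
  fixes f :: "'a::euclidean_space \<Rightarrow> 'a"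
  assumes f: "orthogonal_transformation f"
  shows "distr lborel borel f = lborel"
proof -
  have lin: "linear f" using f by (rule orthogonal_transformation_linear)
  have surj: "surj f" using f by (rule orthogonal_transformation_surj)
  have [measurable]: "f \<in> borel_measurable borel"
    using lin by (intro borel_measurable_continuous_onI linear_continuous_on linear_conv_bounded_linear[THEN iffD1])
  define \<mu> where "\<mu> = distr lborel borel f"
  have sets_\<mu>[measurable_cong, simp]: "sets \<mu> = sets borel" by (simp add: \<mu>_def)
  define B where "B = (ball 0 1 :: 'a set)"
  have [measurable]: "B \<in> sets borel" by (simp add: B_def)
  have Bf: "f x \<in> B \<longleftrightarrow> x \<in> B" for x
    using f by (simp add: B_def orthogonal_transformation_norm)
  \<comment> \<open>A shift of the image is the image of a shift: surjectivity writes c as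
    \<open>f c'\<close>, and linearity does the rest.\<close>
  have shift: "(\<integral>\<^sup>+x. g (x + c) \<partial>\<mu>) = (\<integral>\<^sup>+x. g x \<partial>\<mu>)" if [measurable]: "g \<in> borel_measurable borel" for g c
  proof -
    obtain c' where c': "c = f c'" using surj by auto
    have "(\<integral>\<^sup>+x. g (x + c) \<partial>\<mu>) = (\<integral>\<^sup>+x. g (f x + f c') \<partial>lborel)"
      unfolding \<mu>_def c' by (subst nn_integral_distr) auto
    also have "\<dots> = (\<integral>\<^sup>+x. g (f (x + c')) \<partial>lborel)" by (simp add: linear_add[OF lin])
    also have "\<dots> = (\<integral>\<^sup>+x. g (f x) \<partial>lborel)" by (rule lborel_translate_invariant) measurable
    also have "\<dots> = (\<integral>\<^sup>+x. g x \<partial>\<mu>)" unfolding \<mu>_def by (subst nn_integral_distr) auto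
    finally show ?thesis .
  qed
  have \<mu>B: "emeasure \<mu> B = emeasure lborel B"
    unfolding \<mu>_def by (subst emeasure_distr) (auto simp: vimage_def Bf)
  have Bpos: "emeasure lborel B \<noteq> 0" "emeasure lborel B \<noteq> \<infinity>"
    unfolding B_def using emeasure_lborel_ball_finite[of "0::'a" 1]
    by (auto simp: emeasure_lborel_unit_ball_neq_0 less_top)
  \<comment> \<open>The map preserves centred balls, so they exhaust the space with finite measure;
    Fubini depends on this.\<close>
  interpret \<mu>: sigma_finite_measure \<mu>
  proof
    show "\<exists>A. countable A \<and> A \<subseteq> sets \<mu> \<and> \<Union>A = space \<mu> \<and> (\<forall>a\<in>A. emeasure \<mu> a \<noteq> \<infinity>)"
    proof (intro exI conjI ballI)
      show "countable (range (\<lambda>n::nat. ball (0::'a) n))" by simp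
      show "\<Union>(range (\<lambda>n::nat. ball (0::'a) n)) = space \<mu>"
        using reals_Archimedean2 by (auto simp: \<mu>_def)
      fix a assume "a \<in> range (\<lambda>n::nat. ball (0::'a) n)"
      then obtain n :: nat where a: "a = ball 0 n" by auto
      have "f -` ball 0 n = ball 0 n" using f by (auto simp: orthogonal_transformation_norm)
      then have "emeasure \<mu> a = emeasure lborel a" unfolding \<mu>_def a by (subst emeasure_distr) auto
      then show "emeasure \<mu> a \<noteq> \<infinity>" using emeasure_lborel_ball_finite[of "0::'a" n] a by (simp add: less_top)
    qed auto
  qed
  interpret P: pair_sigma_finite \<mu> lborel ..
  have "emeasure \<mu> A = emeasure lborel A" if [measurable]: "A \<in> sets borel" for A
  proof -
    have "emeasure \<mu> A * emeasure lborel B = (\<integral>\<^sup>+y. (\<integral>\<^sup>+x. indicator A x * indicator B y \<partial>\<mu>) \<partial>lborel)"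
      by (simp add: nn_integral_multc nn_integral_cmult)
    also have "\<dots> = (\<integral>\<^sup>+y. (\<integral>\<^sup>+x. indicator A (x + y) * indicator B y \<partial>\<mu>) \<partial>lborel)"
      by (intro nn_integral_cong shift[symmetric, where c = _ and g = "\<lambda>x. indicator A x * indicator B _"]) measurable
    also have "\<dots> = (\<integral>\<^sup>+x. (\<integral>\<^sup>+y. indicator A (x + y) * indicator B y \<partial>lborel) \<partial>\<mu>)"
      by (rule P.Fubini') measurable
    also have "\<dots> = (\<integral>\<^sup>+x. (\<integral>\<^sup>+y. indicator A y * indicator B (y - x) \<partial>lborel) \<partial>\<mu>)"
    proof (rule nn_integral_cong)
      fix x
      show "(\<integral>\<^sup>+y. indicator A (x + y) * indicator B y \<partial>lborel) = (\<integral>\<^sup>+y. indicator A y * indicator B (y - x) \<partial>lborel)"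
        using lborel_translate_invariant[of "\<lambda>y. indicator A y * indicator B (y - x)" x]
        by (simp add: add.commute)
    qed
    also have "\<dots> = (\<integral>\<^sup>+y. (\<integral>\<^sup>+x. indicator A y * indicator B (y - x) \<partial>\<mu>) \<partial>lborel)"
      by (rule P.Fubini'[symmetric]) measurable
    also have "\<dots> = (\<integral>\<^sup>+y. (\<integral>\<^sup>+x. indicator A y * indicator B x \<partial>\<mu>) \<partial>lborel)"
    proof (rule nn_integral_cong)
      fix y :: 'a
      have "indicator B (y - x) = (indicator B (x + - y) :: ennreal)" for x
        by (auto simp: B_def indicator_def norm_minus_commute)
      then show "(\<integral>\<^sup>+x. indicator A y * indicator B (y - x) \<partial>\<mu>) = (\<integral>\<^sup>+x. indicator A y * indicator B x \<partial>\<mu>)"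
        using shift[of "\<lambda>x. indicator A y * indicator B x" "- y"] by simp
    qed
    also have "\<dots> = emeasure lborel A * emeasure lborel B"
      by (simp add: nn_integral_multc nn_integral_cmult \<mu>B)
    finally show ?thesis using Bpos by (simp add: ennreal_mult_cancel_left mult.commute[of _ "emeasure lborel B"])
  qed
  then have "\<mu> = lborel" by (intro measure_eqI) (simp_all only: sets_\<mu> sets_lborel)
  then show ?thesis by (simp add: \<mu>_def)
qed

text \<open>An orthogonal map preserves the uniform measure on the ball and commutes with the radial
  projection.\<close>

lemma sphere_unif_orthogonal:
  fixes f :: "'a::euclidean_space \<Rightarrow> 'a"
  assumes f: "orthogonal_transformation f"
  shows "distr sphere_unif borel f = sphere_unif"
proof -
  have lin: "linear f" using f by (rule orthogonal_transformation_linear)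
  have [measurable]: "f \<in> borel_measurable borel"
    using lin by (intro borel_measurable_continuous_onI linear_continuous_on linear_conv_bounded_linear[THEN iffD1])
  let ?U = "uniform_measure lborel (ball (0::'a) 1)"
  have [measurable]: "ball (0::'a) 1 \<in> sets lborel" by simp
  have U: "distr ?U borel f = ?U"
  proof -
    have "?U = density (distr lborel borel f) (\<lambda>x. indicator (ball 0 1) x / emeasure lborel (ball (0::'a) 1))"
      by (simp add: uniform_measure_def lborel_distr_orthogonal[OF f])
    also have "\<dots> = distr (density lborel (\<lambda>x. indicator (ball 0 1) (f x) / emeasure lborel (ball (0::'a) 1))) borel f"
      by (rule density_distr) measurable
    also have "(\<lambda>x. indicator (ball 0 1) (f x) :: ennreal) = indicator (ball 0 1)"
      using f by (auto simp: indicator_def orthogonal_transformation_norm)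
    finally show ?thesis by (simp add: uniform_measure_def fun_eq_iff)
  qed
  have eq: "(\<lambda>x. f (x /\<^sub>R norm x)) = (\<lambda>x. f x /\<^sub>R norm (f x))"
    using f lin by (auto simp: linear_scale orthogonal_transformation_norm)
  have "distr sphere_unif borel f = distr ?U borel (\<lambda>x. f (x /\<^sub>R norm x))"
    unfolding sphere_unif_def by (subst distr_distr) (auto simp: comp_def)
  moreover have "distr ?U borel (\<lambda>x. f x /\<^sub>R norm (f x)) = distr (distr ?U borel f) borel (\<lambda>x. x /\<^sub>R norm x)"
    by (subst distr_distr) (auto simp: comp_def)
  ultimately show ?thesis unfolding U eq by (simp only: sphere_unif_def)
qed

lemma matrix_vector_measurable [measurable]: "(*v) (A :: real^'n^'m) \<in> borel_measurable borel"
  by (intro borel_measurable_continuous_onI linear_continuous_on matrix_vector_mul_bounded_linear)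

text \<open>Moves a matrix from the point to the direction; a common rotation of two measures
  thereby becomes a rotation of the sphere.\<close>

lemma proj_matrix:
  fixes A :: "real^'n^'m"
  shows "proj \<theta> (A *v x) = proj (transpose A *v \<theta>) x"
  using dot_lmul_matrix[of \<theta> A x] by (simp add: proj_def inner_commute[of _ \<theta>] inner_commute[of x])

section \<open>Sliced discrepancies\<close>

abbreviation proj_GW2 :: "'a::euclidean_space measure \<Rightarrow> 'a measure \<Rightarrow> 'a \<Rightarrow> ennreal" where
  "proj_GW2 \<mu> \<nu> \<theta> \<equiv> GW2 sqdist sqdist (distr \<mu> borel (proj \<theta>)) (distr \<nu> borel (proj \<theta>))"

lemma sets_sphere_unif [measurable_cong, simp]: "sets sphere_unif = sets borel"
  by (simp add: sphere_unif_def)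

lemma distr_borel_probs:
  assumes "\<mu> \<in> borel_probs" "f \<in> borel_measurable borel"
  shows "distr \<mu> borel f \<in> borel_probs"
  using borel_probs_distr[OF borel_probsD(2)[OF assms(1)] measurable_borel_probs[OF assms]] .

lemma distr_proj_borel_probs:
  "\<mu> \<in> borel_probs \<Longrightarrow> distr \<mu> borel (proj \<theta>) \<in> borel_probs"
  by (intro distr_borel_probs proj_measurable)

lemma lin_push_borel_probs: "\<mu> \<in> borel_probs \<Longrightarrow> lin_push A \<mu> \<in> borel_probs"
  unfolding lin_push_def by (intro distr_borel_probs matrix_vector_measurable)

lemma translate_borel_probs: "\<mu> \<in> borel_probs \<Longrightarrow> translate a \<mu> \<in> borel_probs"
  unfolding translate_def
  by (intro distr_borel_probs) auto

lemma lin_push_mat_1 [simp]: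
  fixes \<mu> :: "(real^'a) measure"
  shows "\<mu> \<in> borel_probs \<Longrightarrow> lin_push (mat 1) \<mu> = \<mu>"
proof -
  assume "\<mu> \<in> borel_probs"
  then have "distr \<mu> borel (\<lambda>x. x) = \<mu>" by (rule distr_id_borel_probs)
  moreover have "(*v) (mat 1) = (\<lambda>x :: real^'a. x)" by auto
  ultimately show ?thesis by (simp add: lin_push_def)
qed

lemma lin_push_lin_push:
  assumes "\<mu> \<in> borel_probs"
  shows "lin_push A (lin_push B \<mu>) = lin_push (A ** B) \<mu>"
  unfolding lin_push_def
  by (subst distr_distr)
    (auto simp: comp_def matrix_vector_mul_assoc intro!: matrix_vector_measurable measurable_borel_probs[OF assms])

lemma lin_push_translate:
  assumes "\<mu> \<in> borel_probs"
  shows "lin_push A (translate a \<mu>) = translate (A *v a) (lin_push A \<mu>)"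
proof -
  have [measurable]: "(*v) A \<in> borel_measurable \<mu>" "(\<lambda>x. x + a) \<in> borel_measurable \<mu>"
    by (intro measurable_borel_probs[OF assms]; measurable)+
  show ?thesis unfolding lin_push_def translate_def
    by (subst (1 2) distr_distr) (auto simp: comp_def matrix_vector_right_distrib matrix_vector_measurable)
qed

text \<open>In each direction a translation turns into a shift of the line, which
  \<open>sqdist\<close> does not notice.\<close>

lemma distr_proj_translate:
  assumes "\<mu> \<in> borel_probs"
  shows "distr (translate a \<mu>) borel (proj \<theta>) = distr (distr \<mu> borel (proj \<theta>)) borel (\<lambda>s. s + a \<bullet> \<theta>)"
proof -
  have [measurable]: "proj \<theta> \<in> borel_measurable \<mu>" "(\<lambda>x. x + a) \<in> borel_measurable \<mu>"
    by (intro measurable_borel_probs[OF assms]; measurable)+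
  show ?thesis unfolding translate_def
    by (subst (1 2) distr_distr) (auto simp: comp_def proj_def inner_add_left)
qed

lemma distr_proj_lin_push:
  assumes "\<mu> \<in> borel_probs"
  shows "distr (lin_push A \<mu>) borel (proj \<theta>) = distr \<mu> borel (proj (transpose A *v \<theta>))"
proof -
  have [measurable]: "(*v) A \<in> borel_measurable \<mu>"
    by (intro measurable_borel_probs[OF assms] matrix_vector_measurable)
  show ?thesis unfolding lin_push_def
    by (subst distr_distr) (auto simp: comp_def proj_matrix fun_eq_iff intro!: distr_cong)
qed

text \<open>One inequality for all shifts suffices: applied to the shifted measure with the shift -c
  it yields the other one.\<close>

lemma GW2_translate:
  assumes \<alpha>: "\<alpha> \<in> borel_probs" and \<beta>: "\<beta> \<in> borel_probs"
  shows "GW2 sqdist sqdist (distr \<alpha> borel (\<lambda>s. s + c)) \<beta> = GW2 sqdist sqdist \<alpha> \<beta>"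
proof (rule antisym)
  note id = distr_id_borel_probs[OF \<beta>]
  have le: "GW2 sqdist sqdist (distr \<alpha> borel (\<lambda>s. s + c)) \<beta> \<le> GW2 sqdist sqdist \<alpha> \<beta>"
    if "\<alpha> \<in> borel_probs" for \<alpha> c
    by (rule GW2_distr_le[OF that \<beta> _ _ sqdist_measurable sqdist_measurable, of _ "\<lambda>s. s", unfolded id])
      (simp_all add: sqdist_def)
  show "GW2 sqdist sqdist (distr \<alpha> borel (\<lambda>s. s + c)) \<beta> \<le> GW2 sqdist sqdist \<alpha> \<beta>" by (rule le) fact
  have \<alpha>c: "distr \<alpha> borel (\<lambda>s. s + c) \<in> borel_probs"
    by (intro distr_borel_probs \<alpha>) measurable
  have [measurable]: "(\<lambda>s. s + c) \<in> borel_measurable \<alpha>"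
    by (intro measurable_borel_probs[OF \<alpha>]) measurable
  have "distr (distr \<alpha> borel (\<lambda>s. s + c)) borel (\<lambda>s. s + - c) = distr \<alpha> borel (\<lambda>s. s)"
    by (subst distr_distr) (auto simp: comp_def)
  also have "\<dots> = \<alpha>" using \<alpha> by (rule distr_id_borel_probs)
  finally show "GW2 sqdist sqdist \<alpha> \<beta> \<le> GW2 sqdist sqdist (distr \<alpha> borel (\<lambda>s. s + c)) \<beta>"
    using le[OF \<alpha>c, of "- c"] by simp
qed

lemma proj_GW2_commute:
  "\<mu> \<in> borel_probs \<Longrightarrow> \<nu> \<in> borel_probs \<Longrightarrow> proj_GW2 \<mu> \<nu> \<theta> = proj_GW2 \<nu> \<mu> \<theta>"
  by (intro GW2_commute distr_proj_borel_probs sqdist_measurable)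

lemma proj_GW2_translate:
  assumes "\<mu> \<in> borel_probs" "\<nu> \<in> borel_probs"
  shows "proj_GW2 (translate a \<mu>) \<nu> \<theta> = proj_GW2 \<mu> \<nu> \<theta>" "proj_GW2 \<mu> (translate a \<nu>) \<theta> = proj_GW2 \<mu> \<nu> \<theta>"
proof -
  have *: "proj_GW2 (translate a \<mu>) \<nu> \<theta> = proj_GW2 \<mu> \<nu> \<theta>"
    if "\<mu> \<in> borel_probs" "\<nu> \<in> borel_probs" for \<mu> \<nu>
    using that by (simp add: distr_proj_translate GW2_translate distr_proj_borel_probs)
  show "proj_GW2 (translate a \<mu>) \<nu> \<theta> = proj_GW2 \<mu> \<nu> \<theta>" by (intro * assms)
  show "proj_GW2 \<mu> (translate a \<nu>) \<theta> = proj_GW2 \<mu> \<nu> \<theta>"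
    using assms *[of \<nu> \<mu>] by (simp add: proj_GW2_commute translate_borel_probs)
qed

lemma SGW_lin_translate:
  assumes "\<mu> \<in> borel_probs" "\<nu> \<in> borel_probs"
  shows "SGW_lin \<Delta> (translate a \<mu>) \<nu> = SGW_lin \<Delta> \<mu> \<nu>" "SGW_lin \<Delta> \<mu> (translate b \<nu>) = SGW_lin \<Delta> \<mu> \<nu>"
  unfolding SGW_lin_def lin_push_translate[OF assms(1)]
    proj_GW2_translate[OF lin_push_borel_probs[OF assms(1)] assms(2)] by (rule refl)+

text \<open>With \<Delta> absorbed into the first measure, \<open>RISGW\<close> for p = q is
  governed by the properties of \<open>SGW\<close>.\<close>

lemma SGW_lin_eq_SGW:
  assumes "\<mu> \<in> borel_probs" "\<nu> \<in> borel_probs"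
  shows "SGW_lin \<Delta> \<mu> \<nu> = SGW (lin_push \<Delta> \<mu>) \<nu>"
  using assms by (simp add: SGW_def SGW_lin_def lin_push_borel_probs)

lemma SGW_eq:
  "\<mu> \<in> borel_probs \<Longrightarrow> \<nu> \<in> borel_probs \<Longrightarrow> SGW \<mu> \<nu> = (\<integral>\<^sup>+\<theta>. (proj_GW2 \<mu> \<nu> \<theta>)\<^sup>2 \<partial>sphere_unif)"
  by (simp add: SGW_def SGW_lin_def)

lemma proj_GW2_measurable:
  "\<mu> \<in> borel_probs \<Longrightarrow> \<nu> \<in> borel_probs \<Longrightarrow> proj_GW2 \<mu> \<nu> \<in> borel_measurable sphere_unif"
  using GW2_proj_measurable by (simp add: measurable_cong_sets[OF sets_sphere_unif refl])

lemma SGW_commute: "\<mu> \<in> borel_probs \<Longrightarrow> \<nu> \<in> borel_probs \<Longrightarrow> SGW \<mu> \<nu> = SGW \<nu> \<mu>"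
  by (simp add: SGW_eq proj_GW2_commute)

lemma SGW_self:
  fixes \<mu> :: "(real^'n) measure"
  assumes "\<mu> \<in> borel_probs"
  shows "SGW \<mu> \<mu> = 0"
proof -
  have "proj_GW2 \<mu> \<mu> \<theta> = 0" for \<theta>
  proof -
    let ?m = "distr \<mu> borel (proj \<theta>)"
    have m: "?m \<in> borel_probs" by (rule distr_proj_borel_probs[OF assms])
    have "GW2 sqdist sqdist ?m (distr ?m borel (\<lambda>s. s)) = 0"
      by (rule GW2_eq_0_map[OF m _ sqdist_measurable sqdist_measurable]) auto
    then show ?thesis by (simp only: distr_id_borel_probs[OF m])
  qed
  then show ?thesis by (simp add: SGW_eq assms)
qed

text \<open>The root of \<open>SGW\<close> is the L2 norm over the sphere of the one-dimensional
  discrepancy, so the triangle inequality in each direction combines with Minkowski's inequality;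
  measurability in the direction is used here.\<close>

lemma SGW_triangle:
  assumes "\<mu> \<in> borel_probs" "\<nu> \<in> borel_probs" "\<rho> \<in> borel_probs"
  shows "ennreal_sqrt (SGW \<mu> \<rho>) \<le> ennreal_sqrt (SGW \<mu> \<nu>) + ennreal_sqrt (SGW \<nu> \<rho>)"
proof -
  have "SGW \<mu> \<rho> \<le> (\<integral>\<^sup>+\<theta>. (proj_GW2 \<mu> \<nu> \<theta> + proj_GW2 \<nu> \<rho> \<theta>)\<^sup>2 \<partial>sphere_unif)"
    unfolding SGW_eq[OF assms(1,3)]
    by (intro nn_integral_mono power_mono GW2_triangle distr_proj_borel_probs assms zero_le)
  then have "ennreal_sqrt (SGW \<mu> \<rho>) \<le>
      ennreal_sqrt (\<integral>\<^sup>+\<theta>. (proj_GW2 \<mu> \<nu> \<theta> + proj_GW2 \<nu> \<rho> \<theta>)\<^sup>2 \<partial>sphere_unif)"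
    by (rule ennreal_sqrt_mono)
  also have "\<dots> \<le> ennreal_sqrt (SGW \<mu> \<nu>) + ennreal_sqrt (SGW \<nu> \<rho>)"
    unfolding SGW_eq[OF assms(1,2)] SGW_eq[OF assms(2,3)]
    by (intro Minkowski_nn_integral proj_GW2_measurable assms)
  finally show ?thesis .
qed

text \<open>Rotating both measures by Q replaces each direction by its image under the transpose,
  which preserves the uniform measure on the sphere.\<close>

lemma SGW_orthogonal:
  fixes Q :: "real^'n^'n"
  assumes \<mu>: "\<mu> \<in> borel_probs" and \<nu>: "\<nu> \<in> borel_probs" and Q: "orthogonal_matrix Q"
  shows "SGW (lin_push Q \<mu>) (lin_push Q \<nu>) = SGW \<mu> \<nu>"
proof -
  have orth: "orthogonal_transformation ((*v) (transpose Q))"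
    using Q by (simp add: orthogonal_transformation_matrix orthogonal_matrix_transpose
        del: transpose_matrix_vector)
  have [measurable]: "(*v) (transpose Q) \<in> borel_measurable sphere_unif"
    using matrix_vector_measurable[of "transpose Q"] by (simp add: measurable_cong_sets[OF sets_sphere_unif refl])
  have "SGW (lin_push Q \<mu>) (lin_push Q \<nu>) = (\<integral>\<^sup>+\<theta>. (proj_GW2 \<mu> \<nu> (transpose Q *v \<theta>))\<^sup>2 \<partial>sphere_unif)"
    using \<mu> \<nu> by (simp only: SGW_eq lin_push_borel_probs distr_proj_lin_push)
  also have "\<dots> = (\<integral>\<^sup>+\<theta>. (proj_GW2 \<mu> \<nu> \<theta>)\<^sup>2 \<partial>distr sphere_unif borel ((*v) (transpose Q)))"
    using GW2_proj_measurable[OF \<mu> \<nu>] by (intro nn_integral_distr[symmetric]) measurable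
  also have "\<dots> = SGW \<mu> \<nu>" by (simp only: sphere_unif_orthogonal[OF orth] SGW_eq[OF \<mu> \<nu>])
  finally show ?thesis .
qed

section \<open>The infimum over rotations\<close>

lemma stiefel_square: "(stiefel :: (real^'n^'n) set) = {Q. orthogonal_matrix Q}"
  by (auto simp: stiefel_def orthogonal_matrix)

lemma RISGW_eq:
  fixes \<mu> \<nu> :: "(real^'n) measure"
  assumes "\<mu> \<in> borel_probs" "\<nu> \<in> borel_probs"
  shows "RISGW \<mu> \<nu> = (INF Q\<in>{Q. orthogonal_matrix Q}. SGW (lin_push Q \<mu>) \<nu>)"
  unfolding RISGW_def stiefel_square using assms by (simp add: SGW_lin_eq_SGW)

lemma RISGW_le:
  fixes \<mu> \<nu> :: "(real^'n) measure"
  assumes "\<mu> \<in> borel_probs" "\<nu> \<in> borel_probs" "orthogonal_matrix Q"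
  shows "RISGW \<mu> \<nu> \<le> SGW (lin_push Q \<mu>) \<nu>"
  unfolding RISGW_eq[OF assms(1,2)] using assms(3) by (intro INF_lower) simp

text \<open>A common rotation of both arguments carries Q over from one measure to the transpose on
  the other, which is a competitor for the exchanged pair.\<close>

lemma RISGW_commute:
  fixes \<mu> \<nu> :: "(real^'n) measure"
  assumes "\<mu> \<in> borel_probs" "\<nu> \<in> borel_probs"
  shows "RISGW \<mu> \<nu> = RISGW \<nu> \<mu>"
proof -
  have "RISGW \<nu> \<mu> \<le> RISGW \<mu> \<nu>" if \<mu>: "\<mu> \<in> borel_probs" and \<nu>: "\<nu> \<in> borel_probs"
    for \<mu> \<nu> :: "(real^'n) measure"
    unfolding RISGW_eq[OF that]
  proof (rule INF_greatest)
    fix Q :: "real^'n^'n" assume "Q \<in> {Q. orthogonal_matrix Q}"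
    then have Q: "orthogonal_matrix Q" and QT: "orthogonal_matrix (transpose Q)"
      by (auto simp: orthogonal_matrix_transpose)
    have "RISGW \<nu> \<mu> \<le> SGW (lin_push (transpose Q) \<nu>) \<mu>" by (intro RISGW_le \<mu> \<nu> QT)
    also have "\<dots> = SGW \<mu> (lin_push (transpose Q) \<nu>)" by (intro SGW_commute lin_push_borel_probs \<mu> \<nu>)
    also have "\<dots> = SGW (lin_push Q \<mu>) (lin_push Q (lin_push (transpose Q) \<nu>))"
      by (intro SGW_orthogonal[symmetric] lin_push_borel_probs \<mu> \<nu> Q)
    also have "\<dots> = SGW (lin_push Q \<mu>) \<nu>"
      using Q \<nu> by (simp add: lin_push_lin_push orthogonal_matrix_def)
    finally show "RISGW \<nu> \<mu> \<le> SGW (lin_push Q \<mu>) \<nu>" .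
  qed
  with assms show ?thesis by (intro antisym) auto
qed

text \<open>Right multiplication by Q permutes the competitors. The converse inequality is the same
  one for the rotated measure and the inverse rotation.\<close>

lemma RISGW_rotate:
  fixes \<mu> \<nu> :: "(real^'n) measure"
  assumes \<mu>: "\<mu> \<in> borel_probs" and \<nu>: "\<nu> \<in> borel_probs" and Q: "orthogonal_matrix Q"
  shows "RISGW (lin_push Q \<mu>) \<nu> = RISGW \<mu> \<nu>"
proof (rule antisym)
  have le: "RISGW \<mu> \<nu> \<le> RISGW (lin_push Q \<mu>) \<nu>"
    if \<mu>: "\<mu> \<in> borel_probs" and Q: "orthogonal_matrix Q" for \<mu> :: "(real^'n) measure" and Q
    unfolding RISGW_eq[OF lin_push_borel_probs[OF \<mu>] \<nu>]
  proof (rule INF_greatest)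
    fix R :: "real^'n^'n" assume "R \<in> {Q. orthogonal_matrix Q}"
    then show "RISGW \<mu> \<nu> \<le> SGW (lin_push R (lin_push Q \<mu>)) \<nu>"
      using RISGW_le[OF \<mu> \<nu>, of "R ** Q"] \<mu> Q by (simp add: lin_push_lin_push orthogonal_matrix_mul)
  qed
  show "RISGW \<mu> \<nu> \<le> RISGW (lin_push Q \<mu>) \<nu>" by (intro le \<mu> Q)
  show "RISGW (lin_push Q \<mu>) \<nu> \<le> RISGW \<mu> \<nu>"
    using le[OF lin_push_borel_probs[OF \<mu>, of Q], of "transpose Q"] \<mu> Q
    by (simp add: lin_push_lin_push orthogonal_matrix_transpose) (simp add: orthogonal_matrix_def)
qed

lemma RISGW_translate:
  assumes "\<mu> \<in> borel_probs" "\<nu> \<in> borel_probs"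
  shows "RISGW (translate a \<mu>) \<nu> = RISGW \<mu> \<nu>" "RISGW \<mu> (translate b \<nu>) = RISGW \<mu> \<nu>"
  unfolding RISGW_def SGW_lin_translate[OF assms] by (rule refl)+

lemma RISGW_rotate_right:
  fixes \<mu> \<nu> :: "(real^'n) measure"
  assumes \<mu>: "\<mu> \<in> borel_probs" and \<nu>: "\<nu> \<in> borel_probs" and Q: "orthogonal_matrix Q"
  shows "RISGW \<mu> (lin_push Q \<nu>) = RISGW \<mu> \<nu>"
  using RISGW_commute[OF \<mu> lin_push_borel_probs[OF \<nu>], of Q] RISGW_rotate[OF \<nu> \<mu> Q] RISGW_commute[OF \<nu> \<mu>]
  by simp

lemma RISGW_self:
  fixes \<mu> :: "(real^'n) measure"
  assumes "\<mu> \<in> borel_probs"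
  shows "RISGW \<mu> \<mu> = 0"
  using RISGW_le[OF assms assms, of "mat 1"] assms
  by (simp add: SGW_self orthogonal_matrix_id)

text \<open>Competitors P for (\<mu>, \<nu>) and Q for (\<nu>, \<rho>) compose to Q ** P for (\<mu>,
  \<rho>). The intermediate measure is the image of \<nu> under Q, and the common rotation then
  cancels by \<open>SGW_orthogonal\<close>.\<close>

lemma RISGW_triangle:
  fixes \<mu> \<nu> \<rho> :: "(real^'n) measure"
  assumes \<mu>: "\<mu> \<in> borel_probs" and \<nu>: "\<nu> \<in> borel_probs" and \<rho>: "\<rho> \<in> borel_probs"
  shows "ennreal_sqrt (RISGW \<mu> \<rho>) \<le> ennreal_sqrt (RISGW \<mu> \<nu>) + ennreal_sqrt (RISGW \<nu> \<rho>)"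
  unfolding RISGW_eq[OF \<mu> \<nu>] RISGW_eq[OF \<nu> \<rho>]
proof (rule le_ennreal_sqrt_INF_add)
  fix P Q :: "real^'n^'n" assume "P \<in> {Q. orthogonal_matrix Q}" "Q \<in> {Q. orthogonal_matrix Q}"
  then have P: "orthogonal_matrix P" and Q: "orthogonal_matrix Q" by auto
  have "RISGW \<mu> \<rho> \<le> SGW (lin_push (Q ** P) \<mu>) \<rho>" by (intro RISGW_le \<mu> \<rho> orthogonal_matrix_mul P Q)
  then have "ennreal_sqrt (RISGW \<mu> \<rho>) \<le> ennreal_sqrt (SGW (lin_push Q (lin_push P \<mu>)) \<rho>)"
    using \<mu> by (intro ennreal_sqrt_mono) (simp add: lin_push_lin_push)
  also have "\<dots> \<le> ennreal_sqrt (SGW (lin_push Q (lin_push P \<mu>)) (lin_push Q \<nu>)) + ennreal_sqrt (SGW (lin_push Q \<nu>) \<rho>)"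
    by (intro SGW_triangle lin_push_borel_probs \<mu> \<nu> \<rho>)
  also have "SGW (lin_push Q (lin_push P \<mu>)) (lin_push Q \<nu>) = SGW (lin_push P \<mu>) \<nu>"
    by (intro SGW_orthogonal lin_push_borel_probs \<mu> \<nu> Q)
  finally show "ennreal_sqrt (RISGW \<mu> \<rho>) \<le> ennreal_sqrt (SGW (lin_push P \<mu>) \<nu>) + ennreal_sqrt (SGW (lin_push Q \<nu>) \<rho>)" .
qed

section \<open>Vanishing discrepancy\<close>

text \<open>An isometry of the line is fixed by two points: 0 goes to 0 and a to \<sigma> * a.
  Squaring both distance conditions leaves an equation between the mixed terms.\<close>

lemma isometric_pairs:
  fixes s t :: real
  assumes "\<sigma>\<^sup>2 = 1" "a \<noteq> 0" "\<bar>s\<bar> = \<bar>t\<bar>" "\<bar>s - a\<bar> = \<bar>t - \<sigma> * a\<bar>"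
  shows "t = \<sigma> * s"
proof -
  have 1: "s\<^sup>2 = t\<^sup>2" "(s - a)\<^sup>2 = (t - \<sigma> * a)\<^sup>2"
    using assms(3,4) by (metis power2_abs)+
  have "(t - \<sigma> * a)\<^sup>2 = t\<^sup>2 - 2 * t * \<sigma> * a + \<sigma>\<^sup>2 * a\<^sup>2"
    by (simp add: power2_eq_square algebra_simps)
  moreover have "(s - a)\<^sup>2 = s\<^sup>2 - 2 * s * a + a\<^sup>2"
    by (simp add: power2_eq_square algebra_simps)
  ultimately have "s = t * \<sigma>" using 1 assms(1,2) by auto
  then have "\<sigma> * s = \<sigma>\<^sup>2 * t" by (simp add: power2_eq_square)
  then show ?thesis using assms(1) by simp
qed

text \<open>Fix a point p0 at matching distances from almost every point of \<pi>. A second such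
  point p1 with another abscissa determines the sign as the slope between them. If there is none,
  \<pi> is a point mass and either sign works.\<close>

lemma gw_cost_eq_0_isometry:
  assumes \<pi>: "\<pi> \<in> borel_probs" and 0: "gw_cost sqdist sqdist \<pi> = 0"
  shows "\<exists>\<sigma> c. \<sigma>\<^sup>2 = 1 \<and> (AE p in \<pi>. snd p = \<sigma> * fst p + c)"
proof -
  interpret prob_space \<pi> using borel_probsD[OF \<pi>] by simp
  note [measurable_cong] = borel_probsD(1)[OF \<pi>]
  define k where "k = (\<lambda>p p' :: real \<times> real.
    ennreal (\<bar>sqdist (fst p) (fst p') - sqdist (snd p) (snd p')\<bar>\<^sup>2))"
  have k: "case_prod k \<in> borel_measurable (borel \<Otimes>\<^sub>M borel)"
    unfolding k_def by (rule gw_kernel_measurable[OF sqdist_measurable sqdist_measurable])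
  have k0: "k p p' = 0 \<longleftrightarrow> \<bar>fst p - fst p'\<bar> = \<bar>snd p - snd p'\<bar>" for p p'
    by (auto simp: k_def sqdist_def power2_eq_iff abs_eq_iff)
  have sec: "(\<lambda>p. k p p') \<in> borel_measurable \<pi>" for p'
    using measurable_compose[OF measurable_Pair1'[of p' borel borel] k] measurable_compose[OF _ k, of "\<lambda>p. (p, p')" \<pi>]
    by simp
  have meas: "(\<lambda>p'. \<integral>\<^sup>+p. k p p' \<partial>\<pi>) \<in> borel_measurable \<pi>"
  proof (rule borel_measurable_nn_integral)
    show "(\<lambda>(p', p). k p p') \<in> borel_measurable (\<pi> \<Otimes>\<^sub>M \<pi>)"
      using measurable_compose[OF _ k, of "\<lambda>x. (snd x, fst x)" "\<pi> \<Otimes>\<^sub>M \<pi>"] by (simp add: case_prod_beta)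
  qed
  have "(\<integral>\<^sup>+p'. (\<integral>\<^sup>+p. k p p' \<partial>\<pi>) \<partial>\<pi>) = 0" using 0 by (simp add: gw_cost_def k_def)
  then have "AE p' in \<pi>. (\<integral>\<^sup>+p. k p p' \<partial>\<pi>) = 0"
    using nn_integral_0_iff_AE[OF meas] by simp
  then have *: "AE p' in \<pi>. AE p in \<pi>. \<bar>fst p - fst p'\<bar> = \<bar>snd p - snd p'\<bar>"
    using nn_integral_0_iff_AE[OF sec] by (simp add: k0)
  then obtain p0 where p0: "AE p in \<pi>. \<bar>fst p - fst p0\<bar> = \<bar>snd p - snd p0\<bar>"
    using eventually_happens'[OF ae_filter_bot] by blast
  show ?thesis
  proof (cases "\<exists>p1. (AE p in \<pi>. \<bar>fst p - fst p1\<bar> = \<bar>snd p - snd p1\<bar>) \<and>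
      \<bar>fst p1 - fst p0\<bar> = \<bar>snd p1 - snd p0\<bar> \<and> fst p1 \<noteq> fst p0")
    case True
    then obtain p1 where p1: "AE p in \<pi>. \<bar>fst p - fst p1\<bar> = \<bar>snd p - snd p1\<bar>"
      "\<bar>fst p1 - fst p0\<bar> = \<bar>snd p1 - snd p0\<bar>" "fst p1 \<noteq> fst p0" by blast
    define a where "a = fst p1 - fst p0"
    define \<sigma> where "\<sigma> = (snd p1 - snd p0) / a"
    have a: "a \<noteq> 0" using p1(3) by (simp add: a_def)
    have "\<bar>\<sigma>\<bar> = 1" using p1(2) a by (simp add: \<sigma>_def a_def abs_divide)
    then have \<sigma>: "\<sigma>\<^sup>2 = 1" by (metis power2_abs one_power2)
    have "AE p in \<pi>. snd p = \<sigma> * fst p + (snd p0 - \<sigma> * fst p0)"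
      using p0 p1(1)
    proof eventually_elim
      case (elim p)
      have "\<bar>(fst p - fst p0) - a\<bar> = \<bar>(snd p - snd p0) - \<sigma> * a\<bar>"
        using elim(2) a by (simp add: \<sigma>_def a_def)
      from isometric_pairs[OF \<sigma> a elim(1) this] show ?case by (simp add: algebra_simps)
    qed
    with \<sigma> show ?thesis by blast
  next
    case False
    have "AE p in \<pi>. snd p = 1 * fst p + (snd p0 - fst p0)"
      using p0 *
    proof eventually_elim
      case (elim p)
      with False have "fst p = fst p0" by blast
      with elim(1) show ?case by simp
    qed
    moreover have "(1::real)\<^sup>2 = 1" by simp
    ultimately show ?thesis by blast
  qed
qed

text \<open>The infimum is attained, by \<open>projected_coupling_limit\<close> for a constant
  sequence, and a coupling of cost 0 is carried by the graph of an isometry.\<close>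

lemma proj_GW2_eq_0_imp:
  fixes \<mu> \<nu> :: "'a::euclidean_space measure"
  assumes \<mu>: "\<mu> \<in> borel_probs" and \<nu>: "\<nu> \<in> borel_probs" and 0: "proj_GW2 \<mu> \<nu> \<theta> = 0"
  shows "\<exists>\<sigma> c. \<sigma>\<^sup>2 = 1 \<and> distr \<nu> borel (proj \<theta>) = distr \<mu> borel (\<lambda>x. \<sigma> * proj \<theta> x + c)"
proof -
  obtain \<pi> where \<pi>: "\<pi> \<in> couplings (distr \<mu> borel (proj \<theta>)) (distr \<nu> borel (proj \<theta>))"
    "gw_cost sqdist sqdist \<pi> \<le> 0"
    using projected_coupling_limit[OF \<mu> \<nu> tendsto_const, of 0 \<theta>] 0 by auto
  note P = couplings_borel_probs[OF distr_proj_borel_probs[OF \<mu>] distr_proj_borel_probs[OF \<nu>] \<pi>(1)]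
  obtain \<sigma> c where \<sigma>: "\<sigma>\<^sup>2 = 1" and AE: "AE p in \<pi>. snd p = \<sigma> * fst p + c"
    using gw_cost_eq_0_isometry[OF P(1)] \<pi>(2) by auto
  have m: "snd \<in> borel_measurable \<pi>" "fst \<in> borel_measurable \<pi>" "(\<lambda>p. \<sigma> * fst p + c) \<in> borel_measurable \<pi>"
    by (intro measurable_borel_probs[OF P(1)]; measurable)+
  have m2: "proj \<theta> \<in> borel_measurable \<mu>" by (intro measurable_borel_probs[OF \<mu>] proj_measurable)
  have "distr \<nu> borel (proj \<theta>) = distr \<pi> borel (\<lambda>p. \<sigma> * fst p + c)"
    unfolding P(3)[symmetric] using AE m by (intro distr_cong_AE) auto
  also have "\<dots> = distr (distr \<pi> borel fst) borel (\<lambda>s. \<sigma> * s + c)"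
    using m by (subst distr_distr) (auto simp: comp_def)
  also have "\<dots> = distr \<mu> borel (\<lambda>x. \<sigma> * proj \<theta> x + c)"
    unfolding P(2) using m2 by (subst distr_distr) (auto simp: comp_def)
  finally show ?thesis using \<sigma> by blast
qed

section \<open>Directional moments of measures carried by a ball\<close>

lemma integrable_continuous_bounded:
  fixes f :: "'a::euclidean_space \<Rightarrow> 'b::{banach, second_countable_topology}"
  assumes \<mu>: "\<mu> \<in> borel_probs" and bnd: "AE x in \<mu>. norm x \<le> R" and f: "continuous_on UNIV f"
  shows "integrable \<mu> f"
proof -
  interpret prob_space \<mu> using borel_probsD[OF \<mu>] by simp
  have "compact (f ` cball 0 R)"
    by (intro compact_continuous_image continuous_on_subset[OF f]) auto
  then obtain B where "\<forall>y\<in>f ` cball 0 R. norm y \<le> B"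
    using compact_imp_bounded[of "f ` cball 0 R"] unfolding bounded_iff by blast
  then have B: "norm (f x) \<le> B" if "norm x \<le> R" for x using that by simp
  have "AE x in \<mu>. norm (f x) \<le> B" using bnd by eventually_elim (rule B)
  moreover have "f \<in> borel_measurable \<mu>"
    by (intro measurable_borel_probs[OF \<mu>] borel_measurable_continuous_onI f)
  ultimately show ?thesis by (rule integrable_const_bound)
qed

text \<open>The direction ranges over the whole space: for measures carried by a ball this is a
  homogeneous polynomial of degree k in \<theta>, to be scaled and restricted to lines.\<close>

definition proj_moment :: "'a::euclidean_space measure \<Rightarrow> nat \<Rightarrow> 'a \<Rightarrow> real" where
  "proj_moment \<mu> k \<theta> = (\<integral>x. (x \<bullet> \<theta>) ^ k \<partial>\<mu>)"

lemma integrable_proj_moment: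
  fixes \<mu> :: "'a::euclidean_space measure"
  assumes "\<mu> \<in> borel_probs" "AE x in \<mu>. norm x \<le> R"
  shows "integrable \<mu> (\<lambda>x. (x \<bullet> \<theta>) ^ k)"
  by (intro integrable_continuous_bounded[OF assms] continuous_intros)

lemma proj_moment_scale: "proj_moment \<mu> k (c *\<^sub>R \<theta>) = c ^ k * proj_moment \<mu> k \<theta>"
  by (simp add: proj_moment_def power_mult_distrib)

text \<open>Binomial expansion in s. Polynomials in one variable are enough, because the comparison
  of signs joins just two directions by a line.\<close>

lemma proj_moment_line:
  fixes \<mu> :: "'a::euclidean_space measure"
  assumes \<mu>: "\<mu> \<in> borel_probs" "AE x in \<mu>. norm x \<le> R"
  shows "\<exists>P. \<forall>s. proj_moment \<mu> k (u + s *\<^sub>R v) = poly P s"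
proof -
  define c where "c j = of_nat (k choose j) * (\<integral>x. (x \<bullet> v) ^ j * (x \<bullet> u) ^ (k - j) \<partial>\<mu>)" for j
  have "proj_moment \<mu> k (u + s *\<^sub>R v) = poly (\<Sum>j\<le>k. monom (c j) j) s" for s
  proof -
    have "proj_moment \<mu> k (u + s *\<^sub>R v) =
        (\<integral>x. (\<Sum>j\<le>k. of_nat (k choose j) * s ^ j * ((x \<bullet> v) ^ j * (x \<bullet> u) ^ (k - j))) \<partial>\<mu>)"
      unfolding proj_moment_def inner_add_right inner_scaleR_right add.commute[of "_ \<bullet> u"] binomial_ring
      by (simp add: power_mult_distrib mult_ac)
    also have "\<dots> = (\<Sum>j\<le>k. \<integral>x. of_nat (k choose j) * s ^ j * ((x \<bullet> v) ^ j * (x \<bullet> u) ^ (k - j)) \<partial>\<mu>)"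
      by (intro Bochner_Integration.integral_sum integrable_continuous_bounded[OF \<mu>] continuous_intros)
    also have "\<dots> = (\<Sum>j\<le>k. c j * s ^ j)"
      by (simp add: c_def mult_ac)
    finally show ?thesis by (simp add: poly_sum poly_monom)
  qed
  then show ?thesis by blast
qed

lemma proj_moment_continuous:
  fixes \<mu> :: "'a::euclidean_space measure"
  assumes \<mu>: "\<mu> \<in> borel_probs" "AE x in \<mu>. norm x \<le> R"
  shows "continuous_on UNIV (proj_moment \<mu> k)"
proof -
  interpret prob_space \<mu> using borel_probsD[OF \<mu>(1)] by simp
  have "(\<lambda>n. proj_moment \<mu> k (\<theta> n)) \<longlonglongrightarrow> proj_moment \<mu> k \<theta>'" if \<theta>: "\<theta> \<longlonglongrightarrow> \<theta>'" for \<theta> \<theta>'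
  proof -
    obtain K where K: "\<And>n. norm (\<theta> n) \<le> K" "K > 0"
      using convergent_imp_bounded[OF \<theta>] by (auto simp: bounded_pos)
    show ?thesis unfolding proj_moment_def
    proof (rule integral_dominated_convergence[where w = "\<lambda>_. (\<bar>R\<bar> * K) ^ k"])
      show "AE x in \<mu>. (\<lambda>n. (x \<bullet> \<theta> n) ^ k) \<longlonglongrightarrow> (x \<bullet> \<theta>') ^ k"
        using \<theta> by (intro AE_I2 tendsto_intros)
      show "AE x in \<mu>. norm ((x \<bullet> \<theta> n) ^ k) \<le> (\<bar>R\<bar> * K) ^ k" for n
        using \<mu>(2)
      proof eventually_elim
        case (elim x)
        have "\<bar>x \<bullet> \<theta> n\<bar> \<le> norm x * norm (\<theta> n)" by (rule Cauchy_Schwarz_ineq2)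
        also have "\<dots> \<le> \<bar>R\<bar> * K" using elim K by (intro mult_mono) auto
        finally show ?case by (simp add: power_abs power_mono)
      qed
      show "(\<lambda>x. (x \<bullet> \<theta> n) ^ k) \<in> borel_measurable \<mu>" "(\<lambda>x. (x \<bullet> \<theta>') ^ k) \<in> borel_measurable \<mu>" for n
        using integrable_proj_moment[OF \<mu>] by (auto dest: borel_measurable_integrable)
    qed simp
  qed
  then show ?thesis by (auto simp: continuous_on_sequentially comp_def)
qed

text \<open>Termwise integration of the exponential series, with the constant majorant exp(|R| *
  norm \<theta>). Thus the moments determine the Laplace transform.\<close>

lemma proj_moment_exp_sums:
  fixes \<mu> :: "'a::euclidean_space measure"
  assumes \<mu>: "\<mu> \<in> borel_probs" "AE x in \<mu>. norm x \<le> R"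
  shows "(\<lambda>n. \<Sum>k<n. proj_moment \<mu> k \<theta> /\<^sub>R fact k) \<longlonglongrightarrow> (\<integral>x. exp (x \<bullet> \<theta>) \<partial>\<mu>)"
proof -
  interpret prob_space \<mu> using borel_probsD[OF \<mu>(1)] by simp
  have int: "integrable \<mu> (\<lambda>x. (x \<bullet> \<theta>) ^ k /\<^sub>R fact k)" for k
    by (intro integrable_continuous_bounded[OF \<mu>] continuous_intros)
  have "(\<lambda>n. \<integral>x. (\<Sum>k<n. (x \<bullet> \<theta>) ^ k /\<^sub>R fact k) \<partial>\<mu>) \<longlonglongrightarrow> (\<integral>x. exp (x \<bullet> \<theta>) \<partial>\<mu>)"
  proof (rule integral_dominated_convergence[where w = "\<lambda>_. exp (\<bar>R\<bar> * norm \<theta>)"])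
    show "AE x in \<mu>. (\<lambda>n. \<Sum>k<n. (x \<bullet> \<theta>) ^ k /\<^sub>R fact k) \<longlonglongrightarrow> exp (x \<bullet> \<theta>)"
      by (intro AE_I2 exp_converges[unfolded sums_def])
    show "AE x in \<mu>. norm (\<Sum>k<n. (x \<bullet> \<theta>) ^ k /\<^sub>R fact k) \<le> exp (\<bar>R\<bar> * norm \<theta>)" for n
      using \<mu>(2)
    proof eventually_elim
      case (elim x)
      have "norm (\<Sum>k<n. (x \<bullet> \<theta>) ^ k /\<^sub>R fact k) \<le> (\<Sum>k<n. \<bar>x \<bullet> \<theta>\<bar> ^ k /\<^sub>R fact k)"
        by (intro sum_norm_le) (simp add: power_abs abs_mult)
      also have "\<dots> \<le> exp \<bar>x \<bullet> \<theta>\<bar>"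
        unfolding sums_unique[OF exp_converges]
        by (intro sum_le_suminf sums_summable[OF exp_converges]) auto
      also have "\<bar>x \<bullet> \<theta>\<bar> \<le> norm x * norm \<theta>" by (rule Cauchy_Schwarz_ineq2)
      also have "\<dots> \<le> \<bar>R\<bar> * norm \<theta>" using elim by (intro mult_right_mono) auto
      finally show ?case by simp
    qed
    show "(\<lambda>x. exp (x \<bullet> \<theta>)) \<in> borel_measurable \<mu>"
      by (intro borel_measurable_integrable integrable_continuous_bounded[OF \<mu>] continuous_intros)
    show "(\<lambda>x. \<Sum>k<n. (x \<bullet> \<theta>) ^ k /\<^sub>R fact k) \<in> borel_measurable \<mu>" for n
      by (intro borel_measurable_integrable integrable_continuous_bounded[OF \<mu>] continuous_intros)
  qed simp
  moreover have "(\<integral>x. (\<Sum>k<n. (x \<bullet> \<theta>) ^ k /\<^sub>R fact k) \<partial>\<mu>) = (\<Sum>k<n. proj_moment \<mu> k \<theta> /\<^sub>R fact k)" for n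
    using int by (subst Bochner_Integration.integral_sum) (auto simp: proj_moment_def)
  ultimately show ?thesis by simp
qed

text \<open>The linear span of the exponentials. It is closed under products, and each exponential
  depends on one direction, so its integral is read off from the moments in that direction;
  coordinate monomials would call for mixed moments.\<close>

inductive_set exp_algebra :: "('a::euclidean_space \<Rightarrow> real) set" where
  exp: "(\<lambda>x. exp (x \<bullet> \<theta>)) \<in> exp_algebra"
| add: "f \<in> exp_algebra \<Longrightarrow> g \<in> exp_algebra \<Longrightarrow> (\<lambda>x. f x + g x) \<in> exp_algebra"
| scale: "f \<in> exp_algebra \<Longrightarrow> (\<lambda>x. c * f x) \<in> exp_algebra"

lemma exp_algebra_continuous: "f \<in> exp_algebra \<Longrightarrow> continuous_on S f"
  by (induction rule: exp_algebra.induct) (auto intro!: continuous_intros)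

lemma exp_algebra_mult:
  assumes "f \<in> exp_algebra" "g \<in> exp_algebra"
  shows "(\<lambda>x. f x * g x) \<in> exp_algebra"
  using assms(1)
proof induction
  case (exp \<theta>)
  show ?case using assms(2)
  proof induction
    case (exp \<theta>')
    show ?case using exp_algebra.exp[of "\<theta> + \<theta>'"] by (simp add: inner_add_right exp_add)
  next
    case (add f g)
    then show ?case using exp_algebra.add by (fastforce simp: distrib_left)
  next
    case (scale f c)
    then show ?case using exp_algebra.scale[of _ c] by (simp add: mult.left_commute)
  qed
next
  case (add f h)
  then show ?case using exp_algebra.add by (fastforce simp: distrib_right)
next
  case (scale f c)
  then show ?case using exp_algebra.scale[of _ c] by (simp add: mult.assoc)
qed

lemma exp_algebra_function_ring: "function_ring_on exp_algebra (cball (0::'a::euclidean_space) R)"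
proof
  show "(\<lambda>_. c) \<in> exp_algebra" for c :: real
    using exp_algebra.scale[OF exp_algebra.exp[of 0], of c] by simp
  fix x y :: 'a assume "x \<noteq> y"
  \<comment> \<open>The direction x - y separates the points: the two exponents differ by the
    squared norm of x - y.\<close>
  then have "(x - y) \<bullet> (x - y) \<noteq> 0" by simp
  then have "exp (x \<bullet> (x - y)) \<noteq> exp (y \<bullet> (x - y))" by (simp add: inner_diff_left)
  then show "\<exists>f\<in>exp_algebra. f x \<noteq> f y"
    by (intro bexI[OF _ exp_algebra.exp[of "x - y"]])
qed (auto intro: exp_algebra_continuous exp_algebra_mult exp_algebra.add)

text \<open>Equal Laplace transforms give equal integrals over \<open>exp_algebra\<close>, and
  Stone-Weierstrass extends this to continuous functions, approximated uniformly on the ball that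
  carries both measures.\<close>

lemma measure_eqI_proj_moment:
  fixes \<mu> \<nu> :: "'a::euclidean_space measure"
  assumes \<mu>: "\<mu> \<in> borel_probs" "AE x in \<mu>. norm x \<le> R"
    and \<nu>: "\<nu> \<in> borel_probs" "AE x in \<nu>. norm x \<le> R"
    and eq: "\<And>k \<theta>. proj_moment \<mu> k \<theta> = proj_moment \<nu> k \<theta>"
  shows "\<mu> = \<nu>"
proof (rule measure_eqI_integral_continuous)
  interpret \<mu>: prob_space \<mu> using borel_probsD[OF \<mu>(1)] by simp
  interpret \<nu>: prob_space \<nu> using borel_probsD[OF \<nu>(1)] by simp
  show "prob_space \<mu>" "prob_space \<nu>" "sets \<mu> = sets borel" "sets \<nu> = sets borel"
    using \<mu> \<nu> by (auto simp: borel_probsD)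
  note int = integrable_continuous_bounded[OF \<mu>] integrable_continuous_bounded[OF \<nu>]
  have exp_eq: "(\<integral>x. exp (x \<bullet> \<theta>) \<partial>\<mu>) = (\<integral>x. exp (x \<bullet> \<theta>) \<partial>\<nu>)" for \<theta>
    using LIMSEQ_unique[OF proj_moment_exp_sums[OF \<mu>, of \<theta>]] proj_moment_exp_sums[OF \<nu>, of \<theta>]
    by (simp add: eq)
  have alg_eq: "integral\<^sup>L \<mu> g = integral\<^sup>L \<nu> g" if "g \<in> exp_algebra" for g
    using that by induction (auto simp: exp_eq int exp_algebra_continuous)
  interpret function_ring_on exp_algebra "cball (0::'a) R" by (rule exp_algebra_function_ring)
  fix f :: "'a \<Rightarrow> real" assume f: "continuous_on UNIV f"
  have close: "\<bar>integral\<^sup>L \<mu> f - integral\<^sup>L \<nu> f\<bar> \<le> e" if "e > 0" for e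
  proof -
    obtain g where g: "g \<in> exp_algebra" "\<And>x. norm x \<le> R \<Longrightarrow> \<bar>f x - g x\<bar> < e / 2"
      using Stone_Weierstrass_basic[OF continuous_on_subset[OF f], of "e / 2"] \<open>e > 0\<close> by auto
    have *: "\<bar>integral\<^sup>L \<rho> f - integral\<^sup>L \<rho> g\<bar> \<le> e / 2"
      if \<rho>: "\<rho> \<in> borel_probs" "AE x in \<rho>. norm x \<le> R" for \<rho> :: "'a measure"
    proof -
      interpret \<rho>: prob_space \<rho> using borel_probsD[OF \<rho>(1)] by simp
      have i: "integrable \<rho> f" "integrable \<rho> g"
        by (intro integrable_continuous_bounded[OF \<rho>] f exp_algebra_continuous g(1))+
      have "\<bar>integral\<^sup>L \<rho> f - integral\<^sup>L \<rho> g\<bar> = \<bar>\<integral>x. f x - g x \<partial>\<rho>\<bar>" using i by simp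
      also have "\<dots> \<le> (\<integral>x. \<bar>f x - g x\<bar> \<partial>\<rho>)" by (rule integral_abs_bound)
      also have "\<dots> \<le> (\<integral>x. e / 2 \<partial>\<rho>)"
      proof (rule integral_mono_AE)
        show "AE x in \<rho>. \<bar>f x - g x\<bar> \<le> e / 2"
          using \<rho>(2) by eventually_elim (use g(2) in fastforce)
      qed (use i in auto)
      also have "\<dots> = e / 2" by (simp add: \<rho>.prob_space)
      finally show ?thesis .
    qed
    show ?thesis using *[OF \<mu>] *[OF \<nu>] alg_eq[OF g(1)] by linarith
  qed
  then have "\<bar>integral\<^sup>L \<mu> f - integral\<^sup>L \<nu> f\<bar> \<le> 0" by (rule field_le_epsilon) simp
  then show "integral\<^sup>L \<mu> f = integral\<^sup>L \<nu> f" by simp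
qed

section \<open>Supports\<close>

text \<open>The complement of the support is the union of all null open sets, and Lindelof's theorem
  makes this union countable.\<close>

lemma AE_in_supp:
  fixes \<mu> :: "'a::second_countable_topology measure"
  assumes \<mu>: "\<mu> \<in> borel_probs"
  shows "closed (supp \<mu>)" "AE x in \<mu>. x \<in> supp \<mu>"
proof -
  let ?F = "{U. open U \<and> emeasure \<mu> U = 0}"
  have compl: "- supp \<mu> = \<Union>?F"
    unfolding supp_def by (auto simp: not_gr_zero)
  have "open (- supp \<mu>)" unfolding compl by auto
  then show "closed (supp \<mu>)" by (simp add: closed_def)
  obtain F where F: "F \<subseteq> ?F" "countable F" "\<Union>F = \<Union>?F"
    using Lindelof[of ?F] by blast
  have "U \<in> null_sets \<mu>" if "U \<in> F" for U
    using F(1) that by (intro null_setsI) (auto simp: borel_probsD(1)[OF \<mu>])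
  with F(2) have "(\<Union>U\<in>F. U) \<in> null_sets \<mu>" by (rule null_sets_UN')
  then have "- supp \<mu> \<in> null_sets \<mu>" using F compl by simp
  then have "AE x in \<mu>. x \<notin> - supp \<mu>" by (rule AE_not_in)
  then show "AE x in \<mu>. x \<in> supp \<mu>" by simp
qed

lemma supp_distr_homeomorphism:
  fixes f :: "'a::topological_space \<Rightarrow> 'b::topological_space"
  assumes \<mu>: "\<mu> \<in> borel_probs"
    and f: "continuous_on UNIV f" and g: "continuous_on UNIV g"
    and gf: "\<And>x. g (f x) = x" and fg: "\<And>y. f (g y) = y"
  shows "supp (distr \<mu> borel f) = f ` supp \<mu>"
proof -
  have m: "f \<in> borel_measurable \<mu>"
    by (intro measurable_borel_probs[OF \<mu>] borel_measurable_continuous_onI f)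
  have em: "emeasure (distr \<mu> borel f) U = emeasure \<mu> (f -` U)" if "open U" for U
    using that m by (subst emeasure_distr) (auto simp: borel_probsD(3)[OF \<mu>])
  have iff: "f x \<in> supp (distr \<mu> borel f) \<longleftrightarrow> x \<in> supp \<mu>" for x
  proof
    assume *: "f x \<in> supp (distr \<mu> borel f)"
    show "x \<in> supp \<mu>" unfolding supp_def
    proof safe
      fix U assume U: "open U" "x \<in> U"
      have o: "open (g -` U)" using g U by (auto simp: continuous_on_open_vimage)
      moreover have "f -` g -` U = U" by (auto simp: gf)
      ultimately show "0 < emeasure \<mu> U"
        using * U em[OF o] by (auto simp: supp_def gf)
    qed
  next
    assume *: "x \<in> supp \<mu>"
    show "f x \<in> supp (distr \<mu> borel f)" unfolding supp_def
    proof safe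
      fix U assume U: "open U" "f x \<in> U"
      have "open (f -` U)" using f U by (auto simp: continuous_on_open_vimage)
      then show "0 < emeasure (distr \<mu> borel f) U"
        using * U em[OF U(1)] by (auto simp: supp_def)
    qed
  qed
  show ?thesis
  proof (intro set_eqI iffI)
    fix y assume "y \<in> supp (distr \<mu> borel f)"
    then have "g y \<in> supp \<mu>" using iff[of "g y"] by (simp add: fg)
    then show "y \<in> f ` supp \<mu>" by (rule rev_image_eqI) (simp add: fg)
  qed (use iff in auto)
qed

text \<open>Prepares \<open>isomorphic_for\<close>, where the push-forward starts from the
  restricted measure; the support has full measure.\<close>

lemma distr_restrict_supp:
  fixes f :: "'a::second_countable_topology \<Rightarrow> 'b::topological_space"
  assumes \<mu>: "\<mu> \<in> borel_probs" and f: "f \<in> borel_measurable borel"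
  shows "f \<in> borel_measurable (restrict_space \<mu> (supp \<mu>))"
    "distr (restrict_space \<mu> (supp \<mu>)) borel f = distr \<mu> borel f"
proof -
  have m: "f \<in> borel_measurable \<mu>" by (rule measurable_borel_probs[OF \<mu> f])
  have s: "supp \<mu> \<in> sets \<mu>" using AE_in_supp(1)[OF \<mu>] by (simp add: borel_probsD(1)[OF \<mu>])
  show r: "f \<in> borel_measurable (restrict_space \<mu> (supp \<mu>))" by (rule measurable_restrict_space1[OF m])
  show "distr (restrict_space \<mu> (supp \<mu>)) borel f = distr \<mu> borel f"
  proof (rule measure_eqI)
    fix A assume "A \<in> sets (distr (restrict_space \<mu> (supp \<mu>)) borel f)"
    then have A: "A \<in> sets borel" by simp
    have "emeasure (distr (restrict_space \<mu> (supp \<mu>)) borel f) A = emeasure \<mu> (f -` A \<inter> supp \<mu>)"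
      using s A r borel_probsD(3)[OF \<mu>]
      by (subst emeasure_distr) (auto simp: emeasure_restrict_space space_restrict_space)
    also have "\<dots> = emeasure \<mu> (f -` A \<inter> space \<mu>)"
      using AE_in_supp(2)[OF \<mu>] measurable_sets[OF m A] s borel_probsD(3)[OF \<mu>]
      by (intro emeasure_eq_AE) auto
    also have "\<dots> = emeasure (distr \<mu> borel f) A" by (rule emeasure_distr[OF m A, symmetric])
    finally show "emeasure (distr (restrict_space \<mu> (supp \<mu>)) borel f) A = emeasure (distr \<mu> borel f) A" .
  qed simp
qed

section \<open>From vanishing in almost every direction to one affine map\<close>

text \<open>Comparing first moments, both 0 by centring, shows that the shift c of the isometry
  vanishes; the sign is all that remains.\<close>

lemma proj_moment_eq_up_to_sign:
  fixes \<mu> \<nu> :: "'a::euclidean_space measure"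
  assumes \<mu>: "\<mu> \<in> borel_probs" "AE x in \<mu>. norm x \<le> R" and \<nu>: "\<nu> \<in> borel_probs"
    and centred: "proj_moment \<mu> 1 \<theta> = 0" "proj_moment \<nu> 1 \<theta> = 0"
    and 0: "proj_GW2 \<mu> \<nu> \<theta> = 0"
  shows "\<exists>\<sigma>. \<sigma>\<^sup>2 = 1 \<and> (\<forall>k. proj_moment \<nu> k \<theta> = \<sigma> ^ k * proj_moment \<mu> k \<theta>)"
proof -
  interpret \<mu>: prob_space \<mu> using borel_probsD[OF \<mu>(1)] by simp
  obtain \<sigma> c where \<sigma>: "\<sigma>\<^sup>2 = 1"
    and eq: "distr \<nu> borel (proj \<theta>) = distr \<mu> borel (\<lambda>x. \<sigma> * proj \<theta> x + c)"
    using proj_GW2_eq_0_imp[OF \<mu>(1) \<nu> 0] by blast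
  have m: "proj \<theta> \<in> borel_measurable \<nu>" "(\<lambda>x. \<sigma> * proj \<theta> x + c) \<in> borel_measurable \<mu>"
    by (intro measurable_borel_probs[OF \<nu>] measurable_borel_probs[OF \<mu>(1)]; measurable)+
  have pw: "(\<lambda>s::real. s ^ k) \<in> borel_measurable borel" for k by measurable
  have mom: "proj_moment \<nu> k \<theta> = (\<integral>x. (\<sigma> * (x \<bullet> \<theta>) + c) ^ k \<partial>\<mu>)" for k
    using arg_cong[OF eq, of "\<lambda>P. \<integral>s. s ^ k \<partial>P"]
    unfolding integral_distr[OF m(1) pw] integral_distr[OF m(2) pw] by (simp add: proj_moment_def proj_def)
  have "integrable \<mu> (\<lambda>x. x \<bullet> \<theta>)" using integrable_proj_moment[OF \<mu>, of \<theta> 1] by simp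
  then have "c = 0"
    using mom[of 1] centred by (simp add: proj_moment_def \<mu>.prob_space)
  then have "proj_moment \<nu> k \<theta> = \<sigma> ^ k * proj_moment \<mu> k \<theta>" for k
    unfolding mom by (simp add: proj_moment_def power_mult_distrib)
  with \<sigma> show ?thesis by blast
qed

text \<open>Passes from almost every direction to every one. A point lies on the ray of its radial
  projection, so S has full measure in the unit ball. Being closed, S contains the ball, since
  otherwise it would miss a smaller ball of positive measure; scaling reaches all other
  points.\<close>

lemma AE_sphere_closed_cone:
  fixes S :: "'a::euclidean_space set"
  assumes AE: "AE \<theta> in sphere_unif. \<theta> \<in> S" and closed: "closed S"
    and cone: "\<And>c x. c > 0 \<Longrightarrow> x \<in> S \<Longrightarrow> c *\<^sub>R x \<in> S"
  shows "x \<in> S"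
proof -
  let ?B = "ball (0::'a) 1"
  have B: "emeasure lborel ?B \<noteq> 0" "emeasure lborel ?B < \<infinity>"
    using emeasure_lborel_unit_ball_neq_0 emeasure_lborel_ball_finite by auto
  have m: "(\<lambda>x. x /\<^sub>R norm x) \<in> borel_measurable (uniform_measure lborel ?B)"
    by measurable
  have "AE x in uniform_measure lborel ?B. x /\<^sub>R norm x \<in> S"
    using AE closed unfolding sphere_unif_def by (subst (asm) AE_distr_iff[OF m]) auto
  then have "AE x in uniform_measure lborel ?B. x \<in> S"
  proof eventually_elim
    case (elim x)
    show ?case
    \<comment> \<open>At the centre the radial projection takes the value 0 by the convention for
      division.\<close>
    proof (cases "x = 0")
      case False
      then show ?thesis using cone[OF _ elim, of "norm x"] by simp
    qed (use elim in simp)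
  qed
  then have AE_B: "AE x in lborel. x \<in> ?B \<longrightarrow> x \<in> S"
    using B by (subst (asm) AE_uniform_measure) auto
  have "?B \<subseteq> S"
  proof (rule ccontr)
    assume "\<not> ?B \<subseteq> S"
    then obtain y where "y \<in> ?B - S" by blast
    moreover have "open (?B - S)" using closed by (intro open_Diff) auto
    ultimately obtain e where e: "e > 0" "ball y e \<subseteq> ?B - S" using open_contains_ball by metis
    have "AE x in lborel. x \<notin> ball y e" using AE_B by eventually_elim (use e in auto)
    then have "emeasure lborel (ball y e) = 0" by (subst (asm) AE_iff_measurable[of "ball y e"]) auto
    then show False using content_ball_pos[OF e(1), of y] by (simp add: measure_def)
  qed
  \<comment> \<open>The added 1 puts the scaled vector strictly inside the ball and admits x =
    0.\<close>
  have pos: "norm x + 1 > 0" using norm_ge_zero[of x] by linarith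
  then have "(1 / (norm x + 1)) *\<^sub>R x \<in> ?B" by (simp add: field_simps)
  with \<open>?B \<subseteq> S\<close> have "(1 / (norm x + 1)) *\<^sub>R x \<in> S" by blast
  from cone[OF pos this] pos show ?thesis by simp
qed

text \<open>The signs found direction by direction agree, because on a line through two directions
  that refute the two signs the moment differences are polynomials whose product vanishes.\<close>

lemma proj_moment_global_sign:
  fixes \<mu> \<nu> :: "'a::euclidean_space measure"
  assumes \<mu>: "\<mu> \<in> borel_probs" "AE x in \<mu>. norm x \<le> R" and \<nu>: "\<nu> \<in> borel_probs" "AE x in \<nu>. norm x \<le> R"
    and loc: "\<And>\<theta>. \<exists>\<sigma>. \<sigma>\<^sup>2 = 1 \<and> (\<forall>k. proj_moment \<nu> k \<theta> = \<sigma> ^ k * proj_moment \<mu> k \<theta>)"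
  shows "\<exists>\<sigma>. \<sigma>\<^sup>2 = 1 \<and> (\<forall>k \<theta>. proj_moment \<nu> k \<theta> = \<sigma> ^ k * proj_moment \<mu> k \<theta>)"
proof (rule ccontr)
  assume neg: "\<not> ?thesis"
  have "\<exists>k u. proj_moment \<nu> k u \<noteq> \<sigma> ^ k * proj_moment \<mu> k u" if "\<sigma>\<^sup>2 = 1" for \<sigma>
    using neg that by blast
  \<comment> \<open>The direction u refutes the sign 1 and v the sign -1. On the joining line they
    sit at s = 0 and s = 1, where P and Q respectively are nonzero.\<close>
  from this[of 1] this[of "-1"] obtain k u l v
    where k: "proj_moment \<nu> k u \<noteq> proj_moment \<mu> k u" and l: "proj_moment \<nu> l v \<noteq> (-1) ^ l * proj_moment \<mu> l v"
    by auto
  have "\<exists>P. \<forall>s. proj_moment \<nu> k (u + s *\<^sub>R (v - u)) - \<sigma> ^ k * proj_moment \<mu> k (u + s *\<^sub>R (v - u)) = poly P s"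
    for k and \<sigma> :: real
  proof -
    obtain P Q where "\<forall>s. proj_moment \<nu> k (u + s *\<^sub>R (v - u)) = poly P s"
      "\<forall>s. proj_moment \<mu> k (u + s *\<^sub>R (v - u)) = poly Q s"
      using proj_moment_line[OF \<mu>] proj_moment_line[OF \<nu>] by metis
    then show ?thesis by (intro exI[of _ "P - smult (\<sigma> ^ k) Q"]) simp
  qed
  from this[of k 1] this[of l "-1"] obtain P Q where
    P: "\<And>s. proj_moment \<nu> k (u + s *\<^sub>R (v - u)) - proj_moment \<mu> k (u + s *\<^sub>R (v - u)) = poly P s" and
    Q: "\<And>s. proj_moment \<nu> l (u + s *\<^sub>R (v - u)) - (-1) ^ l * proj_moment \<mu> l (u + s *\<^sub>R (v - u)) = poly Q s"
    by auto
  \<comment> \<open>Whichever sign holds at this direction makes one of the factors vanish.\<close>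
  have "poly (P * Q) s = 0" for s
  proof -
    obtain \<sigma> where \<sigma>: "\<sigma>\<^sup>2 = 1" "\<And>k. proj_moment \<nu> k (u + s *\<^sub>R (v - u)) = \<sigma> ^ k * proj_moment \<mu> k (u + s *\<^sub>R (v - u))"
      using loc by blast
    have "\<sigma> = 1 \<or> \<sigma> = -1" using \<sigma>(1) by (simp add: power2_eq_1_iff)
    then show ?thesis using P[of s] Q[of s] \<sigma>(2)[of k] \<sigma>(2)[of l] by auto
  qed
  then have "P * Q = 0" using poly_all_0_iff_0 by blast
  then have "P = 0 \<or> Q = 0" by simp
  then show False using P[of 0] Q[of 1] k l by auto
qed

text \<open>Translation invariance allows both measures to be centred. For these the global sign
  \<sigma> gives the moments of the image under scaling by \<sigma>, so that image is the other
  measure; undoing the centring restores the shifts.\<close>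

lemma SGW_eq_0_imp_affine:
  fixes \<mu> \<nu> :: "(real^'n) measure"
  assumes \<mu>: "\<mu> \<in> borel_probs" "AE x in \<mu>. norm x \<le> R" and \<nu>: "\<nu> \<in> borel_probs" "AE x in \<nu>. norm x \<le> R"
    and SGW: "SGW \<mu> \<nu> = 0"
  shows "\<exists>\<sigma> a b. \<bar>\<sigma>\<bar> = 1 \<and> \<nu> = distr \<mu> borel (\<lambda>x. \<sigma> *\<^sub>R (x - a) + b)"
proof -
  have centre: "\<exists>S a. translate a \<rho> \<in> borel_probs \<and> (AE x in translate a \<rho>. norm x \<le> S) \<and>
      (\<forall>\<theta>. proj_moment (translate a \<rho>) 1 \<theta> = 0)"
    if \<rho>: "\<rho> \<in> borel_probs" "AE x in \<rho>. norm x \<le> R" for \<rho> :: "(real^'n) measure"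
  proof -
    interpret prob_space \<rho> using borel_probsD[OF \<rho>(1)] by simp
    define a where "a = (\<integral>x. x \<partial>\<rho>)"
    have m: "(\<lambda>x. x + - a) \<in> borel_measurable \<rho>"
      by (intro measurable_borel_probs[OF \<rho>(1)]) measurable
    have i: "integrable \<rho> (\<lambda>x. x)" by (intro integrable_continuous_bounded[OF \<rho>] continuous_on_id)
    have "AE x in \<rho>. norm (x + - a) \<le> R + norm a"
      using \<rho>(2)
    proof eventually_elim
      case (elim x)
      then show ?case using norm_triangle_ineq[of x "- a"] by simp
    qed
    then have "AE x in translate (- a) \<rho>. norm x \<le> R + norm a"
      unfolding translate_def by (subst AE_distr_iff[OF m]) auto
    moreover have "proj_moment (translate (- a) \<rho>) 1 \<theta> = 0" for \<theta>
    proof -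
      have "proj_moment (translate (- a) \<rho>) 1 \<theta> = (\<integral>x. (x + - a) \<bullet> \<theta> \<partial>\<rho>)"
        unfolding proj_moment_def translate_def power_one_right by (rule integral_distr[OF m]) measurable
      also have "\<dots> = (\<integral>x. x \<bullet> \<theta> \<partial>\<rho>) - a \<bullet> \<theta>"
        using i by (simp add: inner_diff_left prob_space)
      also have "(\<integral>x. x \<bullet> \<theta> \<partial>\<rho>) = a \<bullet> \<theta>" using i by (simp add: a_def)
      finally show ?thesis by simp
    qed
    ultimately show ?thesis using translate_borel_probs[OF \<rho>(1)] by blast
  qed
  obtain S1 a where a: "translate a \<mu> \<in> borel_probs" "AE x in translate a \<mu>. norm x \<le> S1"
    "\<And>\<theta>. proj_moment (translate a \<mu>) 1 \<theta> = 0" using centre[OF \<mu>] by blast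
  obtain S2 b where b: "translate b \<nu> \<in> borel_probs" "AE x in translate b \<nu>. norm x \<le> S2"
    "\<And>\<theta>. proj_moment (translate b \<nu>) 1 \<theta> = 0" using centre[OF \<nu>] by blast
  define \<mu>' where "\<mu>' = translate a \<mu>"
  define \<nu>' where "\<nu>' = translate b \<nu>"
  define S where "S = max S1 S2"
  have \<mu>': "\<mu>' \<in> borel_probs" "AE x in \<mu>'. norm x \<le> S" "\<And>\<theta>. proj_moment \<mu>' 1 \<theta> = 0"
  proof -
    show "AE x in \<mu>'. norm x \<le> S"
      using a(2) unfolding \<mu>'_def S_def by eventually_elim simp
  qed (use a in \<open>simp_all only: \<mu>'_def\<close>)
  have \<nu>': "\<nu>' \<in> borel_probs" "AE x in \<nu>'. norm x \<le> S" "\<And>\<theta>. proj_moment \<nu>' 1 \<theta> = 0"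
  proof -
    show "AE x in \<nu>'. norm x \<le> S"
      using b(2) unfolding \<nu>'_def S_def by eventually_elim simp
  qed (use b in \<open>simp_all only: \<nu>'_def\<close>)
  \<comment> \<open>For each sign the condition defines a closed cone. The union for the two signs
    has full measure on the sphere, hence is the whole space.\<close>
  define C where "C \<sigma> = {\<theta>. \<forall>k. proj_moment \<nu>' k \<theta> = \<sigma> ^ k * proj_moment \<mu>' k \<theta>}" for \<sigma>
  have "closed (C \<sigma>)" for \<sigma>
    unfolding C_def
    by (intro closed_Collect_all closed_Collect_eq continuous_intros
        proj_moment_continuous[OF \<mu>'(1,2)] proj_moment_continuous[OF \<nu>'(1,2)])
  then have closed: "closed (C 1 \<union> C (- 1))" by blast
  have C_iff: "\<theta> \<in> C 1 \<union> C (- 1) \<longleftrightarrow> (\<exists>\<sigma>. \<sigma>\<^sup>2 = 1 \<and> (\<forall>k. proj_moment \<nu>' k \<theta> = \<sigma> ^ k * proj_moment \<mu>' k \<theta>))" for \<theta>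
    unfolding C_def power2_eq_1_iff by blast
  have "(\<integral>\<^sup>+\<theta>. (proj_GW2 \<mu>' \<nu>' \<theta>)\<^sup>2 \<partial>sphere_unif) = 0"
    using SGW \<mu>(1) \<nu>(1) by (simp add: SGW_eq \<mu>'_def \<nu>'_def proj_GW2_translate translate_borel_probs)
  moreover have "(\<lambda>\<theta>. (proj_GW2 \<mu>' \<nu>' \<theta>)\<^sup>2) \<in> borel_measurable sphere_unif"
    using proj_GW2_measurable[OF \<mu>'(1) \<nu>'(1)] by measurable
  ultimately have "AE \<theta> in sphere_unif. (proj_GW2 \<mu>' \<nu>' \<theta>)\<^sup>2 = 0"
    using nn_integral_0_iff_AE by blast
  then have AE: "AE \<theta> in sphere_unif. \<theta> \<in> C 1 \<union> C (- 1)"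
  proof eventually_elim
    case (elim \<theta>)
    then show ?case unfolding C_iff
      by (intro proj_moment_eq_up_to_sign[OF \<mu>'(1,2) \<nu>'(1) \<mu>'(3) \<nu>'(3)]) simp
  qed
  have "\<theta> \<in> C 1 \<union> C (- 1)" for \<theta>
  proof (rule AE_sphere_closed_cone[OF AE closed])
    show "c *\<^sub>R x \<in> C 1 \<union> C (- 1)" if "c > 0" "x \<in> C 1 \<union> C (- 1)" for c x
      using that(2) by (auto simp: C_def proj_moment_scale)
  qed
  then obtain \<sigma> where \<sigma>: "\<sigma>\<^sup>2 = 1" "\<And>k \<theta>. proj_moment \<nu>' k \<theta> = \<sigma> ^ k * proj_moment \<mu>' k \<theta>"
    using proj_moment_global_sign[OF \<mu>'(1,2) \<nu>'(1,2)] unfolding C_iff by blast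
  have abs: "\<bar>\<sigma>\<bar> = 1" using \<sigma>(1) by (auto simp: power2_eq_1_iff)
  have m: "(\<lambda>x. \<sigma> *\<^sub>R x) \<in> borel_measurable \<mu>'"
    by (intro measurable_borel_probs[OF \<mu>'(1)]) measurable
  have "\<nu>' = distr \<mu>' borel (\<lambda>x. \<sigma> *\<^sub>R x)"
  proof (rule measure_eqI_proj_moment[OF \<nu>'(1,2)])
    show "distr \<mu>' borel (\<lambda>x. \<sigma> *\<^sub>R x) \<in> borel_probs" by (intro distr_borel_probs \<mu>'(1)) measurable
    show "AE x in distr \<mu>' borel (\<lambda>x. \<sigma> *\<^sub>R x). norm x \<le> S"
      using \<mu>'(2) by (subst AE_distr_iff[OF m]) (auto simp: abs)
    show "proj_moment \<nu>' k \<theta> = proj_moment (distr \<mu>' borel (\<lambda>x. \<sigma> *\<^sub>R x)) k \<theta>" for k \<theta>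
    proof -
      have "proj_moment (distr \<mu>' borel (\<lambda>x. \<sigma> *\<^sub>R x)) k \<theta> = (\<integral>x. ((\<sigma> *\<^sub>R x) \<bullet> \<theta>) ^ k \<partial>\<mu>')"
        unfolding proj_moment_def by (rule integral_distr[OF m]) measurable
      also have "\<dots> = \<sigma> ^ k * proj_moment \<mu>' k \<theta>"
        by (simp add: proj_moment_def power_mult_distrib)
      finally show ?thesis by (simp only: \<sigma>(2))
    qed
  qed
  have m1: "(\<lambda>x. x + a) \<in> borel_measurable \<mu>" "(\<lambda>x. \<sigma> *\<^sub>R (x + a)) \<in> borel_measurable \<mu>"
    by (intro measurable_borel_probs[OF \<mu>(1)]; measurable)+
  have m2: "(\<lambda>x. x + b) \<in> borel_measurable \<nu>" by (intro measurable_borel_probs[OF \<nu>(1)]) measurable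
  have "distr \<nu>' borel (\<lambda>x. x + - b) = distr \<nu> borel (\<lambda>x. x)"
    unfolding \<nu>'_def translate_def using m2 by (subst distr_distr) (auto simp: comp_def)
  then have "\<nu> = distr \<nu>' borel (\<lambda>x. x + - b)" by (simp add: distr_id_borel_probs[OF \<nu>(1)])
  also have "\<nu>' = distr \<mu> borel (\<lambda>x. \<sigma> *\<^sub>R (x + a))"
    unfolding \<open>\<nu>' = distr \<mu>' borel (\<lambda>x. \<sigma> *\<^sub>R x)\<close> \<mu>'_def translate_def
    using m1(1) by (subst distr_distr) (auto simp: comp_def)
  \<comment> \<open>Here a and b are the centring shifts, that is, the negatives of the barycentres;
    hence the minus signs.\<close>
  also have "distr \<dots> borel (\<lambda>x. x + - b) = distr \<mu> borel (\<lambda>x. \<sigma> *\<^sub>R (x - (- a)) + (- b))"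
    using m1(2) by (subst distr_distr) (auto simp: comp_def)
  finally show ?thesis using abs by blast
qed

text \<open>The affine map multiplies all coordinate differences by one sign and so preserves
  \<open>l1_dist\<close>; its inverse has the same form because \<sigma> * \<sigma> = 1. The
  coupling on its graph gives the value 0 of \<open>GW2\<close>.\<close>

lemma SGW_eq_0_isomorphic:
  fixes \<mu> \<nu> :: "(real^'n) measure"
  assumes \<mu>: "\<mu> \<in> borel_probs" and \<nu>: "\<nu> \<in> borel_probs"
    and compact: "compact (supp \<mu>)" "compact (supp \<nu>)" and SGW: "SGW \<mu> \<nu> = 0"
  shows "isomorphic_for l1_dist \<mu> \<nu>" "GW2 l1_dist l1_dist \<mu> \<nu> = 0"
proof -
  obtain R1 where R1: "\<And>x. x \<in> supp \<mu> \<Longrightarrow> norm x \<le> R1"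
    using compact_imp_bounded[OF compact(1)] by (auto simp: bounded_iff)
  obtain R2 where R2: "\<And>x. x \<in> supp \<nu> \<Longrightarrow> norm x \<le> R2"
    using compact_imp_bounded[OF compact(2)] by (auto simp: bounded_iff)
  have "AE x in \<mu>. norm x \<le> max R1 R2"
    using AE_in_supp(2)[OF \<mu>] by eventually_elim (use R1 in fastforce)
  moreover have "AE x in \<nu>. norm x \<le> max R1 R2"
    using AE_in_supp(2)[OF \<nu>] by eventually_elim (use R2 in fastforce)
  ultimately obtain \<sigma> a b where \<sigma>: "\<bar>\<sigma>\<bar> = 1" and \<nu>_eq: "\<nu> = distr \<mu> borel (\<lambda>x. \<sigma> *\<^sub>R (x - a) + b)"
    using SGW_eq_0_imp_affine[OF \<mu> _ \<nu> _ SGW] by blast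
  define f where "f = (\<lambda>x. \<sigma> *\<^sub>R (x - a) + b)"
  define g where "g = (\<lambda>y. \<sigma> *\<^sub>R (y - b) + a)"
  have "\<sigma> * \<sigma> = 1" using \<sigma> by (metis abs_mult_self_eq mult_1)
  then have gf: "g (f x) = x" and fg: "f (g x) = x" for x by (auto simp: f_def g_def)
  have cf: "continuous_on UNIV f" and cg: "continuous_on UNIV g"
    unfolding f_def g_def by (intro continuous_intros)+
  have f: "f \<in> borel_measurable borel" by (rule borel_measurable_continuous_onI[OF cf])
  have iso: "l1_dist (f x) (f y) = l1_dist x y" for x y
  proof -
    have "f x $ i - f y $ i = \<sigma> * (x $ i - y $ i)" for i by (simp add: f_def algebra_simps)
    then show ?thesis by (simp add: l1_dist_def abs_mult \<sigma>)
  qed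
  have supp: "supp \<nu> = f ` supp \<mu>"
    unfolding \<nu>_eq f_def[symmetric] by (rule supp_distr_homeomorphism[OF \<mu> cf cg gf fg])
  have "inj f" by (rule inj_on_inverseI[of _ g]) (rule gf)
  then have "bij_betw f (supp \<mu>) (supp \<nu>)"
    unfolding supp by (intro inj_on_imp_bij_betw inj_on_subset[OF \<open>inj f\<close>]) auto
  then show "isomorphic_for l1_dist \<mu> \<nu>"
    using distr_restrict_supp[OF \<mu> f] iso \<nu>_eq unfolding isomorphic_for_def f_def[symmetric] by auto
  have l1: "case_prod l1_dist \<in> borel_measurable (borel :: ((real^'n) \<times> (real^'n)) measure)"
    unfolding l1_dist_def case_prod_beta by (intro borel_measurable_continuous_onI continuous_intros)
  show "GW2 l1_dist l1_dist \<mu> \<nu> = 0"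
    unfolding \<nu>_eq f_def[symmetric] by (rule GW2_eq_0_map[OF \<mu> f l1 l1 iso])
qed

theorem theorem4p1p3:
  shows
    "\<comment> \<open>(i) translation invariance\<close>
     (\<forall>(\<Delta> :: real^'p^'q). \<forall>\<mu>\<in>borel_probs. \<forall>\<nu>\<in>borel_probs. \<forall>a b.
        SGW_lin \<Delta> (translate a \<mu>) \<nu> = SGW_lin \<Delta> \<mu> \<nu> \<and>
        SGW_lin \<Delta> \<mu> (translate b \<nu>) = SGW_lin \<Delta> \<mu> \<nu>) \<and>
     (CARD('p) \<le> CARD('q) \<longrightarrow>
        (\<forall>(\<mu> :: (real^'p) measure)\<in>borel_probs. \<forall>(\<nu> :: (real^'q) measure)\<in>borel_probs. \<forall>a b.
           RISGW (translate a \<mu>) \<nu> = RISGW \<mu> \<nu> \<and>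
           RISGW \<mu> (translate b \<nu>) = RISGW \<mu> \<nu>)) \<and>
     \<comment> \<open>(i) rotation invariance for \<open>p = q\<close>\<close>
     (\<forall>(\<mu> :: (real^'p) measure)\<in>borel_probs. \<forall>(\<nu> :: (real^'p) measure)\<in>borel_probs.
        \<forall>(Q :: real^'p^'p). orthogonal_matrix Q \<longrightarrow>
          RISGW (lin_push Q \<mu>) \<nu> = RISGW \<mu> \<nu> \<and>
          RISGW \<mu> (lin_push Q \<nu>) = RISGW \<mu> \<nu>) \<and>
     \<comment> \<open>(ii) symmetry, vanishing on the diagonal, triangle inequality (for the square roots)\<close>
     (\<forall>(\<mu> :: (real^'p) measure)\<in>borel_probs. \<forall>\<nu>\<in>borel_probs.
        SGW \<mu> \<nu> = SGW \<nu> \<mu> \<and> RISGW \<mu> \<nu> = RISGW \<nu> \<mu>) \<and>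
     (\<forall>(\<mu> :: (real^'p) measure)\<in>borel_probs. SGW \<mu> \<mu> = 0 \<and> RISGW \<mu> \<mu> = 0) \<and>
     (\<forall>(\<mu> :: (real^'p) measure)\<in>borel_probs. \<forall>(\<nu> :: (real^'p) measure)\<in>borel_probs.
        \<forall>(\<rho> :: (real^'p) measure)\<in>borel_probs.
          ennreal_sqrt (SGW \<mu> \<rho>) \<le> ennreal_sqrt (SGW \<mu> \<nu>) + ennreal_sqrt (SGW \<nu> \<rho>) \<and>
          ennreal_sqrt (RISGW \<mu> \<rho>) \<le> ennreal_sqrt (RISGW \<mu> \<nu>) + ennreal_sqrt (RISGW \<nu> \<rho>)) \<and>
     \<comment> \<open>(iii)\<close>
     (\<forall>(\<mu> :: (real^'p) measure)\<in>borel_probs. \<forall>(\<nu> :: (real^'p) measure)\<in>borel_probs.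
        compact (supp \<mu>) \<longrightarrow> compact (supp \<nu>) \<longrightarrow> SGW \<mu> \<nu> = 0 \<longrightarrow>
          isomorphic_for l1_dist \<mu> \<nu> \<and> GW2 l1_dist l1_dist \<mu> \<nu> = 0)"
  by (intro conjI allI ballI impI)
    ((rule SGW_lin_translate RISGW_translate RISGW_rotate RISGW_rotate_right SGW_commute RISGW_commute
        SGW_self RISGW_self SGW_triangle RISGW_triangle SGW_eq_0_isomorphic; assumption)+)

end
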